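(* Let $V$ be a superspace of dimension $n|m$, $0\le r\le n$, $0\le s\le m$. The super Plücker relations for the homogeneous coordinates $$u^{a_1\ldots a_r|\hat\mu_1\ldots\hat\mu_s}\ (\text{even}),\quad u^{a_1\ldots a_{r-1}\hat\nu|\hat\mu_1\ldots\hat\mu_s}\ (\text{odd}),\quad u^{*a_1\ldots a_r|\hat\mu_1\ldots\hat\mu_s}\ (\text{even}),\quad u^{*a_1\ldots a_r|b\hat\mu_1\ldots\hat\mu_{s-1}}\ (\text{odd})$$ on $P^{\mathrm{fin}}_{1,-1}\bigl(\Lambda^{r|s}(V)\oplus\Lambda^{s|r}(\Pi V)\bigr)$, i.e. the relations specifying the image of the super Plücker map $G_{r|s}(V)\to P^{\mathrm{fin}}_{1,-1}\bigl(\Lambda^{r|s}(V)\oplus\Lambda^{s|r}(\Pi V)\bigr)$, are the following, for all combinations of indices (where $\underline a=a_1\ldots a_r$, $\underline b=b_1\ldots b_r$, $\underline{\hat\mu}=\hat\mu_1\ldots\hat\mu_s$, $\underline{\hat\nu}=\hat\nu_1\ldots\hat\nu_s$): $$u^{\underline a|\underline{\hat\mu}}\,u^{*\underline a|\underline{\hat\mu}}=1,$$ $$\operatorname{Ber}\begin{pmatrix}X_{i}{}^{b_j}&X_{i}{}^{\hat\nu_\beta}\\ Y_{\alpha}{}^{b_j}&Y_{\alpha}{}^{\hat\nu_\beta}\end{pmatrix}_{i,j=1..r;\ \alpha,\beta=1..s}=(u^{\underline a|\underline{\hat\mu}})^{r+s-1}\,u^{\underline b|\underline{\hat\nu}},$$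 $$\operatorname{Ber}\begin{pmatrix}X_i{}^{b_j}&X_i{}^{\hat\lambda}&\Big|&X_i{}^{\hat\nu_\beta}\\ Y_\alpha{}^{b_j}&Y_\alpha{}^{\hat\lambda}&\Big|&Y_\alpha{}^{\hat\nu_\beta}\end{pmatrix}_{i=1..r,\ j=1..r-1;\ \alpha,\beta=1..s}=(u^{\underline a|\underline{\hat\mu}})^{r+s-1}\,u^{b_1\ldots b_{r-1}\hat\lambda|\underline{\hat\nu}},$$ $$\operatorname{Ber}^*\begin{pmatrix}X_i{}^{b_j}&\Big|&X_i{}^{c}&X_i{}^{\hat\nu_\beta}\\ Y_\alpha{}^{b_j}&\Big|&Y_\alpha{}^{c}&Y_\alpha{}^{\hat\nu_\beta}\end{pmatrix}_{i,j=1..r;\ \alpha=1..s,\ \beta=1..s-1}=(u^{\underline a|\underline{\hat\mu}})^{-r-s+1}\,u^{*b_1\ldots b_r|c\hat\nu_1\ldots\hat\nu_{s-1}}.$$ Here, for any index $d$ (even or odd), $$X_i{}^{d}:=u^{a_1\ldots a_{i-1}\,d\,a_{i+1}\ldots a_r|\underline{\hat\mu}},\qquad Y_\alpha{}^{d}:=u^{*\underline a|\hat\mu_1\ldots\hat\mu_{\alpha-1}\,d\,\hat\mu_{\alpha+1}\ldots\hat\mu_s};$$ $i,\alpha$ label rows ($i$ even rows, $\alpha$ odd rows) and $j,\beta$ label columns. The first $r$ columns are in even positions and the last $s$ in odd positions; in the third relation the column with index $\hat\lambda$ is a "wrong parity" column in the last even position, and in the fourth the column with index $c$ is a "wrong parity"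 column in the first odd position.
   Context: All objects are taken over arbitrary commutative superalgebras. For an even square supermatrix $g=\begin{pmatrix}g_{00}&g_{01}\\ g_{10}&g_{11}\end{pmatrix}$, $\operatorname{Ber}g=\det(g_{00}-g_{01}g_{11}^{-1}g_{10})/\det g_{11}$, and $\operatorname{Ber}^*g:=\operatorname{Ber}(g^\Pi)=\det(g_{11}-g_{10}g_{00}^{-1}g_{01})/\det g_{00}$ ($g^\Pi$: parities of all rows and columns reversed). $\operatorname{Ber}$ is multilinear in the even columns and by multilinearity is extended to one column of the opposite ("wrong") parity in an even position; $\operatorname{Ber}^*$ is multilinear in the odd columns and is similarly extended to one wrong-parity column in an odd position (the same formulas apply; the values are then odd). $G_{r|s}(V)$ is the super Grassmannian: the quotient by the left action of $\mathrm{GL}(r|s)$ of the supermanifold of even $(r|s)\times(n|m)$ matrices $U$ containing an invertible $(r|s)\times(r|s)$ submatrix; even columns of $U$ are labeled by $a\in\{1,\dots,n\}$, odd columns by $\hat\mu\in\{\hat 1,\dots,\hat m\}$. Let $U^{d_1\ldots d_r|d'_1\ldots d'_s}$ be the square matrix formed by the indicated columns of $U$, the first $r$ put in even positions and the last $s$ in odd positions. $P^{\mathrm{fin}}_{1,-1}(\Lambda^{r|s}(V)\oplus\Lambda^{s|r}(\Pi V))$ is the weighted projective superspace with the homogeneous coordinates listed in the claim (initially for increasing $a$'s and increasing $\mu$'s, with $\hat\nu\notin\{\hat\mu_1,\dots,\hat\mu_s\}$, $b\notin\{a_1,\dots,a_r\}$), where the unstarred coordinates have weight $+1$ and the starred ones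 weight $-1$: $(u,u^* )\sim(\lambda u,\lambda^{-1}u^* )$ for even invertible $\lambda$. The notation is extended by antisymmetry within the first $r$ positions and within the last $s$ positions, with $u^{\ldots\hat\nu\ldots|\underline{\hat\mu}}=0$ if $\hat\nu\in\{\hat\mu_1,\dots,\hat\mu_s\}$ and $u^{*\underline a|\ldots b\ldots}=0$ if $b\in\{a_1,\dots,a_r\}$; in unstarred symbols $\hat\mu_1,\dots,\hat\mu_s$ are distinct and in starred symbols $a_1,\dots,a_r$ are distinct. The super Plücker map $G_{r|s}(V)\to P^{\mathrm{fin}}_{1,-1}$ is the (rational) map $$u^{\underline a|\underline{\hat\mu}}=\operatorname{Ber}U^{\underline a|\underline{\hat\mu}},\quad u^{a_1\ldots a_{r-1}\hat\nu|\underline{\hat\mu}}=\operatorname{Ber}U^{a_1\ldots a_{r-1}\hat\nu|\underline{\hat\mu}},\quad u^{*\underline a|\underline{\hat\mu}}=\operatorname{Ber}^*U^{\underline a|\underline{\hat\mu}},\quad u^{*\underline a|b\hat\mu_1\ldots\hat\mu_{s-1}}=\operatorname{Ber}^*U^{\underline a|b\hat\mu_1\ldots\hat\mu_{s-1}}.$$ It is considered where the denominators involved are invertible, i.e. where $\operatorname{Ber}U^{\underline a|\underline{\hat\mu}}$, $\operatorname{Ber}U^{a_1\ldots a_{r-1}\hat\nu|\underline{\hat\mu}}$, $\operatorname{Ber}^*U^{\underline a|\underline{\hat\mu}}$ and $\operatorname{Ber}^*U^{\underline a|b\hat\mu_1\ldots\hat\mu_{s-1}}$ are defined for all combinations of indices;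 likewise the relations are understood as including that the Berezinians occurring in them are defined. *)

theory Defs
  imports "Jordan_Normal_Form.Matrix" "HOL-Combinatorics.Permutations"
begin

section \<open>Commutative superalgebras\<close>

text \<open>
  \<open>A False\<close> is the even part and \<open>A True\<close> the odd part of the ring \<open>'a\<close>, so that addition of
  parities is \<open>\<noteq>\<close> on \<^typ>\<open>bool\<close>.  No ground field is fixed: forgetting the scalars turns every
  commutative superalgebra into such a ring.  The condition \<open>x * x = 0\<close> for odd \<open>x\<close> follows from
  the sign rule as soon as 2 is invertible; it is the standard requirement otherwise.
\<close>

definition comm_superalgebra :: "(bool \<Rightarrow> 'a::ring_1 set) \<Rightarrow> bool" where
  "comm_superalgebra A \<longleftrightarrow>
     (\<forall>p. 0 \<in> A p \<and> (\<forall>x\<in>A p. \<forall>y\<in>A p. x + y \<in> A p \<and> - x \<in> A p)) \<and>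
     (\<forall>z. \<exists>!w. fst w \<in> A False \<and> snd w \<in> A True \<and> z = fst w + snd w) \<and>
     1 \<in> A False \<and>
     (\<forall>p q. \<forall>x\<in>A p. \<forall>y\<in>A q. x * y \<in> A (p \<noteq> q) \<and> x * y = (if p \<and> q then - (y * x) else y * x)) \<and>
     (\<forall>x\<in>A True. x * x = 0)"

definition is_inverse :: "'a::ring_1 \<Rightarrow> 'a \<Rightarrow> bool" where
  "is_inverse x y \<longleftrightarrow> x * y = 1 \<and> y * x = 1"

definition invertible_elem :: "'a::ring_1 \<Rightarrow> bool" where
  "invertible_elem x \<longleftrightarrow> (\<exists>y. is_inverse x y)"

definition inv_elem :: "'a::ring_1 \<Rightarrow> 'a" where
  "inv_elem x = (THE y. is_inverse x y)"

definition zpow :: "'a::ring_1 \<Rightarrow> int \<Rightarrow> 'a" where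
  "zpow x k = (if k \<ge> 0 then x ^ nat k else inv_elem x ^ nat (- k))"

section \<open>Determinants and Berezinians\<close>

definition inv_matrix :: "'a::ring_1 mat \<Rightarrow> 'a mat" where
  "inv_matrix M = (THE N. N \<in> carrier_mat (dim_row M) (dim_row M) \<and> inverts_mat M N \<and> inverts_mat N M)"

text \<open>
  The library determinant requires a commutative ring.  Below, the columns consist of even
  elements except for at most one column of odd elements, so the entries in each product commute
  and the order of the factors (here: the order of the columns) is immaterial.
\<close>

definition sdet :: "'a::ring_1 mat \<Rightarrow> 'a" where
  "sdet M = (\<Sum>p | p permutes {..<dim_col M}.
     of_int (sign p) * prod_list (map (\<lambda>j. M $$ (p j, j)) [0..<dim_col M]))"

definition Ber_blocks :: "'a::ring_1 mat \<Rightarrow> 'a mat \<Rightarrow> 'a mat \<Rightarrow> 'a mat \<Rightarrow> 'a" where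
  "Ber_blocks g00 g01 g10 g11 = sdet (g00 - g01 * inv_matrix g11 * g10) * inv_elem (sdet g11)"

text \<open>
  The first \<open>r\<close> rows and columns of \<open>g\<close> are in even positions, the remaining ones in odd positions.
  The same formulas are used when one column in an even position (for \<open>Ber\<close>), respectively in an
  odd position (for \<open>Ber_star\<close>), has the wrong parity.
\<close>

definition Ber :: "nat \<Rightarrow> 'a::ring_1 mat \<Rightarrow> 'a" where
  "Ber r g = (case split_block g r r of (g00, g01, g10, g11) \<Rightarrow> Ber_blocks g00 g01 g10 g11)"

definition Ber_defined :: "nat \<Rightarrow> 'a::ring_1 mat \<Rightarrow> bool" where
  "Ber_defined r g \<longleftrightarrow> (case split_block g r r of (g00, g01, g10, g11) \<Rightarrow> invertible_mat g11)"

definition Ber_star :: "nat \<Rightarrow> 'a::ring_1 mat \<Rightarrow> 'a" where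
  "Ber_star r g = (case split_block g r r of (g00, g01, g10, g11) \<Rightarrow> Ber_blocks g11 g10 g01 g00)"

definition Ber_star_defined :: "nat \<Rightarrow> 'a::ring_1 mat \<Rightarrow> bool" where
  "Ber_star_defined r g \<longleftrightarrow> (case split_block g r r of (g00, g01, g10, g11) \<Rightarrow> invertible_mat g00)"

section \<open>Indices\<close>

text \<open>
  Column indices are \<open>0, \<dots>, n + m - 1\<close>: those below \<open>n\<close> are the even indices, and \<open>n + k\<close>
  stands for the odd index written \<open>k + 1\<close> with a hat.  A symbol \<open>d\<^sub>1 \<dots> d\<^sub>r | d'\<^sub>1 \<dots> d'\<^sub>s\<close> is a pair of
  lists.
\<close>

definition even_inds :: "nat \<Rightarrow> nat set" where
  "even_inds n = {..<n}"

definition odd_inds :: "nat \<Rightarrow> nat \<Rightarrow> nat set" where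
  "odd_inds n m = {n..<n + m}"

definition tuples :: "nat set \<Rightarrow> nat \<Rightarrow> nat list set" where
  "tuples I k = {ds. length ds = k \<and> set ds \<subseteq> I}"

definition distinct_tuples :: "nat set \<Rightarrow> nat \<Rightarrow> nat list set" where
  "distinct_tuples I k = {ds \<in> tuples I k. distinct ds}"

definition increasing_tuples :: "nat set \<Rightarrow> nat \<Rightarrow> nat list set" where
  "increasing_tuples I k = {ds \<in> tuples I k. sorted_wrt (<) ds}"

definition right_symbols :: "nat \<Rightarrow> nat \<Rightarrow> nat \<Rightarrow> nat \<Rightarrow> (nat list \<times> nat list) set" where
  "right_symbols n m r s = increasing_tuples (even_inds n) r \<times> increasing_tuples (odd_inds n m) s"

definition wrong_symbols :: "nat \<Rightarrow> nat \<Rightarrow> nat \<Rightarrow> nat \<Rightarrow> (nat list \<times> nat list) set" where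
  "wrong_symbols n m r s = {(as @ [\<nu>], \<mu>s) | as \<nu> \<mu>s. r \<ge> 1 \<and>
     as \<in> increasing_tuples (even_inds n) (r - 1) \<and> \<nu> \<in> odd_inds n m \<and>
     \<mu>s \<in> increasing_tuples (odd_inds n m) s \<and> \<nu> \<notin> set \<mu>s}"

definition wrong_symbols_star :: "nat \<Rightarrow> nat \<Rightarrow> nat \<Rightarrow> nat \<Rightarrow> (nat list \<times> nat list) set" where
  "wrong_symbols_star n m r s = {(as, b # \<mu>s) | as b \<mu>s. s \<ge> 1 \<and>
     as \<in> increasing_tuples (even_inds n) r \<and> b \<in> even_inds n \<and>
     \<mu>s \<in> increasing_tuples (odd_inds n m) (s - 1) \<and> b \<notin> set as}"

section \<open>Weighted projective superspace\<close>

type_synonym 'a coords = "(nat list \<Rightarrow> nat list \<Rightarrow> 'a) \<times> (nat list \<Rightarrow> nat list \<Rightarrow> 'a)"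

text \<open>
  A coordinate tuple \<open>(u, v)\<close> lists the unstarred coordinates \<open>u\<close> and the starred ones \<open>v\<close>;
  both are functions of symbols, set to 0 on symbols that do not label a coordinate.
\<close>

definition homogeneous_coords :: "(bool \<Rightarrow> 'a::ring_1 set) \<Rightarrow> nat \<Rightarrow> nat \<Rightarrow> nat \<Rightarrow> nat \<Rightarrow> 'a coords set" where
  "homogeneous_coords A n m r s = {(u, v).
     (\<forall>(ds, es) \<in> right_symbols n m r s. u ds es \<in> A False \<and> v ds es \<in> A False) \<and>
     (\<forall>(ds, es) \<in> wrong_symbols n m r s. u ds es \<in> A True) \<and>
     (\<forall>(ds, es) \<in> wrong_symbols_star n m r s. v ds es \<in> A True) \<and>
     (\<forall>ds es. (ds, es) \<notin> right_symbols n m r s \<union> wrong_symbols n m r s \<longrightarrow> u ds es = 0) \<and>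
     (\<forall>ds es. (ds, es) \<notin> right_symbols n m r s \<union> wrong_symbols_star n m r s \<longrightarrow> v ds es = 0) \<and>
     (\<exists>(ds, es) \<in> right_symbols n m r s. invertible_elem (u ds es) \<or> invertible_elem (v ds es))}"

definition weighted_rel ::
  "(bool \<Rightarrow> 'a::ring_1 set) \<Rightarrow> nat \<Rightarrow> nat \<Rightarrow> nat \<Rightarrow> nat \<Rightarrow> ('a coords \<times> 'a coords) set" where
  "weighted_rel A n m r s = {((u, v), (u', v')).
     (u, v) \<in> homogeneous_coords A n m r s \<and> (u', v') \<in> homogeneous_coords A n m r s \<and>
     (\<exists>c \<in> A False. invertible_elem c \<and>
        u' = (\<lambda>ds es. c * u ds es) \<and> v' = (\<lambda>ds es. inv_elem c * v ds es))}"

definition weighted_projective ::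
  "(bool \<Rightarrow> 'a::ring_1 set) \<Rightarrow> nat \<Rightarrow> nat \<Rightarrow> nat \<Rightarrow> nat \<Rightarrow> 'a coords set set" where
  "weighted_projective A n m r s = homogeneous_coords A n m r s // weighted_rel A n m r s"

section \<open>Super Grassmannian\<close>

definition even_supermats ::
  "(bool \<Rightarrow> 'a::ring_1 set) \<Rightarrow> nat \<Rightarrow> nat \<Rightarrow> nat \<Rightarrow> nat \<Rightarrow> 'a mat set" where
  "even_supermats A r s n m = {U \<in> carrier_mat (r + s) (n + m).
     \<forall>i < r + s. \<forall>j < n + m. U $$ (i, j) \<in> A ((i < r) \<noteq> (j < n))}"

definition super_GL :: "(bool \<Rightarrow> 'a::ring_1 set) \<Rightarrow> nat \<Rightarrow> nat \<Rightarrow> 'a mat set" where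
  "super_GL A r s = {g \<in> even_supermats A r s r s.
     \<exists>h \<in> even_supermats A r s r s. inverts_mat g h \<and> inverts_mat h g}"

definition submatrix_cols :: "'a mat \<Rightarrow> nat list \<Rightarrow> nat list \<Rightarrow> 'a mat" where
  "submatrix_cols U ds es = mat (dim_row U) (length (ds @ es)) (\<lambda>(i, j). U $$ (i, (ds @ es) ! j))"

definition full_rank_supermats ::
  "(bool \<Rightarrow> 'a::ring_1 set) \<Rightarrow> nat \<Rightarrow> nat \<Rightarrow> nat \<Rightarrow> nat \<Rightarrow> 'a mat set" where
  "full_rank_supermats A n m r s = {U \<in> even_supermats A r s n m.
     \<exists>(ds, es) \<in> right_symbols n m r s. submatrix_cols U ds es \<in> super_GL A r s}"

definition GL_rel ::
  "(bool \<Rightarrow> 'a::ring_1 set) \<Rightarrow> nat \<Rightarrow> nat \<Rightarrow> nat \<Rightarrow> nat \<Rightarrow> ('a mat \<times> 'a mat) set" where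
  "GL_rel A n m r s = {(U, g * U) | U g. U \<in> full_rank_supermats A n m r s \<and> g \<in> super_GL A r s}"

definition super_Grassmannian ::
  "(bool \<Rightarrow> 'a::ring_1 set) \<Rightarrow> nat \<Rightarrow> nat \<Rightarrow> nat \<Rightarrow> nat \<Rightarrow> 'a mat set set" where
  "super_Grassmannian A n m r s = full_rank_supermats A n m r s // GL_rel A n m r s"

section \<open>Super Pluecker map\<close>

definition Pluecker_coords :: "nat \<Rightarrow> nat \<Rightarrow> nat \<Rightarrow> nat \<Rightarrow> 'a::ring_1 mat \<Rightarrow> 'a coords" where
  "Pluecker_coords n m r s U =
     ((\<lambda>ds es. if (ds, es) \<in> right_symbols n m r s \<union> wrong_symbols n m r s
                then Ber r (submatrix_cols U ds es) else 0),
      (\<lambda>ds es. if (ds, es) \<in> right_symbols n m r s \<union> wrong_symbols_star n m r s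
                then Ber_star r (submatrix_cols U ds es) else 0))"

definition Pluecker_defined :: "nat \<Rightarrow> nat \<Rightarrow> nat \<Rightarrow> nat \<Rightarrow> 'a::ring_1 mat \<Rightarrow> bool" where
  "Pluecker_defined n m r s U \<longleftrightarrow>
     (\<forall>(ds, es) \<in> right_symbols n m r s \<union> wrong_symbols n m r s.
        Ber_defined r (submatrix_cols U ds es)) \<and>
     (\<forall>(ds, es) \<in> right_symbols n m r s \<union> wrong_symbols_star n m r s.
        Ber_star_defined r (submatrix_cols U ds es))"

definition Pluecker_domain ::
  "(bool \<Rightarrow> 'a::ring_1 set) \<Rightarrow> nat \<Rightarrow> nat \<Rightarrow> nat \<Rightarrow> nat \<Rightarrow> 'a mat set set" where
  "Pluecker_domain A n m r s =
     {\<Gamma> \<in> super_Grassmannian A n m r s. \<forall>U \<in> \<Gamma>. Pluecker_defined n m r s U}"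

text \<open>
  The map induced on classes; its value is an element of the projective superspace only if the
  classes of \<open>Pluecker_coords n m r s U\<close> agree for all representatives \<open>U\<close>.
\<close>

definition super_Pluecker_map ::
  "(bool \<Rightarrow> 'a::ring_1 set) \<Rightarrow> nat \<Rightarrow> nat \<Rightarrow> nat \<Rightarrow> nat \<Rightarrow> 'a mat set \<Rightarrow> 'a coords set" where
  "super_Pluecker_map A n m r s \<Gamma> =
     (\<Union>U \<in> \<Gamma>. weighted_rel A n m r s `` {Pluecker_coords n m r s U})"

section \<open>Super Pluecker relations\<close>

definition inversion_sign :: "nat list \<Rightarrow> 'a::ring_1" where
  "inversion_sign ds = (- 1) ^ card {(i, j). i < j \<and> j < length ds \<and> ds ! i > ds ! j}"

text \<open>
  Extension of coordinates by antisymmetry separately in the first and in the last positions.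
  Since even indices are smaller than odd ones, sorting moves a wrong-parity index to the last
  of the even positions, respectively to the first of the odd positions.  The value is 0 also if an
  index occurs on both sides of the bar.
\<close>

definition antisym :: "(nat list \<Rightarrow> nat list \<Rightarrow> 'a::ring_1) \<Rightarrow> nat list \<Rightarrow> nat list \<Rightarrow> 'a" where
  "antisym u ds es = (if distinct (ds @ es)
     then inversion_sign ds * inversion_sign es * u (sort ds) (sort es) else 0)"

definition relation_matrix :: "'a::ring_1 coords \<Rightarrow> nat list \<Rightarrow> nat list \<Rightarrow> nat list \<Rightarrow> 'a mat" where
  "relation_matrix p as \<mu>s ds = (case p of (u, v) \<Rightarrow>
     mat (length as + length \<mu>s) (length ds) (\<lambda>(i, j).
       if i < length as then antisym u (as[i := ds ! j]) \<mu>s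
       else antisym v as (\<mu>s[i - length as := ds ! j])))"

definition super_Pluecker_relations :: "nat \<Rightarrow> nat \<Rightarrow> nat \<Rightarrow> nat \<Rightarrow> 'a::ring_1 coords \<Rightarrow> bool" where
  "super_Pluecker_relations n m r s p \<longleftrightarrow> (case p of (u, v) \<Rightarrow>
     \<forall>as \<in> distinct_tuples (even_inds n) r. \<forall>\<mu>s \<in> distinct_tuples (odd_inds n m) s.
       antisym u as \<mu>s * antisym v as \<mu>s = 1 \<and>
       (\<forall>bs \<in> tuples (even_inds n) r. \<forall>\<nu>s \<in> distinct_tuples (odd_inds n m) s.
          let M = relation_matrix p as \<mu>s (bs @ \<nu>s) in
          Ber_defined r M \<and>
          Ber r M = zpow (antisym u as \<mu>s) (int r + int s - 1) * antisym u bs \<nu>s) \<and>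
       (r \<ge> 1 \<longrightarrow> (\<forall>bs \<in> tuples (even_inds n) (r - 1). \<forall>\<kappa> \<in> odd_inds n m.
          \<forall>\<nu>s \<in> distinct_tuples (odd_inds n m) s.
          let M = relation_matrix p as \<mu>s (bs @ [\<kappa>] @ \<nu>s) in
          Ber_defined r M \<and>
          Ber r M = zpow (antisym u as \<mu>s) (int r + int s - 1) * antisym u (bs @ [\<kappa>]) \<nu>s)) \<and>
       (s \<ge> 1 \<longrightarrow> (\<forall>bs \<in> distinct_tuples (even_inds n) r. \<forall>c \<in> even_inds n.
          \<forall>\<nu>s \<in> tuples (odd_inds n m) (s - 1).
          let M = relation_matrix p as \<mu>s (bs @ [c] @ \<nu>s) in
          Ber_star_defined r M \<and>
          Ber_star r M = zpow (antisym u as \<mu>s) (- int r - int s + 1) * antisym v bs (c # \<nu>s))))"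

end

(*
  Even elements are central, so their determinants obey the usual rules, and sdet (S * E) =
  sdet S * sdet E holds for central S and arbitrary E.  The one place where oddness enters is
  det (1 - P Q) * det (1 - Q P) = 1 for odd P and Q; it yields Ber * Ber_star = 1 and, as Ber is
  unchanged by upper and Ber_star by lower unitriangular factors, the multiplicativity of Ber.
  Multiplicativity persists for Ber of matrices with arbitrary columns in the even positions: such
  a matrix is W * E with W in GL(r|s) and E having only unit vectors in the odd positions.

  Let U represent a point of the Grassmannian where everything is defined, let W0 be the submatrix
  with columns a|mu and W = W0^-1 * U.  Cramer's rule identifies the relation matrix of a|mu with
  diag(t, ..., t, t^-1, ..., t^-1) * W, where t is the coordinate u^{a|mu}; taking Ber and Ber_star
  of its submatrices gives the relations.  Conversely, if the relations hold, then the relation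
  matrix of one fixed symbol a|mu is itself a matrix U whose coordinates are proportional to the
  given ones, with factor (u^{a|mu})^(1-r-s).
*)
theory Submission
  imports Defs "Jordan_Normal_Form.Determinant"
begin

section \<open>Determinants over the center\<close>

text \<open>The ring is noncommutative, without ground field, and 2 may be a zero divisor; the
  arguments rest on even elements being central and odd elements anticommuting with square 0.
  \<open>Ber_star\<close> is \<open>Ber_blocks\<close> with the parities exchanged and
  \<open>GL_blocks\<close> is symmetric under this exchange, so each fact is proved once for
  \<open>Ber_blocks\<close>. The identity for 1 - P Q also shows that adding a product of odd
  matrices to an even invertible matrix keeps it invertible; hence an even supermatrix is invertible
  exactly when both diagonal blocks are. So definedness of all Berezinians makes any r distinct even
  and s distinct odd columns an invertible frame, and every symbol can serve as a|mu. The exponents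
  come from Ber diag(t, ..., t, t^-1, ..., t^-1) = t^(r+s): with coordinates c * Ber and t = c * Ber
  W0, cancelling Ber W0 leaves t^(r+s-1) * c, and c is absorbed by the coordinate on the right. In
  the converse, the first relation for all symbols makes the right-parity coordinates units; this
  yields the invertible even blocks.\<close>

text \<open>
  The library determinant needs a commutative ring as a type.  The even part of a superalgebra
  depends on the variable \<open>A\<close> and cannot be turned into a type, but it lies in the center of \<^typ>\<open>'a\<close>.
\<close>

typedef (overloaded) ('a::ring_1) center = "{x::'a. \<forall>y. x * y = y * x}"
  by (rule exI[of _ 0]) simp

setup_lifting type_definition_center

instantiation center :: (ring_1) comm_ring_1
begin

lift_definition zero_center :: "'a center" is 0 by simp
lift_definition one_center :: "'a center" is 1 by simp
lift_definition plus_center :: "'a center \<Rightarrow> 'a center \<Rightarrow> 'a center" is "(+)"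
  by (simp add: algebra_simps)
lift_definition minus_center :: "'a center \<Rightarrow> 'a center \<Rightarrow> 'a center" is "(-)"
  by (simp add: algebra_simps)
lift_definition uminus_center :: "'a center \<Rightarrow> 'a center" is uminus by simp
lift_definition times_center :: "'a center \<Rightarrow> 'a center \<Rightarrow> 'a center" is "(*)"
  by (metis mult.assoc)

instance
proof
  fix a b c :: "'a center"
  show "a * b * c = a * (b * c)"
    by transfer (rule mult.assoc)
  show "a * b = b * a"
    by transfer blast
  show "1 * a = a"
    by transfer (rule mult_1)
  show "(a + b) * c = a * c + b * c"
    by transfer (rule distrib_right)
  show "a + b + c = a + (b + c)"
    by transfer (rule add.assoc)
  show "a + b = b + a"
    by transfer (rule add.commute)
  show "0 + a = a"
    by transfer (rule add_0)
  show "- a + a = 0"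
    by transfer (rule left_minus)
  show "a - b = a + - b"
    by transfer (rule diff_conv_add_uminus)
  show "(0 :: 'a center) \<noteq> 1"
    by transfer (rule zero_neq_one)
qed

end


lemma Rep_center_simps [simp]:
  "Rep_center 0 = 0" "Rep_center 1 = 1" "Rep_center (x + y) = Rep_center x + Rep_center y"
  "Rep_center (x - y) = Rep_center x - Rep_center y" "Rep_center (- x) = - Rep_center x"
  "Rep_center (x * y) = Rep_center x * Rep_center y"
  by (fact zero_center.rep_eq one_center.rep_eq plus_center.rep_eq minus_center.rep_eq
      uminus_center.rep_eq times_center.rep_eq)+

interpretation Rep_center: ring_hom "Rep_center :: 'a::ring_1 center \<Rightarrow> 'a"
  by unfold_locales simp_all

definition central :: "'a::ring_1 \<Rightarrow> bool" where
  "central x \<longleftrightarrow> (\<forall>y. x * y = y * x)"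

lemma centralD: "central x \<Longrightarrow> x * y = y * x"
  by (simp add: central_def)

lemma central_Rep [simp]: "central (Rep_center x)"
  using Rep_center[of x] by (simp add: central_def)

lemma Rep_Abs_center [simp]: "central x \<Longrightarrow> Rep_center (Abs_center x) = x"
  by (rule Abs_center_inverse) (simp add: central_def)

definition central_mat :: "'a::ring_1 mat \<Rightarrow> bool" where
  "central_mat M \<longleftrightarrow> (\<forall>i<dim_row M. \<forall>j<dim_col M. central (M $$ (i, j)))"

abbreviation to_center :: "'a::ring_1 mat \<Rightarrow> 'a center mat" where
  "to_center \<equiv> map_mat Abs_center"

lemma of_to_center [simp]: "central_mat M \<Longrightarrow> map_mat Rep_center (to_center M) = M"
  by (rule eq_matI) (auto simp: central_mat_def)

lemma central_mat_Rep [simp]: "central_mat (map_mat Rep_center N)"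
  by (simp add: central_mat_def)

lemma central_mat_obtain:
  assumes "central_mat M"
  obtains N where "M = map_mat Rep_center N"
  using of_to_center[OF assms] by metis

text \<open>Connects \<open>sdet\<close> with the library determinant along the inclusion of the
  center, which is a ring homomorphism; there the ordered product becomes an ordinary one.\<close>

lemma sdet_map_Rep:
  assumes N: "N \<in> carrier_mat n n"
  shows "sdet (map_mat Rep_center N) = Rep_center (det N)"
proof -
  have "prod_list (map (\<lambda>j. map_mat Rep_center N $$ (p j, j)) [0..<n]) =
      Rep_center (\<Prod>j<n. N $$ (p j, j))" if p: "p permutes {..<n}" for p
  proof -
    have "map (\<lambda>j. map_mat Rep_center N $$ (p j, j)) [0..<n] =
        map Rep_center (map (\<lambda>j. N $$ (p j, j)) [0..<n])"
      using N permutes_in_image[OF p] by auto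
    moreover have "(\<Prod>j<n. N $$ (p j, j)) = prod_list (map (\<lambda>j. N $$ (p j, j)) [0..<n])"
      by (simp add: interv_sum_list_conv_sum_set_nat[symmetric] prod.distinct_set_conv_list[symmetric] lessThan_atLeast0)
    ultimately show ?thesis
      by (simp only: Rep_center.hom_prod_list)
  qed
  then have "sdet (map_mat Rep_center N) = (\<Sum>p | p permutes {..<n}. Rep_center (of_int (sign p) * (\<Prod>j<n. N $$ (p j, j))))"
    using N unfolding sdet_def by (auto intro!: sum.cong)
  also have "\<dots> = Rep_center (det N)"
    unfolding det_col[OF N] by (simp add: lessThan_atLeast0 Rep_center.hom_sum)
  finally show ?thesis .
qed

text \<open>Expansion of a product of sums with the factors kept in list order, since they need not
  commute. The induction appends the last factor on the right, which corresponds to extending a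
  choice function by its value at \<open>l\<close>.\<close>

lemma prod_list_sum:
  fixes a :: "nat \<Rightarrow> nat \<Rightarrow> 'a::semiring_1"
  shows "prod_list (map (\<lambda>j. \<Sum>k<n. a j k) [0..<l]) =
    (\<Sum>f \<in> {..<l} \<rightarrow>\<^sub>E {..<n}. prod_list (map (\<lambda>j. a j (f j)) [0..<l]))"
proof (induction l)
  case (Suc l)
  have *: "inj_on (\<lambda>(y, g). g(l := y)) ({..<n} \<times> ({..<l} \<rightarrow>\<^sub>E {..<n}))"
    by (rule inj_combinator) simp
  have "(\<Sum>f \<in> {..<Suc l} \<rightarrow>\<^sub>E {..<n}. prod_list (map (\<lambda>j. a j (f j)) [0..<Suc l])) =
    (\<Sum>(y, g) \<in> {..<n} \<times> ({..<l} \<rightarrow>\<^sub>E {..<n}). prod_list (map (\<lambda>j. a j ((g(l := y)) j)) [0..<Suc l]))"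
    unfolding lessThan_Suc PiE_insert_eq by (subst sum.reindex[OF *]) (simp add: case_prod_beta)
  also have "\<dots> = (\<Sum>(y, g) \<in> {..<n} \<times> ({..<l} \<rightarrow>\<^sub>E {..<n}). prod_list (map (\<lambda>j. a j (g j)) [0..<l]) * a l y)"
  proof (intro sum.cong refl, clarify)
    fix y g
    have "map (\<lambda>j. a j (if j = l then y else g j)) [0..<l] = map (\<lambda>j. a j (g j)) [0..<l]"
      by (rule map_cong) auto
    then have "prod_list (map (\<lambda>j. a j (if j = l then y else g j)) [0..<l]) =
        prod_list (map (\<lambda>j. a j (g j)) [0..<l])"
      by (rule arg_cong)
    then show "prod_list (map (\<lambda>j. a j ((g(l := y)) j)) [0..<Suc l]) =
        prod_list (map (\<lambda>j. a j (g j)) [0..<l]) * a l y"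
      by simp
  qed
  also have "\<dots> = (\<Sum>g \<in> {..<l} \<rightarrow>\<^sub>E {..<n}. prod_list (map (\<lambda>j. a j (g j)) [0..<l])) * (\<Sum>y<n. a l y)"
    by (subst sum.cartesian_product[symmetric], subst sum.swap) (simp add: sum_product)
  finally show ?case
    by (simp add: Suc)
qed simp

lemma central_mult: "central x \<Longrightarrow> central y \<Longrightarrow> central (x * y)"
  unfolding central_def by (metis mult.assoc)

lemma central_0 [simp]: "central 0" and central_1 [simp]: "central 1"
  by (simp_all add: central_def)

lemma central_prod_list: "(\<And>x. x \<in> set xs \<Longrightarrow> central x) \<Longrightarrow> central (prod_list xs)"
  by (induction xs) (auto intro: central_mult)

text \<open>Moves the coefficients to the front while the order of the arbitrary factors
  \<open>g x\<close> is preserved.\<close>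

lemma prod_list_mult_central:
  assumes "\<And>x. x \<in> set xs \<Longrightarrow> central (f x)"
  shows "prod_list (map (\<lambda>x. f x * g x) xs) = prod_list (map f xs) * prod_list (map g xs)"
  using assms
proof (induction xs)
  case (Cons x xs)
  let ?F = "prod_list (map f xs)" and ?G = "prod_list (map g xs)"
  have "central ?F"
    using Cons.prems by (intro central_prod_list) auto
  then have c: "g x * ?F = ?F * g x"
    by (metis centralD)
  have "f x * g x * (?F * ?G) = f x * (g x * ?F) * ?G"
    by (simp only: mult.assoc)
  also have "\<dots> = f x * ?F * (g x * ?G)"
    unfolding c by (simp only: mult.assoc)
  finally show ?case
    using Cons by simp
qed simp

text \<open>
  Expanding all columns of \<open>S * E\<close> gives a sum over maps \<open>f\<close> of \<open>det (S * B f)\<close> times a product of entries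
  of \<open>E\<close>, where \<open>B f\<close> is the 0-1 matrix of \<open>f\<close>; so nothing is needed about the entries of \<open>E\<close>.
\<close>

lemma sdet_mult:
  fixes S E :: "'a::ring_1 mat"
  assumes S: "S \<in> carrier_mat n n" "central_mat S" and E: "E \<in> carrier_mat n n"
  shows "sdet (S * E) = sdet S * sdet E"
proof -
  obtain N where N: "S = map_mat Rep_center N"
    using S by (metis central_mat_obtain)
  with S have Nc: "N \<in> carrier_mat n n"
    by simp
  define P where "P = {p. p permutes {..<n}}"
  define F where "F = {..<n} \<rightarrow>\<^sub>E {..<n}"
  define e where "e f = prod_list (map (\<lambda>j. E $$ (f j, j)) [0..<n])" for f
  define B where "B f = mat n n (\<lambda>(k, j). if k = f j then 1 else 0 :: 'a center)" for f
  have finF: "finite F" and finP: "finite P"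
    unfolding F_def P_def by (auto intro: finite_PiE finite_permutations)
  have Bc: "B f \<in> carrier_mat n n" for f
    by (simp add: B_def)
  have pn: "p j < n" if "p \<in> P" "j < n" for p j
    using that permutes_in_image[of p "{..<n}" j] by (simp add: P_def)
  have NB: "(N * B f) $$ (i, j) = N $$ (i, f j)" if "f \<in> F" "i < n" "j < n" for f i j
  proof -
    have "(N * B f) $$ (i, j) = (\<Sum>k = 0..<n. N $$ (i, k) * (if k = f j then 1 else 0))"
      using that Nc by (simp add: B_def scalar_prod_def)
    also have "\<dots> = (\<Sum>k = 0..<n. if k = f j then N $$ (i, k) else 0)"
      by (intro sum.cong) auto
    finally show ?thesis
      using that by (auto simp: F_def)
  qed
  have "sdet (S * E) = (\<Sum>p\<in>P. of_int (sign p) *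
      prod_list (map (\<lambda>j. \<Sum>k<n. S $$ (p j, k) * E $$ (k, j)) [0..<n]))"
  proof -
    have "map (\<lambda>j. (S * E) $$ (p j, j)) [0..<n] = map (\<lambda>j. \<Sum>k<n. S $$ (p j, k) * E $$ (k, j)) [0..<n]"
      if "p \<in> P" for p
      using S E pn[OF that] by (intro map_cong) (auto simp: scalar_prod_def lessThan_atLeast0)
    then have "prod_list (map (\<lambda>j. (S * E) $$ (p j, j)) [0..<n]) =
        prod_list (map (\<lambda>j. \<Sum>k<n. S $$ (p j, k) * E $$ (k, j)) [0..<n])" if "p \<in> P" for p
      using that by (simp only:)
    then have "(\<Sum>p\<in>P. of_int (sign p) * prod_list (map (\<lambda>j. (S * E) $$ (p j, j)) [0..<n])) =
        (\<Sum>p\<in>P. of_int (sign p) * prod_list (map (\<lambda>j. \<Sum>k<n. S $$ (p j, k) * E $$ (k, j)) [0..<n]))"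
      by (intro sum.cong refl) (simp only:)
    then show ?thesis
      using E by (simp only: sdet_def P_def index_mult_mat carrier_matD)
  qed
  also have "\<dots> = (\<Sum>p\<in>P. \<Sum>f\<in>F. of_int (sign p) *
      (Rep_center (\<Prod>j<n. (N * B f) $$ (p j, j)) * e f))"
  proof (intro sum.cong refl, unfold prod_list_sum sum_distrib_left F_def[symmetric], intro sum.cong refl)
    fix p f assume p: "p \<in> P" and f: "f \<in> F"
    have "prod_list (map (\<lambda>j. S $$ (p j, f j) * E $$ (f j, j)) [0..<n]) =
      prod_list (map (\<lambda>j. S $$ (p j, f j)) [0..<n]) * e f"
      unfolding e_def
    proof (rule prod_list_mult_central)
      fix j assume "j \<in> set [0..<n]"
      then have "f j < n" "p j < n"
        using f pn[OF p] by (auto simp: F_def PiE_iff)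
      then show "central (S $$ (p j, f j))"
        using S by (simp add: central_mat_def)
    qed
    also have "map (\<lambda>j. S $$ (p j, f j)) [0..<n] = map Rep_center (map (\<lambda>j. (N * B f) $$ (p j, j)) [0..<n])"
      unfolding map_map
    proof (rule map_cong[OF refl])
      fix j assume "j \<in> set [0..<n]"
      then have j: "j < n"
        by simp
      then have "f j < n"
        using f by (auto simp: F_def PiE_iff)
      then show "S $$ (p j, f j) = (Rep_center \<circ> (\<lambda>j. (N * B f) $$ (p j, j))) j"
        unfolding comp_def NB[OF f pn[OF p j] j] unfolding N using Nc pn[OF p j] by simp
    qed
    also have "prod_list \<dots> = Rep_center (\<Prod>j<n. (N * B f) $$ (p j, j))"
      unfolding Rep_center.hom_prod_list[symmetric]
      by (subst prod.distinct_set_conv_list[symmetric]) (simp_all add: lessThan_atLeast0)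
    finally show "of_int (sign p) * prod_list (map (\<lambda>j. S $$ (p j, f j) * E $$ (f j, j)) [0..<n]) =
      of_int (sign p) * (Rep_center (\<Prod>j<n. (N * B f) $$ (p j, j)) * e f)"
      by simp
  qed
  also have "\<dots> = (\<Sum>f\<in>F. Rep_center (det (N * B f)) * e f)"
    using Nc Bc
    by (subst sum.swap) (simp add: det_col[of _ n] Rep_center.hom_sum sum_distrib_right P_def lessThan_atLeast0 mult.assoc)
  \<comment> \<open>Determinants multiply over the center, so det S leaves every summand.\<close>
  also have "\<dots> = sdet S * (\<Sum>f\<in>F. Rep_center (det (B f)) * e f)"
    by (simp add: N sdet_map_Rep[OF Nc] det_mult[OF Nc Bc] sum_distrib_left mult.assoc)
  \<comment> \<open>What remains is the same expansion with the identity in place of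
    \<open>S\<close>. It is rearranged by permutations p: the product of the entries
    \<open>B f $$ (p j, j)\<close> is 1 if f agrees with p and 0 otherwise, so one summand survives
    for each p.\<close>
  also have "(\<Sum>f\<in>F. Rep_center (det (B f)) * e f) =
      (\<Sum>p\<in>P. \<Sum>f\<in>F. of_int (sign p) * (Rep_center (\<Prod>j<n. B f $$ (p j, j)) * e f))"
    using Bc by (subst sum.swap) (simp add: det_col[of _ n] Rep_center.hom_sum sum_distrib_right P_def lessThan_atLeast0 mult.assoc)
  also have "\<dots> = (\<Sum>p\<in>P. of_int (sign p) * e p)"
  proof (intro sum.cong refl)
    fix p assume p: "p \<in> P"
    have r: "restrict p {..<n} \<in> F"
      using pn[OF p] by (auto simp: F_def)
    have "(\<Sum>f\<in>F. of_int (sign p) * (Rep_center (\<Prod>j<n. B f $$ (p j, j)) * e f)) =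
      (\<Sum>f\<in>F. if f = restrict p {..<n} then of_int (sign p) * e p else 0)"
    proof (intro sum.cong refl)
      fix f assume f: "f \<in> F"
      show "of_int (sign p) * (Rep_center (\<Prod>j<n. B f $$ (p j, j)) * e f) =
        (if f = restrict p {..<n} then of_int (sign p) * e p else 0)"
      proof (cases "f = restrict p {..<n}")
        case True
        then have "map (\<lambda>j. E $$ (f j, j)) [0..<n] = map (\<lambda>j. E $$ (p j, j)) [0..<n]"
          by (intro map_cong) auto
        then have "e f = e p"
          unfolding e_def by (rule arg_cong)
        moreover have "(\<Prod>j<n. B f $$ (p j, j)) = 1"
          using True by (intro prod.neutral) (auto simp: B_def pn[OF p])
        ultimately show ?thesis
          using True by simp
      next
        case False
        then obtain j where j: "j < n" "f j \<noteq> p j"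
          using f by (auto simp: F_def fun_eq_iff PiE_iff extensional_def restrict_def split: if_splits)
        then have "(\<Prod>j<n. B f $$ (p j, j)) = 0"
          by (intro prod_zero) (auto simp: B_def pn[OF p] intro!: bexI[of _ j])
        then show ?thesis
          using False by simp
      qed
    qed
    also have "\<dots> = of_int (sign p) * e p"
      using r finF by simp
    finally show "(\<Sum>f\<in>F. of_int (sign p) * (Rep_center (\<Prod>j<n. B f $$ (p j, j)) * e f)) = of_int (sign p) * e p" .
  qed
  also have "\<dots> = sdet E"
    using E by (simp add: sdet_def P_def e_def)
  finally show ?thesis .
qed

lemma prod_list_zero: "0 \<in> set xs \<Longrightarrow> prod_list xs = (0::'a::semiring_1)"
  by (induction xs) auto

text \<open>Only the identity permutation contributes, because a permutation fixing every index
  except possibly k fixes k too. The column \<open>c\<close> is arbitrary, so it may be odd, as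
  happens in \<open>Cramer\<close>.\<close>

lemma sdet_id_col:
  fixes c :: "nat \<Rightarrow> 'a::ring_1"
  assumes k: "k < n"
  shows "sdet (mat n n (\<lambda>(i, j). if j = k then c i else if i = j then 1 else 0)) = c k"
    (is "sdet ?M = _")
proof -
  let ?t = "\<lambda>p. of_int (sign p) * prod_list (map (\<lambda>j. ?M $$ (p j, j)) [0..<n])"
  have "?t p = (if p = id then c k else 0)" if p: "p permutes {..<n}" for p
  proof (cases "p = id")
    case True
    have "prod_list (map (\<lambda>j. if j = k then c j else 1) [0..<m]) = (if k < m then c k else 1)" for m
      by (induction m) auto
    moreover have "map (\<lambda>j. ?M $$ (p j, j)) [0..<n] = map (\<lambda>j. if j = k then c j else 1) [0..<n]"
      using True by auto
    ultimately have "prod_list (map (\<lambda>j. ?M $$ (p j, j)) [0..<n]) = c k"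
      using k by (simp only: if_True)
    then show ?thesis
      using True by (simp only: sign_id of_int_1 mult_1 if_True refl)
  next
    case False
    have "\<exists>j<n. j \<noteq> k \<and> p j \<noteq> j"
    proof (rule ccontr)
      assume *: "\<not> (\<exists>j<n. j \<noteq> k \<and> p j \<noteq> j)"
      then have "p j = j" if "j \<noteq> k" for j
        using that p by (cases "j < n") (auto simp: permutes_def)
      moreover from this have "p k = k"
        by (metis p permutes_inv_eq)
      ultimately show False
        using False by (metis eq_id_iff)
    qed
    then obtain j where j: "j < n" "j \<noteq> k" "p j \<noteq> j"
      by blast
    have "p j < n"
      using permutes_in_image[OF p, of j] j by simp
    with j have "0 \<in> set (map (\<lambda>j. ?M $$ (p j, j)) [0..<n])"
      by (auto simp: image_iff intro!: bexI[of _ j])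
    then have "prod_list (map (\<lambda>j. ?M $$ (p j, j)) [0..<n]) = 0"
      by (rule prod_list_zero)
    then show ?thesis
      using False by simp
  qed
  then have "sdet ?M = (\<Sum>p | p permutes {..<n}. if p = id then c k else 0)"
    unfolding sdet_def by (intro sum.cong) auto
  also have "\<dots> = c k"
    by (simp add: finite_permutations permutes_id)
  finally show ?thesis .
qed

section \<open>Units, inverse matrices and column permutations\<close>

lemma is_inverse_unique: "is_inverse x y \<Longrightarrow> is_inverse x z \<Longrightarrow> y = z"
  unfolding is_inverse_def by (metis mult.assoc mult_1 mult_1_right)

lemma inv_elem_eq: "is_inverse x y \<Longrightarrow> inv_elem x = y"
  unfolding inv_elem_def by (rule the_equality) (auto intro: is_inverse_unique)

lemma is_inverse_inv_elem: "invertible_elem x \<Longrightarrow> is_inverse x (inv_elem x)"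
  unfolding invertible_elem_def using inv_elem_eq by metis

lemma inv_elem_right [simp]: "invertible_elem x \<Longrightarrow> x * inv_elem x = 1"
  and inv_elem_left [simp]: "invertible_elem x \<Longrightarrow> inv_elem x * x = 1"
  using is_inverse_inv_elem unfolding is_inverse_def by blast+

lemma invertible_elem_1 [simp]: "invertible_elem 1"
  unfolding invertible_elem_def is_inverse_def by (rule exI[of _ 1]) simp

lemma inv_elem_1 [simp]: "inv_elem 1 = 1"
  by (rule inv_elem_eq) (simp add: is_inverse_def)

lemma is_inverse_mult: "is_inverse x x' \<Longrightarrow> is_inverse y y' \<Longrightarrow> is_inverse (x * y) (y' * x')"
  unfolding is_inverse_def by (metis mult.assoc mult_1_right)

lemma invertible_elem_mult: "invertible_elem x \<Longrightarrow> invertible_elem y \<Longrightarrow> invertible_elem (x * y)"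
  unfolding invertible_elem_def using is_inverse_mult by blast

lemma inv_elem_mult:
  "invertible_elem x \<Longrightarrow> invertible_elem y \<Longrightarrow> inv_elem (x * y) = inv_elem y * inv_elem x"
  by (intro inv_elem_eq is_inverse_mult is_inverse_inv_elem)

lemma invertible_elem_inv_elem: "invertible_elem x \<Longrightarrow> invertible_elem (inv_elem x)"
  using is_inverse_inv_elem[of x] unfolding invertible_elem_def is_inverse_def by blast

lemma inv_elem_inv_elem: "invertible_elem x \<Longrightarrow> inv_elem (inv_elem x) = x"
  using is_inverse_inv_elem[of x] by (intro inv_elem_eq) (simp add: is_inverse_def)

lemma invertible_elem_left_cancel: "invertible_elem x \<Longrightarrow> x * y = x * z \<Longrightarrow> y = z"
  by (metis inv_elem_left mult.assoc mult_1)

lemma invertible_elem_right_cancel: "invertible_elem x \<Longrightarrow> y * x = z * x \<Longrightarrow> y = z"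
  by (metis inv_elem_right mult.assoc mult_1_right)

lemma central_minus: "central x \<Longrightarrow> central (- x)"
  unfolding central_def by (metis mult_minus_left mult_minus_right)

lemma central_inv_elem: 
  assumes "central x" "invertible_elem x"
  shows "central (inv_elem x)"
  unfolding central_def
proof
  fix y
  have "x * (inv_elem x * y) = x * (y * inv_elem x)"
    using assms by (metis centralD inv_elem_left inv_elem_right mult.assoc mult_1 mult_1_right)
  then show "inv_elem x * y = y * inv_elem x"
    by (rule invertible_elem_left_cancel[OF assms(2)])
qed

text \<open>The product gives a right inverse of \<open>x\<close>, and centrality makes it
  two-sided. This is how units are extracted from determinants of products.\<close>

lemma invertible_elem_factor:
  assumes "central x" "invertible_elem (x * y)"
  shows "invertible_elem x"
proof -
  have "x * (y * inv_elem (x * y)) = 1"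
    using assms(2) by (metis inv_elem_right mult.assoc)
  then show ?thesis
    using assms(1) unfolding invertible_elem_def is_inverse_def by (metis centralD)
qed

section \<open>Inverse matrices and the determinant criterion for invertibility\<close>

lemma inv_matrix_eq:
  assumes "M \<in> carrier_mat n n" "N \<in> carrier_mat n n" "M * N = 1\<^sub>m n" "N * M = 1\<^sub>m n"
  shows "inv_matrix M = N"
  unfolding inv_matrix_def
proof (rule the_equality)
  show "N \<in> carrier_mat (dim_row M) (dim_row M) \<and> inverts_mat M N \<and> inverts_mat N M"
    using assms by (simp add: inverts_mat_def)
next
  fix N' assume "N' \<in> carrier_mat (dim_row M) (dim_row M) \<and> inverts_mat M N' \<and> inverts_mat N' M"
  then have N': "N' \<in> carrier_mat n n" "N' * M = 1\<^sub>m n"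
    using assms by (auto simp: inverts_mat_def)
  have "N' = N' * (M * N)"
    using assms N' by simp
  also have "\<dots> = N' * M * N"
    using assms N' by (intro assoc_mult_mat[symmetric])
  also have "\<dots> = N"
    using assms N' by simp
  finally show "N' = N" .
qed

lemma inv_matrix:
  assumes "M \<in> carrier_mat n n" "invertible_mat M"
  shows "inv_matrix M \<in> carrier_mat n n" "M * inv_matrix M = 1\<^sub>m n" "inv_matrix M * M = 1\<^sub>m n"
proof -
  obtain N where N: "inverts_mat M N" "inverts_mat N M"
    using assms unfolding invertible_mat_def by blast
  have e: "M * N = 1\<^sub>m n" "N * M = 1\<^sub>m (dim_row N)"
    using N assms(1) by (auto simp: inverts_mat_def)
  \<comment> \<open>\<open>invertible_mat\<close> leaves the shape of the inverse open; comparing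
    the dimensions of both sides of the two equations shows that it is square of size n.\<close>
  have "dim_col N = n" "dim_row N = n"
    using arg_cong[OF e(1), of dim_col] arg_cong[OF e(2), of dim_col] assms(1) by auto
  then have "N \<in> carrier_mat n n" "M * N = 1\<^sub>m n" "N * M = 1\<^sub>m n"
    using e by auto
  moreover from this have "inv_matrix M = N"
    using assms(1) by (intro inv_matrix_eq)
  ultimately show "inv_matrix M \<in> carrier_mat n n" "M * inv_matrix M = 1\<^sub>m n" "inv_matrix M * M = 1\<^sub>m n"
    by auto
qed

lemma invertible_matI:
  assumes "M \<in> carrier_mat n n" "N \<in> carrier_mat n n" "M * N = 1\<^sub>m n" "N * M = 1\<^sub>m n"
  shows "invertible_mat M"
  unfolding invertible_mat_def inverts_mat_def square_mat.simps using assms by auto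

lemma central_sdet:
  assumes "M \<in> carrier_mat n n" "central_mat M"
  shows "central (sdet M)"
proof -
  obtain N where "M = map_mat Rep_center N"
    using assms by (metis central_mat_obtain)
  with assms sdet_map_Rep[of N n] show ?thesis
    by auto
qed

lemma sdet_one [simp]: "sdet (1\<^sub>m n :: 'a::ring_1 mat) = 1"
proof -
  have "sdet (map_mat Rep_center (1\<^sub>m n :: 'a center mat)) = Rep_center (det (1\<^sub>m n))"
    by (rule sdet_map_Rep[of _ n]) simp
  then show ?thesis
    by (simp add: Rep_center.mat_hom_one)
qed

text \<open>From left to right by the adjugate. In the other direction the inverse matrix is not
  known to be central, but \<open>sdet_mult\<close> asks for centrality of the left factor
  only.\<close>

lemma invertible_elem_sdet_iff:
  fixes M :: "'a::ring_1 mat"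
  assumes M: "M \<in> carrier_mat n n" "central_mat M"
  shows "invertible_elem (sdet M) \<longleftrightarrow> invertible_mat M"
proof
  assume inv: "invertible_mat M"
  let ?N = "inv_matrix M"
  note N = inv_matrix[OF M(1) inv]
  have "sdet M * sdet ?N = sdet (M * ?N)"
    using sdet_mult[OF M N(1)] by simp
  also have "\<dots> = 1"
    by (simp add: N)
  finally have "sdet M * sdet ?N = 1" .
  moreover have "sdet ?N * sdet M = sdet M * sdet ?N"
    using centralD[OF central_sdet[OF M]] by simp
  ultimately show "invertible_elem (sdet M)"
    unfolding invertible_elem_def is_inverse_def by metis
next
  assume inv: "invertible_elem (sdet M)"
  obtain N where N: "M = map_mat Rep_center N"
    using M by (metis central_mat_obtain)
  then have Nc: "N \<in> carrier_mat n n"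
    using M by simp
  \<comment> \<open>The inverse of a central unit is central, so it lifts to the center and the
    adjugate formula is available there.\<close>
  define d where "d = Abs_center (inv_elem (sdet M))"
  have d: "Rep_center d = inv_elem (sdet M)"
    unfolding d_def by (intro Rep_Abs_center central_inv_elem central_sdet[OF M] inv)
  have "Rep_center (det N * d) = 1"
    using inv by (simp add: d sdet_map_Rep[OF Nc, symmetric] N[symmetric])
  then have dd: "det N * d = 1"
    by (metis Rep_center_inject one_center.rep_eq)
  define K where "K = d \<cdot>\<^sub>m adj_mat N"
  have K: "K \<in> carrier_mat n n" "N * K = 1\<^sub>m n" "K * N = 1\<^sub>m n"
    using adj_mat[OF Nc] Nc dd unfolding K_def
    by (auto simp: mult_smult_distrib[OF Nc adj_mat(1)[OF Nc]] mult_smult_assoc_mat[OF adj_mat(1)[OF Nc] Nc] mult.commute[of d])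
  have "M * map_mat Rep_center K = 1\<^sub>m n" "map_mat Rep_center K * M = 1\<^sub>m n"
    using Rep_center.mat_hom_mult[OF Nc K(1)] Rep_center.mat_hom_mult[OF K(1) Nc] K
    by (simp_all add: N Rep_center.mat_hom_one)
  then show "invertible_mat M"
    using M K(1) by (intro invertible_matI[of M n "map_mat Rep_center K"]) auto
qed

lemma sdet_transpose:
  assumes M: "M \<in> carrier_mat n n" "central_mat M"
  shows "sdet (transpose_mat M) = sdet M"
proof -
  obtain N where N: "M = map_mat Rep_center N"
    using M by (metis central_mat_obtain)
  then have Nc: "N \<in> carrier_mat n n"
    using M by simp
  have "transpose_mat M = map_mat Rep_center (transpose_mat N)"
    by (rule eq_matI) (auto simp: N)
  then show ?thesis
    using sdet_map_Rep[of "transpose_mat N" n] Nc by (simp add: sdet_map_Rep[OF Nc] N det_transpose[OF Nc])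
qed

lemma sdet_smult_one:
  fixes c :: "'a::ring_1"
  assumes "central c"
  shows "sdet (c \<cdot>\<^sub>m 1\<^sub>m n) = c ^ n"
proof -
  have "c \<cdot>\<^sub>m 1\<^sub>m n = map_mat Rep_center (Abs_center c \<cdot>\<^sub>m 1\<^sub>m n)"
    using assms by (intro eq_matI) auto
  then have "sdet (c \<cdot>\<^sub>m 1\<^sub>m n) = Rep_center (det (Abs_center c \<cdot>\<^sub>m 1\<^sub>m n :: 'a center mat))"
    by (simp add: sdet_map_Rep[of _ n])
  also have "\<dots> = c ^ n"
    using assms by (simp add: Rep_center.hom_power)
  finally show ?thesis .
qed

section \<open>Exchange of neighbouring columns\<close>

lemma prod_list_transpose_adjacent:
  fixes f :: "nat \<Rightarrow> 'a::monoid_mult"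
  assumes "Suc l < n" "f l * f (Suc l) = f (Suc l) * f l"
  shows "prod_list (map (f \<circ> Transposition.transpose l (Suc l)) [0..<n]) = prod_list (map f [0..<n])"
proof -
  have *: "[0..<n] = [0..<l] @ [l, Suc l] @ [Suc (Suc l)..<n]"
    using assms(1) by (metis add_2_eq_Suc' append_Cons append_Nil le_add_diff_inverse less_imp_le_nat
        upt_add_eq_append upt_conv_Cons zero_le Suc_lessD Suc_leI)
  have L: "map (f \<circ> Transposition.transpose l (Suc l)) [0..<l] = map f [0..<l]"
    and R: "map (f \<circ> Transposition.transpose l (Suc l)) [Suc (Suc l)..<n] = map f [Suc (Suc l)..<n]"
    by (auto simp: Transposition.transpose_def)
  show ?thesis
    unfolding * map_append prod_list.append L R using assms(2)
    by (simp add: mult.assoc[symmetric])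
qed

lemma sign_compose_adjacent:
  assumes "p permutes {..<n}"
  shows "sign (p \<circ> Transposition.transpose l (Suc l)) = - sign p"
  by (simp add: sign_compose permutes_imp_permutation[OF finite_lessThan assms] permutation_swap_id sign_swap_id)

definition swap_adjacent :: "nat \<Rightarrow> 'a mat \<Rightarrow> 'a mat" where
  "swap_adjacent l M = mat (dim_row M) (dim_col M) (\<lambda>(i, j). M $$ (i, Transposition.transpose l (Suc l) j))"

context
  fixes M :: "'a::ring_1 mat" and n l :: nat
  assumes M: "M \<in> carrier_mat n n" and l: "Suc l < n"
    and comm: "\<And>i i'. i < n \<Longrightarrow> i' < n \<Longrightarrow> M $$ (i, l) * M $$ (i', Suc l) = M $$ (i', Suc l) * M $$ (i, l)"
begin

text \<open>Composing p with the transposition of l and l + 1 exchanges just two neighbouring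
  factors of the ordered product. Hence commutation is assumed only between the entries of these two
  columns.\<close>

lemma prod_list_swap_adjacent:
  assumes p: "p permutes {..<n}"
  shows "prod_list (map (\<lambda>j. swap_adjacent l M $$ ((p \<circ> Transposition.transpose l (Suc l)) j, j)) [0..<n]) =
    prod_list (map (\<lambda>j. M $$ (p j, j)) [0..<n])"
proof -
  let ?t = "Transposition.transpose l (Suc l)"
  have pn: "p j < n" if "j < n" for j
    using permutes_in_image[OF p, of j] that by simp
  have tn: "?t j < n" if "j < n" for j
    using that l by (auto simp: Transposition.transpose_def)
  have "map (\<lambda>j. swap_adjacent l M $$ ((p \<circ> ?t) j, j)) [0..<n] = map ((\<lambda>j. M $$ (p j, j)) \<circ> ?t) [0..<n]"
    using M pn tn by (auto simp: swap_adjacent_def)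
  also have "prod_list \<dots> = prod_list (map (\<lambda>j. M $$ (p j, j)) [0..<n])"
    using l by (intro prod_list_transpose_adjacent comm pn) auto
  finally show ?thesis .
qed

lemma sdet_swap_adjacent: "sdet (swap_adjacent l M) = - sdet M"
proof -
  let ?t = "Transposition.transpose l (Suc l)"
  have t: "?t permutes {..<n}"
    using l by (intro permutes_swap_id) auto
  let ?g = "\<lambda>p. of_int (sign p) * prod_list (map (\<lambda>j. swap_adjacent l M $$ (p j, j)) [0..<n])"
  have "sdet (swap_adjacent l M) = (\<Sum>p | p permutes {..<n}. ?g p)"
    using M by (simp add: sdet_def swap_adjacent_def)
  also have "\<dots> = (\<Sum>p | p permutes {..<n}. ?g (p \<circ> ?t))"
    by (rule sum_permutations_compose_right[OF t])
  also have "\<dots> = (\<Sum>p | p permutes {..<n}. - (of_int (sign p) * prod_list (map (\<lambda>j. M $$ (p j, j)) [0..<n])))"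
  proof (rule sum.cong[OF refl])
    fix p assume "p \<in> {p. p permutes {..<n}}"
    then have p: "p permutes {..<n}"
      by simp
    have "sign (p \<circ> ?t) = - sign p"
      using p by (rule sign_compose_adjacent)
    then show "?g (p \<circ> ?t) = - (of_int (sign p) * prod_list (map (\<lambda>j. M $$ (p j, j)) [0..<n]))"
      using prod_list_swap_adjacent[OF p] by simp
  qed
  also have "\<dots> = - sdet M"
    using M by (simp add: sdet_def sum_negf)
  finally show ?thesis .
qed

text \<open>Antisymmetry would only give 2 * det = 0. Instead the summands of p and of p composed
  with the transposition are cancelled in pairs.\<close>

lemma sdet_equal_adjacent:
  assumes eq: "\<And>i. i < n \<Longrightarrow> M $$ (i, l) = M $$ (i, Suc l)"
  shows "sdet M = 0"
proof -
  let ?t = "Transposition.transpose l (Suc l)"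
  have t: "?t permutes {..<n}"
    using l by (intro permutes_swap_id) auto
  have sM: "swap_adjacent l M = M"
    using M l eq by (intro eq_matI) (auto simp: swap_adjacent_def Transposition.transpose_def)
  define g where "g p = of_int (sign p) * prod_list (map (\<lambda>j. M $$ (p j, j)) [0..<n])" for p
  define P where "P = {p. p permutes {..<n}}"
  \<comment> \<open>One permutation from each pair, selected by the order of its values at l and l +
    1.\<close>
  define Q where "Q = {p \<in> P. p l < p (Suc l)}"
  have fin: "finite P"
    by (simp add: P_def finite_permutations)
  have gt: "g (p \<circ> ?t) = - g p" if "p \<in> P" for p
  proof -
    have p: "p permutes {..<n}"
      using that by (simp add: P_def)
    have "sign (p \<circ> ?t) = - sign p"
      using p by (rule sign_compose_adjacent)
    then show ?thesis
      using prod_list_swap_adjacent[OF p] by (simp add: g_def sM)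
  qed
  have pt: "p \<circ> ?t \<in> P" if "p \<in> P" for p
    using that t by (simp add: P_def permutes_compose)
  have tt: "(p \<circ> ?t) \<circ> ?t = p" for p :: "nat \<Rightarrow> nat"
    by (simp add: comp_assoc)
  have PQ: "P - Q = (\<lambda>p. p \<circ> ?t) ` Q"
  proof (intro equalityI subsetI)
    fix p assume p: "p \<in> P - Q"
    then have "inj p"
      by (auto simp: P_def permutes_inj)
    then have "p l \<noteq> p (Suc l)"
      by (metis injD n_not_Suc_n)
    with p have "p \<circ> ?t \<in> Q"
      using pt[of p] by (auto simp: Q_def)
    then show "p \<in> (\<lambda>p. p \<circ> ?t) ` Q"
      using tt[of p] by (intro image_eqI[of _ _ "p \<circ> ?t"]) auto
  qed (auto simp: Q_def pt)
  have inj: "inj_on (\<lambda>p. p \<circ> ?t) Q"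
    by (rule inj_onI) (metis tt)
  have "sdet M = sum g P"
    using M by (simp add: sdet_def g_def P_def)
  also have "\<dots> = sum g Q + sum g (P - Q)"
    using fin by (subst sum.subset_diff[of Q P]) (auto simp: Q_def add.commute)
  also have "sum g (P - Q) = (\<Sum>p\<in>Q. - g p)"
    unfolding PQ sum.reindex[OF inj] by (intro sum.cong) (auto simp: gt Q_def)
  finally show ?thesis
    by (simp add: sum_negf)
qed

end

section \<open>Inversions and alternating functions of lists\<close>

definition inversions :: "nat list \<Rightarrow> (nat \<times> nat) set" where
  "inversions ds = {(i, j). i < j \<and> j < length ds \<and> ds ! i > ds ! j}"

lemma finite_inversions: "finite (inversions ds)"
  by (rule finite_subset[of _ "{..<length ds} \<times> {..<length ds}"]) (auto simp: inversions_def)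

text \<open>Exchanging the positions l and l + 1 is a bijection between the two inversion sets,
  apart from the pair (l, l + 1) itself, which is an inversion only before the exchange.\<close>

lemma card_inversions_swap:
  assumes "y < x"
  shows "card (inversions (xs @ x # y # ys)) = Suc (card (inversions (xs @ y # x # ys)))"
proof -
  let ?l = "length xs"
  let ?t = "Transposition.transpose ?l (Suc ?l)"
  let ?a = "xs @ x # y # ys" and ?b = "xs @ y # x # ys"
  let ?f = "map_prod ?t ?t"
  have nth: "?a ! ?t i = ?b ! i" for i
    by (auto simp: Transposition.transpose_def nth_append nth_Cons split: nat.splits)
  have nth': "?b ! ?t i = ?a ! i" for i
    using nth[of "?t i"] by simp
  have len: "?t j < length ?a \<longleftrightarrow> j < length ?a" for j
    by (auto simp: Transposition.transpose_def)
  have ord: "?t i < ?t j" if "i < j" "(i, j) \<noteq> (?l, Suc ?l)" for i j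
    using that by (auto simp: Transposition.transpose_def)
  have ff: "?f (?f z) = z" for z
    by (cases z) simp
  have "inversions ?a = insert (?l, Suc ?l) (?f ` inversions ?b)"
  proof (intro equalityI subsetI)
    fix z assume z: "z \<in> inversions ?a"
    show "z \<in> insert (?l, Suc ?l) (?f ` inversions ?b)"
    proof (cases "z = (?l, Suc ?l)")
      case False
      obtain i j where ij: "z = (i, j)"
        by fastforce
      have "?f z \<in> inversions ?b"
        using z ord[of i j] False nth'[of i] nth'[of j] len[of j] unfolding ij inversions_def by auto
      then show ?thesis
        using ff[of z] by (metis imageI insertCI)
    qed simp
  next
    fix z assume "z \<in> insert (?l, Suc ?l) (?f ` inversions ?b)"
    then consider "z = (?l, Suc ?l)" | w where "z = ?f w" "w \<in> inversions ?b"
      by (metis imageE insertE)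
    then show "z \<in> inversions ?a"
    proof cases
      case 1
      then show ?thesis
        using assms by (auto simp: inversions_def nth_append)
    next
      case 2
      obtain i j where ij: "w = (i, j)"
        by fastforce
      have "(i, j) \<noteq> (?l, Suc ?l)"
        using 2 assms by (auto simp: ij inversions_def nth_append)
      then show ?thesis
        using 2 ord[of i j] nth[of i] nth[of j] len[of j] unfolding ij inversions_def by auto
    qed
  qed
  moreover have "(?l, Suc ?l) \<notin> ?f ` inversions ?b"
  proof
    assume "(?l, Suc ?l) \<in> ?f ` inversions ?b"
    then have "?f (?l, Suc ?l) \<in> inversions ?b"
      using ff by (metis imageE)
    then show False
      by (simp add: inversions_def)
  qed
  moreover have "inj_on ?f (inversions ?b)"
    by (rule inj_onI) (metis ff)
  ultimately show ?thesis
    by (simp add: finite_inversions card_image)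
qed

lemma inversion_sign_altdef: "inversion_sign ds = (- 1) ^ card (inversions ds)"
  by (simp add: inversion_sign_def inversions_def)

lemma inversion_sign_sorted: "sorted ds \<Longrightarrow> inversion_sign ds = 1"
proof -
  assume "sorted ds"
  then have "inversions ds = {}"
    by (auto simp: inversions_def dest: sorted_nth_mono[of ds, OF _ less_imp_le])
  then show ?thesis
    by (simp add: inversion_sign_altdef)
qed

text \<open>Bubble sort, by induction on the number of inversions: an unsorted list has a
  neighbouring descent, whose exchange costs one sign; a sorted list with repetitions has equal
  neighbours. Both hypotheses concern only rearrangements of \<open>ds\<close>, so restrictions on
  the labels of \<open>ds\<close> remain usable when they are verified.\<close>

lemma alternating_sort:
  fixes F :: "nat list \<Rightarrow> 'a::ring_1"
  assumes swap: "\<And>xs x y ys. mset (xs @ x # y # ys) = mset ds \<Longrightarrow> y < x \<Longrightarrow> F (xs @ y # x # ys) = - F (xs @ x # y # ys)"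
    and zero: "\<And>xs x ys. mset (xs @ x # x # ys) = mset ds \<Longrightarrow> F (xs @ x # x # ys) = 0"
  shows "F ds = (if distinct ds then inversion_sign ds * F (sort ds) else 0)"
proof -
  have "F es = (if distinct es then inversion_sign es * F (sort es) else 0)" if "mset es = mset ds" for es
    using that
  proof (induction "card (inversions es)" arbitrary: es rule: less_induct)
    case less
    show ?case
    proof (cases "sorted es")
      case srt: True
      show ?thesis
      proof (cases "distinct es")
        case True
        then show ?thesis
          using srt by (simp add: inversion_sign_sorted sorted_sort_id)
      next
        case False
        then have "\<not> sorted_wrt (<) es"
          by (simp add: strict_sorted_iff)
        then obtain i where i: "Suc i < length es" "\<not> es ! i < es ! Suc i"
          by (auto simp: sorted_wrt_iff_nth_Suc_transp[OF transp_on_less])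
        then have i: "Suc i < length es" "es ! i = es ! Suc i"
          using srt by (auto simp: sorted_iff_nth_Suc not_less intro: antisym)
        have "es = take i es @ es ! i # es ! i # drop (Suc (Suc i)) es"
          using i by (metis Cons_nth_drop_Suc Suc_lessD append_take_drop_id)
        then have "F es = 0"
          using zero[of "take i es" "es ! i" "drop (Suc (Suc i)) es"] less.prems by metis
        then show ?thesis
          using False by simp
      qed
    next
      case False
      then obtain i where i: "Suc i < length es" "es ! Suc i < es ! i"
        by (auto simp: sorted_iff_nth_Suc not_le)
      define xs x y ys where "xs = take i es" and "x = es ! i" and "y = es ! Suc i" and "ys = drop (Suc (Suc i)) es"
      have es: "es = xs @ x # y # ys"
        unfolding xs_def x_def y_def ys_def using i by (metis Cons_nth_drop_Suc Suc_lessD append_take_drop_id)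
      let ?es = "xs @ y # x # ys"
      have xy: "y < x"
        using i by (simp add: x_def y_def)
      have c: "card (inversions es) = Suc (card (inversions ?es))"
        unfolding es using card_inversions_swap[OF xy] .
      have ms: "mset ?es = mset es"
        by (simp add: es)
      have "F es = - F ?es"
        using swap[of xs x y ys] xy less.prems by (simp add: es)
      also have "F ?es = (if distinct ?es then inversion_sign ?es * F (sort ?es) else 0)"
        using c ms less.prems by (intro less.hyps) auto
      also have "sort ?es = sort es"
        by (metis ms properties_for_sort mset_sort sorted_sort)
      also have "distinct ?es = distinct es"
        using ms by (metis mset_eq_imp_distinct_iff)
      also have "inversion_sign ?es = (- inversion_sign es :: 'a)"
        by (simp add: inversion_sign_altdef c)
      finally show ?thesis
        by simp
    qed
  qed
  then show ?thesis
    by simp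
qed

section \<open>Matrices over a superalgebra\<close>

text \<open>This rule and the following ones have equations between dimensions as side conditions,
  so that they can be used together as rewrite rules.\<close>

lemma mat_assoc:
  "dim_col A = dim_row B \<Longrightarrow> dim_col B = dim_row C \<Longrightarrow> A * B * C = A * (B * (C :: 'a::semiring_0 mat))"
  by (rule assoc_mult_mat[of A _ _ B _ C]) auto

lemma mat_mult_add:
  "dim_col A = dim_row B \<Longrightarrow> dim_row C = dim_row B \<Longrightarrow> dim_col C = dim_col B \<Longrightarrow>
    A * (B + C) = A * B + A * (C :: 'a::semiring_0 mat)"
  by (rule mult_add_distrib_mat[of A _ _ B _ C]) auto

lemma mat_add_mult:
  "dim_row B = dim_row A \<Longrightarrow> dim_col B = dim_col A \<Longrightarrow> dim_col A = dim_row C \<Longrightarrow>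
    (A + B) * C = A * C + B * (C :: 'a::semiring_0 mat)"
  by (rule add_mult_distrib_mat[of A _ _ B C]) auto

lemma mat_mult_minus:
  "dim_col A = dim_row B \<Longrightarrow> dim_row C = dim_row B \<Longrightarrow> dim_col C = dim_col B \<Longrightarrow>
    A * (B - C) = A * B - A * (C :: 'a::ring_1 mat)"
  by (rule mult_minus_distrib_mat[of A _ _ B _ C]) auto

lemma mat_minus_mult:
  "dim_row B = dim_row A \<Longrightarrow> dim_col B = dim_col A \<Longrightarrow> dim_col A = dim_row C \<Longrightarrow>
    (A - B) * C = A * C - B * (C :: 'a::ring_1 mat)"
  by (rule minus_mult_distrib_mat[of A _ _ B C]) auto

lemma mat_mult_uminus:
  "dim_col A = dim_row B \<Longrightarrow> A * (- B) = - (A * (B :: 'a::ring_1 mat))"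
  by (intro eq_matI) (auto simp: scalar_prod_def sum_negf)

lemma mat_uminus_mult:
  "dim_col A = dim_row B \<Longrightarrow> (- A) * B = - (A * (B :: 'a::ring_1 mat))"
  by (intro eq_matI) (auto simp: scalar_prod_def sum_negf)

lemma mat_mult_one: "dim_col A = n \<Longrightarrow> A * 1\<^sub>m n = (A :: 'a::semiring_1 mat)"
  and mat_one_mult: "dim_row A = n \<Longrightarrow> 1\<^sub>m n * A = A"
  by (auto intro: right_mult_one_mat left_mult_one_mat)

lemmas mat_ring = mat_assoc mat_mult_add mat_add_mult mat_mult_minus mat_minus_mult
  mat_mult_uminus mat_uminus_mult mat_mult_one mat_one_mult

locale superalgebra =
  fixes A :: "bool \<Rightarrow> 'a::ring_1 set"
  assumes superalgebra: "comm_superalgebra A"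
begin

lemma A_0: "0 \<in> A p" and A_add: "x \<in> A p \<Longrightarrow> y \<in> A p \<Longrightarrow> x + y \<in> A p"
  and A_uminus: "x \<in> A p \<Longrightarrow> - x \<in> A p"
  and A_1: "1 \<in> A False"
  using superalgebra unfolding comm_superalgebra_def by blast+

lemma A_minus: "x \<in> A p \<Longrightarrow> y \<in> A p \<Longrightarrow> x - y \<in> A p"
  using A_add[of x p "- y"] A_uminus[of y p] by simp

lemma A_mult: "x \<in> A p \<Longrightarrow> y \<in> A q \<Longrightarrow> x * y \<in> A (p \<noteq> q)"
  and A_commute: "x \<in> A p \<Longrightarrow> y \<in> A q \<Longrightarrow> x * y = (if p \<and> q then - (y * x) else y * x)"
  using superalgebra unfolding comm_superalgebra_def by blast+

lemma A_even_mult: "x \<in> A False \<Longrightarrow> y \<in> A p \<Longrightarrow> x * y \<in> A p"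
  using A_mult[of x False y p] by simp

lemma A_mult_even: "x \<in> A p \<Longrightarrow> y \<in> A False \<Longrightarrow> x * y \<in> A p"
  using A_mult[of x p y False] by simp

lemma odd_square: "x \<in> A True \<Longrightarrow> x * x = 0"
  using superalgebra unfolding comm_superalgebra_def by blast

lemma A_sum: "(\<And>i. i \<in> I \<Longrightarrow> f i \<in> A p) \<Longrightarrow> sum f I \<in> A p"
  by (induction I rule: infinite_finite_induct) (auto intro: A_0 A_add)

lemma A_decompose:
  obtains e d where "e \<in> A False" "d \<in> A True" "z = e + d"
proof -
  have "\<exists>w. fst w \<in> A False \<and> snd w \<in> A True \<and> z = fst w + snd w"
    using superalgebra unfolding comm_superalgebra_def by blast
  then show ?thesis
    using that by blast
qed

lemma A_decompose_unique:
  assumes "e \<in> A False" "d \<in> A True" "e' \<in> A False" "d' \<in> A True" "e + d = e' + d'"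
  shows "e = e'"
proof -
  have "\<exists>!w. fst w \<in> A False \<and> snd w \<in> A True \<and> e + d = fst w + snd w"
    using superalgebra unfolding comm_superalgebra_def by blast
  then obtain w where w: "\<And>v. fst v \<in> A False \<and> snd v \<in> A True \<and> e + d = fst v + snd v \<Longrightarrow> v = w"
    by (elim ex1E) metis
  have "(e, d) = w" "(e', d') = w"
    using assms by (intro w; simp)+
  then have "(e, d) = (e', d')"
    by (rule trans[OF _ sym])
  then show ?thesis
    by (rule Pair_inject)
qed

lemma even_central: 
  assumes "x \<in> A False"
  shows "central x"
  unfolding central_def
proof
  fix y
  obtain e d where y: "e \<in> A False" "d \<in> A True" "y = e + d"
    by (rule A_decompose)
  then show "x * y = y * x"
    using A_commute[OF assms y(1)] A_commute[OF assms y(2)] by (simp add: distrib_left distrib_right)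
qed

section \<open>Homogeneous matrices and parities of determinants\<close>

definition homog :: "bool \<Rightarrow> 'a mat \<Rightarrow> bool" where
  "homog p M \<longleftrightarrow> (\<forall>i<dim_row M. \<forall>j<dim_col M. M $$ (i, j) \<in> A p)"

lemma homog_central: "homog False M \<Longrightarrow> central_mat M"
  unfolding homog_def central_mat_def using even_central by blast

lemma homog_mult: "homog p M \<Longrightarrow> homog q N \<Longrightarrow> dim_col M = dim_row N \<Longrightarrow> homog (p \<noteq> q) (M * N)"
  unfolding homog_def
proof (intro allI impI)
  fix i j
  assume M: "\<forall>i<dim_row M. \<forall>j<dim_col M. M $$ (i, j) \<in> A p"
    and N: "\<forall>i<dim_row N. \<forall>j<dim_col N. N $$ (i, j) \<in> A q"
    and d: "dim_col M = dim_row N" and ij: "i < dim_row (M * N)" "j < dim_col (M * N)"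
  have "(\<Sum>k = 0..<dim_row N. M $$ (i, k) * N $$ (k, j)) \<in> A (p \<noteq> q)"
    using M N d ij by (intro A_sum A_mult) auto
  then show "(M * N) $$ (i, j) \<in> A (p \<noteq> q)"
    using d ij by (simp add: scalar_prod_def)
qed

lemma homog_mult_False_False: "homog False M \<Longrightarrow> homog False N \<Longrightarrow> dim_col M = dim_row N \<Longrightarrow> homog False (M * N)"
  and homog_mult_False_True: "homog False M \<Longrightarrow> homog True N \<Longrightarrow> dim_col M = dim_row N \<Longrightarrow> homog True (M * N)"
  and homog_mult_True_False: "homog True M \<Longrightarrow> homog False N \<Longrightarrow> dim_col M = dim_row N \<Longrightarrow> homog True (M * N)"
  and homog_mult_True_True: "homog True M \<Longrightarrow> homog True N \<Longrightarrow> dim_col M = dim_row N \<Longrightarrow> homog False (M * N)"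
  by (auto dest: homog_mult)

lemma homog_add: "homog p M \<Longrightarrow> homog p N \<Longrightarrow> dim_row N = dim_row M \<Longrightarrow> dim_col N = dim_col M \<Longrightarrow> homog p (M + N)"
  unfolding homog_def by (auto intro: A_add)

lemma homog_minus: "homog p M \<Longrightarrow> homog p N \<Longrightarrow> dim_row N = dim_row M \<Longrightarrow> dim_col N = dim_col M \<Longrightarrow> homog p (M - N)"
  unfolding homog_def by (auto intro: A_minus)

lemma homog_uminus: "homog p M \<Longrightarrow> homog p (- M)"
  unfolding homog_def by (auto intro: A_uminus)

lemma homog_one: "homog False (1\<^sub>m n)"
  unfolding homog_def by (auto intro: A_0 A_1)

lemmas homog_intros = homog_mult_False_False homog_mult_False_True homog_mult_True_False
  homog_mult_True_True homog_add homog_minus homog_uminus homog_one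

text \<open>Taking even parts in M * N = 1 is possible because M is even; so the even part K of the
  inverse N is again a right inverse, and N = N * (M * K) = K.\<close>

lemma homog_inv_matrix:
  assumes M: "M \<in> carrier_mat n n" "homog False M" and inv: "invertible_mat M"
  shows "homog False (inv_matrix M)"
proof -
  note N = inv_matrix[OF M(1) inv]
  let ?N = "inv_matrix M"
  have "\<exists>e. e \<in> A False \<and> (\<exists>d. d \<in> A True \<and> z = e + d)" for z
    using A_decompose[of z] by blast
  then obtain e where e: "\<And>z. e z \<in> A False" "\<And>z. \<exists>d. d \<in> A True \<and> z = e z + d"
    by metis
  then obtain d where d: "\<And>z. d z \<in> A True" "\<And>z. z = e z + d z"
    by metis
  define K where "K = map_mat e ?N"
  have K: "K \<in> carrier_mat n n"
    using N by (simp add: K_def)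
  have "M * K = 1\<^sub>m n"
  proof (rule eq_matI)
    fix i j assume "i < dim_row (1\<^sub>m n :: 'a mat)" "j < dim_col (1\<^sub>m n :: 'a mat)"
    then have ij: "i < n" "j < n"
      by auto
    have "(\<Sum>k = 0..<n. M $$ (i, k) * e (?N $$ (k, j))) + (\<Sum>k = 0..<n. M $$ (i, k) * d (?N $$ (k, j))) =
        (\<Sum>k = 0..<n. M $$ (i, k) * ?N $$ (k, j))"
      unfolding sum.distrib[symmetric] distrib_left[symmetric] d(2)[symmetric] ..
    also have "\<dots> = (M * ?N) $$ (i, j)"
      using ij M N(1) by (simp add: scalar_prod_def)
    also have "\<dots> = (1\<^sub>m n :: 'a mat) $$ (i, j) + 0"
      by (simp add: N)
    finally have eq: "(\<Sum>k = 0..<n. M $$ (i, k) * e (?N $$ (k, j))) + (\<Sum>k = 0..<n. M $$ (i, k) * d (?N $$ (k, j))) =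
        (1\<^sub>m n :: 'a mat) $$ (i, j) + 0" .
    have M': "M $$ (i, k) \<in> A False" if "k \<in> {0..<n}" for k
      using M ij that by (simp add: homog_def)
    have "(1\<^sub>m n :: 'a mat) $$ (i, j) \<in> A False"
      using ij by (simp add: A_0 A_1)
    then have "(\<Sum>k = 0..<n. M $$ (i, k) * e (?N $$ (k, j))) = (1\<^sub>m n :: 'a mat) $$ (i, j)"
      by (intro A_decompose_unique[OF _ _ _ _ eq] A_sum A_even_mult M' e(1) d(1) A_0)
    then show "(M * K) $$ (i, j) = (1\<^sub>m n :: 'a mat) $$ (i, j)"
      using ij M N(1) by (simp add: K_def scalar_prod_def)
  qed (use M K in auto)
  have "?N = ?N * (M * K)"
    using N \<open>M * K = 1\<^sub>m n\<close> by simp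
  also have "\<dots> = ?N * M * K"
    using N M K by (intro assoc_mult_mat[symmetric])
  also have "\<dots> = K"
    using N K by simp
  finally have "?N = K" .
  moreover have "homog False K"
    using N(1) e(1) by (auto simp: homog_def K_def)
  ultimately show ?thesis
    by simp
qed

text \<open>\<open>k\<close> is the position of the single odd factor; a value
  \<open>k \<ge> n\<close> encodes that there is none.\<close>

lemma prod_list_parity:
  assumes "\<And>j. j < n \<Longrightarrow> f j \<in> A (j = k)"
  shows "prod_list (map f [0..<n]) \<in> A (k < n)"
  using assms
proof (induction n)
  case (Suc n)
  have "prod_list (map f [0..<n]) * f n \<in> A ((k < n) \<noteq> (n = k))"
    using Suc by (intro A_mult) auto
  also have "((k < n) \<noteq> (n = k)) = (k < Suc n)"
    by auto
  finally show ?case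
    by simp
qed (simp add: A_1)

lemma of_int_even: "of_int z \<in> A False"
proof -
  have "of_nat k \<in> A False" for k
    by (induction k) (auto intro: A_0 A_1 A_add)
  then show ?thesis
    by (cases z) (auto intro!: A_uminus simp del: of_nat_Suc)
qed

text \<open>\<open>k\<close> is the wrong-parity column; \<open>k \<ge> n\<close> means that all
  columns are even.\<close>

lemma sdet_parity:
  assumes M: "M \<in> carrier_mat n n" and par: "\<And>i j. i < n \<Longrightarrow> j < n \<Longrightarrow> M $$ (i, j) \<in> A (j = k)"
  shows "sdet M \<in> A (k < n)"
proof -
  have "of_int (sign p) * prod_list (map (\<lambda>j. M $$ (p j, j)) [0..<n]) \<in> A (k < n)"
    if p: "p permutes {..<n}" for p
  proof (intro A_even_mult of_int_even prod_list_parity par)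
    fix j assume "j < n"
    then show "p j < n"
      using permutes_in_image[OF p, of j] by simp
  qed
  then show ?thesis
    using M by (auto simp: sdet_def intro!: A_sum)
qed

lemma even_sdet:
  assumes "M \<in> carrier_mat n n" "homog False M"
  shows "sdet M \<in> A False"
  using sdet_parity[of M n n] assms by (auto simp: homog_def)

text \<open>As for matrices: the even part of the inverse is already a right inverse, and
  \<open>x\<close> can be cancelled.\<close>

lemma even_inv_elem:
  assumes "x \<in> A False" "invertible_elem x"
  shows "inv_elem x \<in> A False"
proof -
  obtain e d where y: "e \<in> A False" "d \<in> A True" "inv_elem x = e + d"
    by (rule A_decompose)
  have "x * e + x * d = 1 + 0"
    using assms by (simp add: distrib_left[symmetric] y(3)[symmetric])
  then have "x * e = 1"
    by (intro A_decompose_unique[of "x * e" "x * d" 1 0] A_even_mult assms y A_1 A_0)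
  then have "x * e = x * inv_elem x"
    using assms by simp
  then have "e = inv_elem x"
    by (rule invertible_elem_left_cancel[OF assms(2)])
  then show ?thesis
    using y by simp
qed

text \<open>P * Q is concentrated in column a and Q * P in row b, so each determinant is that of an
  identity matrix with one column (after transposition in the second case) replaced.\<close>

lemma sdet_one_minus_entry:
  assumes P: "P \<in> carrier_mat r s" "homog True P" and q: "q \<in> A True" and ab: "a < r" "b < s"
  defines "Q \<equiv> mat s r (\<lambda>(i, j). if i = b \<and> j = a then q else 0)"
  shows "sdet (1\<^sub>m r - P * Q) = 1 - P $$ (a, b) * q"
    and "sdet (1\<^sub>m s - Q * P) = 1 + P $$ (a, b) * q"
proof -
  have Qc: "Q \<in> carrier_mat s r" and Qo: "homog True Q"
    using q by (auto simp: Q_def homog_def A_0)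
  have PQ: "(P * Q) $$ (i, j) = (if j = a then P $$ (i, b) * q else 0)" if "i < r" "j < r" for i j
  proof -
    have "(P * Q) $$ (i, j) = (\<Sum>k = 0..<s. P $$ (i, k) * (if k = b \<and> j = a then q else 0))"
      using that P by (simp add: Q_def scalar_prod_def)
    also have "\<dots> = (\<Sum>k = 0..<s. if k = b then (if j = a then P $$ (i, b) * q else 0) else 0)"
      by (intro sum.cong) auto
    finally show ?thesis
      using ab by simp
  qed
  have QP: "(Q * P) $$ (i, j) = (if i = b then q * P $$ (a, j) else 0)" if "i < s" "j < s" for i j
  proof -
    have "(Q * P) $$ (i, j) = (\<Sum>k = 0..<r. (if i = b \<and> k = a then q else 0) * P $$ (k, j))"
      using that P by (simp add: Q_def scalar_prod_def)
    also have "\<dots> = (\<Sum>k = 0..<r. if k = a then (if i = b then q * P $$ (a, j) else 0) else 0)"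
      by (intro sum.cong) auto
    finally show ?thesis
      using ab by simp
  qed
  have "1\<^sub>m r - P * Q = mat r r (\<lambda>(i, j). if j = a then (if i = a then 1 else 0) - P $$ (i, b) * q
      else if i = j then 1 else 0)"
    using P Qc by (intro eq_matI) (auto simp: PQ simp del: index_mult_mat(1))
  then show "sdet (1\<^sub>m r - P * Q) = 1 - P $$ (a, b) * q"
    using sdet_id_col[OF ab(1), of "\<lambda>i. (if i = a then 1 else 0) - P $$ (i, b) * q"] by simp
  have ev: "homog False (1\<^sub>m s - Q * P)"
    using P Qc Qo by (intro homog_intros) auto
  have "transpose_mat (1\<^sub>m s - Q * P) = mat s s (\<lambda>(i, j). if j = b then (if i = b then 1 else 0) - q * P $$ (a, i)
      else if i = j then 1 else 0)"
    using P Qc by (intro eq_matI) (auto simp: QP simp del: index_mult_mat(1))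
  then have "sdet (transpose_mat (1\<^sub>m s - Q * P)) = 1 - q * P $$ (a, b)"
    using sdet_id_col[OF ab(2), of "\<lambda>i. (if i = b then 1 else 0) - q * P $$ (a, i)"] by simp
  moreover have "sdet (transpose_mat (1\<^sub>m s - Q * P)) = sdet (1\<^sub>m s - Q * P)"
    using P Qc ev by (intro sdet_transpose[of _ s] homog_central) auto
  \<comment> \<open>The sign of anticommutation turns 1 - q P(a,b) into 1 + P(a,b) q; this is where
    the two determinants become inverse rather than equal.\<close>
  moreover have "q * P $$ (a, b) = - (P $$ (a, b) * q)"
    using A_commute[OF q, of "P $$ (a, b)" True] P ab by (auto simp: homog_def)
  ultimately show "sdet (1\<^sub>m s - Q * P) = 1 + P $$ (a, b) * q"
    by simp
qed

text \<open>
  Induction on the number of nonzero entries of \<open>Q = Q1 + Q2\<close>, with a single entry in \<open>Q1\<close>.  With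
  \<open>G = (1 - P * Q1)\<inverse>\<close> one has \<open>1 - P * Q = (1 - P * Q1) * (1 - (G * P) * Q2)\<close> and
  \<open>1 - Q * P = (1 - Q2 * (G * P)) * (1 - Q1 * P)\<close>.
\<close>

lemma sdet_one_minus_odd:
  assumes P: "P \<in> carrier_mat r s" "homog True P" and Q: "Q \<in> carrier_mat s r" "homog True Q"
  shows "sdet (1\<^sub>m r - P * Q) * sdet (1\<^sub>m s - Q * P) = 1"
proof -
  \<comment> \<open>Stated for all P and Q because the inductive step replaces P by G * P. The set K
    bounds the support of Q.\<close>
  have "sdet (1\<^sub>m r - P * Q) * sdet (1\<^sub>m s - Q * P) = 1"
    if "finite K" "K \<subseteq> {..<s} \<times> {..<r}"
      "P \<in> carrier_mat r s" "homog True P" "Q \<in> carrier_mat s r" "homog True Q"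
      "\<And>i j. i < s \<Longrightarrow> j < r \<Longrightarrow> (i, j) \<notin> K \<Longrightarrow> Q $$ (i, j) = 0" for K P Q
    using that
  proof (induction K arbitrary: P Q rule: finite_induct)
    case empty
    then have "Q = 0\<^sub>m s r"
      by (intro eq_matI) auto
    with empty have "1\<^sub>m r - P * Q = 1\<^sub>m r" "1\<^sub>m s - Q * P = 1\<^sub>m s"
      by auto
    then show ?case
      by simp
  next
    case (insert ba K)
    obtain b a where ba: "ba = (b, a)"
      by fastforce
    have ab: "a < r" "b < s"
      using insert.prems(1) by (auto simp: ba)
    note P = insert.prems(2,3) and Q = insert.prems(4,5)
    define q where "q = Q $$ (b, a)"
    have q: "q \<in> A True"
      using Q ab by (simp add: q_def homog_def)
    define Q1 where "Q1 = mat s r (\<lambda>(i, j). if i = b \<and> j = a then q else 0)"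
    define Q2 where "Q2 = mat s r (\<lambda>(i, j). if i = b \<and> j = a then 0 else Q $$ (i, j))"
    have Q1: "Q1 \<in> carrier_mat s r" "homog True Q1" and Q2: "Q2 \<in> carrier_mat s r" "homog True Q2"
      using q Q by (auto simp: Q1_def Q2_def homog_def A_0)
    have QQ: "Q = Q1 + Q2"
      using Q(1) by (intro eq_matI) (auto simp: Q1_def Q2_def q_def)
    define x where "x = P $$ (a, b) * q"
    have Pab: "P $$ (a, b) \<in> A True"
      using P ab by (simp add: homog_def)
    \<comment> \<open>Vanishing of x * x makes 1 - x and 1 + x inverse to each other, which settles
      the contribution of Q1 and the existence of G.\<close>
    have "x * x = P $$ (a, b) * (q * P $$ (a, b)) * q"
      by (simp add: x_def mult.assoc)
    also have "q * P $$ (a, b) = - (P $$ (a, b) * q)"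
      using A_commute[OF q Pab] by simp
    also have "P $$ (a, b) * - (P $$ (a, b) * q) * q = - (P $$ (a, b) * P $$ (a, b)) * (q * q)"
      by (simp add: mult.assoc)
    also have "\<dots> = 0"
      by (simp add: odd_square[OF q])
    finally have xx: "x * x = 0" .
    define D where "D = 1\<^sub>m r - P * Q1"
    have D: "D \<in> carrier_mat r r" "homog False D"
      unfolding D_def using P Q1 by (auto intro!: homog_intros)
    have dD: "sdet D = 1 - x" and dD': "sdet (1\<^sub>m s - Q1 * P) = 1 + x"
      unfolding D_def Q1_def x_def using sdet_one_minus_entry[OF P q ab] by auto
    have inv: "(1 - x) * (1 + x) = 1" "(1 + x) * (1 - x) = 1"
      using xx by (simp_all add: algebra_simps)
    then have "invertible_mat D"
      unfolding invertible_elem_sdet_iff[OF D(1) homog_central[OF D(2)], symmetric] dD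
      by (auto simp: invertible_elem_def is_inverse_def)
    define G where "G = inv_matrix D"
    note G = inv_matrix[OF D(1) \<open>invertible_mat D\<close>, folded G_def]
      homog_inv_matrix[OF D \<open>invertible_mat D\<close>, folded G_def]
    have GP: "G * P \<in> carrier_mat r s" "homog True (G * P)"
      using G P by (auto intro!: homog_mult_False_True)
    have DGP: "D * (G * P) = P"
      using G D P by (simp add: mat_assoc[symmetric])
    have e1: "1\<^sub>m r - P * Q = D * (1\<^sub>m r - (G * P) * Q2)"
    proof -
      have "D * (1\<^sub>m r - (G * P) * Q2) = D - D * (G * P) * Q2"
        using G D P Q2 by (simp add: mat_ring)
      then show ?thesis
        unfolding DGP using P Q1 Q2
        by (intro eq_matI) (auto simp: D_def QQ mat_ring simp del: index_mult_mat(1))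
    qed
    have e2: "1\<^sub>m s - Q * P = (1\<^sub>m s - Q2 * (G * P)) * (1\<^sub>m s - Q1 * P)"
    proof -
      have "P - P * (Q1 * P) = D * P"
        unfolding D_def using P Q1 by (simp add: mat_ring)
      then have "G * (P - P * (Q1 * P)) = P"
        using G D P by (simp add: mat_assoc[symmetric])
      then have "Q2 * (G * (P - P * (Q1 * P))) = Q2 * P"
        by simp
      moreover have "(1\<^sub>m s - Q2 * (G * P)) * (1\<^sub>m s - Q1 * P) = (1\<^sub>m s - Q1 * P) - Q2 * (G * (P - P * (Q1 * P)))"
        using G P Q1 Q2 by (intro eq_matI) (auto simp: mat_ring simp del: index_mult_mat(1))
      ultimately show ?thesis
        using P Q1 Q2 by (intro eq_matI) (auto simp: QQ mat_ring simp del: index_mult_mat(1))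
    qed
    have IH: "sdet (1\<^sub>m r - (G * P) * Q2) * sdet (1\<^sub>m s - Q2 * (G * P)) = 1"
      using insert.prems GP Q2 insert.hyps
      by (intro insert.IH) (auto simp: Q2_def ba)
    have c1: "sdet (1\<^sub>m r - P * Q) = (1 - x) * sdet (1\<^sub>m r - (G * P) * Q2)"
      unfolding e1 dD[symmetric] using D G(1) P GP Q2 by (intro sdet_mult[of _ r] homog_central carrier_matI) auto
    have c2: "sdet (1\<^sub>m s - Q * P) = sdet (1\<^sub>m s - Q2 * (G * P)) * (1 + x)"
      unfolding e2 dD'[symmetric] using G(1) P Q1 GP Q2
      by (intro sdet_mult[of _ s] homog_central homog_minus homog_one homog_mult_True_True carrier_matI) auto
    have "sdet (1\<^sub>m r - P * Q) * sdet (1\<^sub>m s - Q * P) =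
      (1 - x) * (sdet (1\<^sub>m r - (G * P) * Q2) * sdet (1\<^sub>m s - Q2 * (G * P))) * (1 + x)"
      unfolding c1 c2 by (simp only: mult.assoc)
    then show ?case
      by (simp only: IH inv mult_1_right)
  qed
  from this[of "{..<s} \<times> {..<r}" P Q] show ?thesis
    using assms by auto
qed

lemma invertible_elem_sdet_one_minus_odd:
  assumes P: "P \<in> carrier_mat r s" "homog True P" and Q: "Q \<in> carrier_mat s r" "homog True Q"
  shows "invertible_elem (sdet (1\<^sub>m r - P * Q))"
proof -
  have "homog False (1\<^sub>m r - P * Q)"
    using assms by (auto intro!: homog_intros)
  then have "central (sdet (1\<^sub>m r - P * Q))"
    using assms by (intro central_sdet[of _ r] homog_central) auto
  then show ?thesis
    by (rule invertible_elem_factor[of _ "sdet (1\<^sub>m s - Q * P)"]) (simp add: sdet_one_minus_odd[OF assms])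
qed

end

section \<open>Berezinians of block matrices\<close>

context superalgebra
begin

lemma invertible_mat_mult:
  fixes M N :: "'a mat"
  assumes "M \<in> carrier_mat n n" "N \<in> carrier_mat n n" "homog False M" "homog False N"
    "invertible_mat M" "invertible_mat N"
  shows "invertible_mat (M * N)"
proof -
  have "invertible_elem (sdet (M * N))"
    using assms by (simp add: sdet_mult[of M n N] homog_central invertible_elem_mult invertible_elem_sdet_iff)
  moreover have "homog False (M * N)"
    using assms by (intro homog_mult_False_False) auto
  ultimately show ?thesis
    using assms by (subst invertible_elem_sdet_iff[symmetric, of _ n]) (auto intro: homog_central)
qed

text \<open>Only the two even diagonal blocks are required to be invertible.
  \<open>super_GL_frame\<close> and \<open>frame_super_GL\<close> show that this describes exactly
  GL(r|s), and in this form membership survives the exchange of parities.\<close>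

definition GL_blocks :: "nat \<Rightarrow> nat \<Rightarrow> 'a mat \<Rightarrow> 'a mat \<Rightarrow> 'a mat \<Rightarrow> 'a mat \<Rightarrow> bool" where
  "GL_blocks r s a b c d \<longleftrightarrow>
     a \<in> carrier_mat r r \<and> b \<in> carrier_mat r s \<and> c \<in> carrier_mat s r \<and> d \<in> carrier_mat s s \<and>
     homog False a \<and> homog True b \<and> homog True c \<and> homog False d \<and> invertible_mat a \<and> invertible_mat d"

lemma GL_blocks_D:
  assumes "GL_blocks r s a b c d"
  shows "a \<in> carrier_mat r r" "b \<in> carrier_mat r s" "c \<in> carrier_mat s r" "d \<in> carrier_mat s s"
    "homog False a" "homog True b" "homog True c" "homog False d" "invertible_mat a" "invertible_mat d"
  using assms by (auto simp: GL_blocks_def)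

lemma GL_blocks_swap: "GL_blocks r s a b c d \<Longrightarrow> GL_blocks s r d c b a"
  by (auto simp: GL_blocks_def)

text \<open>Describes b d^-1 by the equation X * d = b. For transformed blocks it then suffices to
  exhibit the transformed X, without manipulating inverse matrices.\<close>

lemma Ber_blocks_eqI:
  fixes X :: "'a mat"
  assumes d: "d \<in> carrier_mat s s" "invertible_mat d" and X: "X \<in> carrier_mat r s" "X * d = b"
  shows "Ber_blocks a b c d = sdet (a - X * c) * inv_elem (sdet d)"
proof -
  note i = inv_matrix[OF d]
  have "b * inv_matrix d = X"
    unfolding X(2)[symmetric] using X(1) d i by (simp add: mat_ring)
  then show ?thesis
    by (simp add: Ber_blocks_def)
qed

text \<open>With X = b d^-1 one has a - X c = a (1 - (a^-1 X) c), where a^-1 X and c are odd; so the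
  determinant of the second factor is a unit.\<close>

lemma Schur_complement:
  assumes "GL_blocks r s a b c d"
  obtains X where "X \<in> carrier_mat r s" "homog True X" "X * d = b"
    "Ber_blocks a b c d = sdet (a - X * c) * inv_elem (sdet d)"
    "a - X * c \<in> carrier_mat r r" "homog False (a - X * c)" "invertible_mat (a - X * c)"
proof -
  note a = GL_blocks_D(1,5,9)[OF assms] and b = GL_blocks_D(2,6)[OF assms]
    and c = GL_blocks_D(3,7)[OF assms] and d = GL_blocks_D(4,8,10)[OF assms]
  note ia = inv_matrix[OF a(1,3)] homog_inv_matrix[OF a] and id = inv_matrix[OF d(1,3)] homog_inv_matrix[OF d]
  define X where "X = b * inv_matrix d"
  have X: "X \<in> carrier_mat r s" "homog True X" "X * d = b"
    unfolding X_def using b d id by (auto intro: homog_mult_True_False simp: mat_ring)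
  define S where "S = a - X * c"
  have S: "S \<in> carrier_mat r r" "homog False S"
    unfolding S_def using a X c by (auto intro!: homog_minus homog_mult_True_True)
  have aX: "inv_matrix a * X \<in> carrier_mat r s" "homog True (inv_matrix a * X)"
    using ia X by (auto intro: homog_mult_False_True)
  have Sa: "S = a * (1\<^sub>m r - (inv_matrix a * X) * c)"
    unfolding S_def using a ia X c by (simp add: mat_ring mat_assoc[of a, symmetric])
  have "sdet S = sdet a * sdet (1\<^sub>m r - (inv_matrix a * X) * c)"
    unfolding Sa using a ia X c by (intro sdet_mult[of _ r] homog_central carrier_matI) auto
  also have "invertible_elem \<dots>"
    using aX c a by (intro invertible_elem_mult invertible_elem_sdet_one_minus_odd[of _ _ s])
      (auto simp: invertible_elem_sdet_iff[of _ r] homog_central)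
  finally have "invertible_mat S"
    using S by (simp add: invertible_elem_sdet_iff[of _ r] homog_central)
  with X S Ber_blocks_eqI[OF d(1,3) X(1,3)] show ?thesis
    by (intro that) (auto simp: S_def)
qed

lemma
  assumes "GL_blocks r s a b c d"
  shows Ber_blocks_even: "Ber_blocks a b c d \<in> A False"
    and invertible_Ber_blocks: "invertible_elem (Ber_blocks a b c d)"
proof -
  obtain X where X: "Ber_blocks a b c d = sdet (a - X * c) * inv_elem (sdet d)"
    "a - X * c \<in> carrier_mat r r" "homog False (a - X * c)" "invertible_mat (a - X * c)"
    by (rule Schur_complement[OF assms])
  have d: "d \<in> carrier_mat s s" "homog False d" "invertible_elem (sdet d)"
    using assms by (auto simp: GL_blocks_def invertible_elem_sdet_iff[of _ s] homog_central)
  show "Ber_blocks a b c d \<in> A False"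
    unfolding X(1) by (intro A_even_mult even_sdet[OF X(2,3)] even_inv_elem even_sdet[OF d(1,2)] d)
  show "invertible_elem (Ber_blocks a b c d)"
    unfolding X(1) using X(2-4) d
    by (intro invertible_elem_mult invertible_elem_inv_elem) (auto simp: invertible_elem_sdet_iff[of _ r] homog_central)
qed

text \<open>Put P = a^-1 b and Q = d^-1 c. The two Schur complements are a (1 - P Q) and d (1 - Q
  P); det a and det d cancel and \<open>sdet_one_minus_odd\<close> remains.\<close>

lemma Ber_blocks_inverse:
  assumes "GL_blocks r s a b c d"
  shows "Ber_blocks a b c d * Ber_blocks d c b a = 1"
proof -
  note a = GL_blocks_D(1,5,9)[OF assms] and b = GL_blocks_D(2,6)[OF assms]
    and c = GL_blocks_D(3,7)[OF assms] and d = GL_blocks_D(4,8,10)[OF assms]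
  note ia = inv_matrix[OF a(1,3)] homog_inv_matrix[OF a] and id = inv_matrix[OF d(1,3)] homog_inv_matrix[OF d]
  define P where "P = inv_matrix a * b"
  define Q where "Q = inv_matrix d * c"
  have P: "P \<in> carrier_mat r s" "homog True P" and Q: "Q \<in> carrier_mat s r" "homog True Q"
    unfolding P_def Q_def using a b c d ia id by (auto intro: homog_mult_False_True)
  have aP: "a * P = b" and dQ: "d * Q = c"
    unfolding P_def Q_def using a b c d ia id by (simp_all add: mat_assoc[symmetric] mat_one_mult)
  have da: "central (sdet a)" "invertible_elem (sdet a)" and dd: "central (sdet d)" "invertible_elem (sdet d)"
    using a d by (auto simp: invertible_elem_sdet_iff[of _ r] invertible_elem_sdet_iff[of _ s] homog_central intro: central_sdet)
  have PQ: "1\<^sub>m r - P * Q \<in> carrier_mat r r" "1\<^sub>m s - Q * P \<in> carrier_mat s s"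
    using P Q by (auto intro!: carrier_matI)
  have "a - b * inv_matrix d * c = a * (1\<^sub>m r - P * Q)"
    using a b c d P Q id by (simp add: mat_ring mat_assoc[of a P, symmetric] aP) (simp add: Q_def)
  then have 1: "Ber_blocks a b c d = sdet a * sdet (1\<^sub>m r - P * Q) * inv_elem (sdet d)"
    unfolding Ber_blocks_def using a PQ by (simp add: sdet_mult[of _ r] homog_central)
  have "d - c * inv_matrix a * b = d * (1\<^sub>m s - Q * P)"
    using a b c d P Q ia by (simp add: mat_ring mat_assoc[of d Q, symmetric] dQ) (simp add: P_def)
  then have 2: "Ber_blocks d c b a = sdet d * sdet (1\<^sub>m s - Q * P) * inv_elem (sdet a)"
    unfolding Ber_blocks_def using d PQ by (simp add: sdet_mult[of _ s] homog_central)
  have "Ber_blocks a b c d * Ber_blocks d c b a =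
    sdet a * (sdet (1\<^sub>m r - P * Q) * (inv_elem (sdet d) * sdet d) * sdet (1\<^sub>m s - Q * P)) * inv_elem (sdet a)"
    unfolding 1 2 by (simp only: mult.assoc)
  also have "\<dots> = 1"
    using da dd by (simp add: sdet_one_minus_odd[OF P Q])
  finally show ?thesis .
qed

text \<open>Factor out d: d + Y b = d (1 - Z b) with Z = - d^-1 Y odd.\<close>

lemma invertible_mat_plus_odd:
  assumes d: "d \<in> carrier_mat s s" "homog False d" "invertible_mat d"
    and Y: "Y \<in> carrier_mat s r" "homog True Y" and b: "b \<in> carrier_mat r s" "homog True b"
  shows "invertible_mat (d + Y * b)"
proof -
  note id = inv_matrix[OF d(1,3)] homog_inv_matrix[OF d]
  define Z where "Z = - (inv_matrix d * Y)"
  have Z: "Z \<in> carrier_mat s r" "homog True Z"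
    unfolding Z_def using id Y by (auto intro!: homog_uminus homog_mult_False_True)
  have dZ: "d * (Z * b) = - (Y * b)"
    unfolding Z_def using d id Y b by (simp add: mat_ring mat_assoc[of d "inv_matrix d", symmetric])
  have "d + Y * b = d * (1\<^sub>m s - Z * b)"
    using d Z b Y dZ by (intro eq_matI) (auto simp: mat_ring simp del: index_mult_mat(1))
  moreover have "invertible_mat (1\<^sub>m s - Z * b)" "homog False (1\<^sub>m s - Z * b)"
  proof -
    show h: "homog False (1\<^sub>m s - Z * b)"
      using Z b by (auto intro!: homog_minus homog_one homog_mult_True_True)
    show "invertible_mat (1\<^sub>m s - Z * b)"
      using invertible_elem_sdet_one_minus_odd[OF Z b] Z b h
      by (subst invertible_elem_sdet_iff[symmetric, of _ s]) (auto intro: homog_central)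
  qed
  ultimately show ?thesis
    using d Z b by (auto intro!: invertible_mat_mult[of _ s])
qed

lemma GL_blocks_mult:
  assumes g: "GL_blocks r s ga gb gc gd" and w: "GL_blocks r s a b c d"
  shows "GL_blocks r s (ga * a + gb * c) (ga * b + gb * d) (gc * a + gd * c) (gc * b + gd * d)"
proof -
  \<comment> \<open>The lower right block of the product is gd * d, which is invertible, plus a
    product of odd matrices. The statement is kept general in order to be applied to the
    parity-exchanged blocks for the upper left block.\<close>
  have *: "invertible_mat (gc * b + gd * d)" if g: "GL_blocks r s ga gb gc gd" and w: "GL_blocks r s a b c d"
    for r s ga gb gc gd a b c d
  proof -
    have "invertible_mat (gd * d + gc * b)"
      using g w unfolding GL_blocks_def
      by (intro invertible_mat_plus_odd[of _ s _ r] invertible_mat_mult[of _ s] homog_mult_False_False) auto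
    also have "gd * d + gc * b = gc * b + gd * d"
      using g w by (intro comm_add_mat[of _ s s]) (auto simp: GL_blocks_def)
    finally show ?thesis .
  qed
  have c: "ga * a + gb * c = gb * c + ga * a"
    using g w by (intro comm_add_mat[of _ r r]) (auto simp: GL_blocks_def)
  have "invertible_mat (ga * a + gb * c)"
    unfolding c using *[OF GL_blocks_swap[OF g] GL_blocks_swap[OF w]] .
  moreover have "invertible_mat (gc * b + gd * d)"
    using *[OF g w] .
  ultimately show ?thesis
    using g w unfolding GL_blocks_def
    by (auto intro!: homog_add intro: homog_mult_False_False homog_mult_False_True homog_mult_True_False homog_mult_True_True)
qed

text \<open>Adding Y times the lower rows replaces X = b d^-1 by X + Y, and the Schur complement
  stays the same.\<close>

lemma Ber_blocks_upper:
  fixes a b c d Y :: "'a mat"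
  assumes w: "a \<in> carrier_mat r r" "b \<in> carrier_mat r s" "c \<in> carrier_mat s r" "d \<in> carrier_mat s s" "invertible_mat d"
    and Y: "Y \<in> carrier_mat r s"
  shows "Ber_blocks (a + Y * c) (b + Y * d) c d = Ber_blocks a b c d"
proof -
  note id = inv_matrix[OF w(4,5)]
  define X where "X = b * inv_matrix d"
  have X: "X \<in> carrier_mat r s" "X * d = b"
    unfolding X_def using w id by (auto simp: mat_ring)
  have "Ber_blocks (a + Y * c) (b + Y * d) c d = sdet (a + Y * c - (X + Y) * c) * inv_elem (sdet d)"
    using X Y w by (intro Ber_blocks_eqI[of _ s _ r]) (auto simp: mat_ring)
  also have "a + Y * c - (X + Y) * c = a - X * c"
    using X Y w by (intro eq_matI) (auto simp: mat_ring simp del: index_mult_mat(1))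
  finally show ?thesis
    using Ber_blocks_eqI[OF w(4,5) X] by simp
qed

text \<open>Here d itself changes, so invariance cannot be read off from the formula. After
  exchanging parities the operation is the one of \<open>Ber_blocks_upper\<close>, and
  \<open>Ber_blocks_inverse\<close> transfers the result back.\<close>

lemma Ber_blocks_lower:
  assumes w: "GL_blocks r s a b c d" and Y: "Y \<in> carrier_mat s r" "homog True Y"
  shows "GL_blocks r s a b (c + Y * a) (d + Y * b)"
    and "Ber_blocks a b (c + Y * a) (d + Y * b) = Ber_blocks a b c d"
proof -
  show g: "GL_blocks r s a b (c + Y * a) (d + Y * b)"
    using w Y unfolding GL_blocks_def
    by (auto intro!: homog_add invertible_mat_plus_odd intro: homog_mult_True_False homog_mult_True_True)
  have "Ber_blocks (d + Y * b) (c + Y * a) b a = Ber_blocks d c b a"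
    using w Y unfolding GL_blocks_def by (intro Ber_blocks_upper) auto
  then have "Ber_blocks a b (c + Y * a) (d + Y * b) * Ber_blocks d c b a = Ber_blocks a b c d * Ber_blocks d c b a"
    using Ber_blocks_inverse[OF g] Ber_blocks_inverse[OF w] by simp
  then show "Ber_blocks a b (c + Y * a) (d + Y * b) = Ber_blocks a b c d"
    using invertible_elem_right_cancel[OF invertible_Ber_blocks[OF GL_blocks_swap[OF w]]] by blast
qed

text \<open>The new X is k X l^-1 and the new Schur complement is k (a - X c). Centrality of det l
  allows its inverse to be moved to the front.\<close>

lemma Ber_blocks_diag:
  assumes w: "GL_blocks r s a b c d" and k: "k \<in> carrier_mat r r" "homog False k"
    and l: "l \<in> carrier_mat s s" "homog False l" "invertible_mat l"
  shows "Ber_blocks (k * a) (k * b) (l * c) (l * d) = sdet k * inv_elem (sdet l) * Ber_blocks a b c d"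
proof -
  note w' = GL_blocks_D[OF w]
  note il = inv_matrix[OF l(1,3)]
  obtain X where X: "X \<in> carrier_mat r s" "homog True X" "X * d = b"
    "Ber_blocks a b c d = sdet (a - X * c) * inv_elem (sdet d)"
    "a - X * c \<in> carrier_mat r r" "homog False (a - X * c)"
    by (rule Schur_complement[OF w])
  have dl: "invertible_elem (sdet l)" "central (sdet l)" and dd: "invertible_elem (sdet d)" "central (sdet d)"
    using l w' by (auto simp: invertible_elem_sdet_iff[of _ s] homog_central intro: central_sdet)
  have ild: "inv_matrix l * (l * d) = d" and ilc: "inv_matrix l * (l * c) = c"
    using l il w' by (simp_all add: mat_assoc[symmetric] mat_one_mult)
  have "Ber_blocks (k * a) (k * b) (l * c) (l * d) =
    sdet (k * a - (k * X * inv_matrix l) * (l * c)) * inv_elem (sdet (l * d))"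
    using X k l il w' by (intro Ber_blocks_eqI[of _ s _ r] invertible_mat_mult[of _ s] carrier_matI) (auto simp: mat_ring ild)
  also have "k * a - (k * X * inv_matrix l) * (l * c) = k * (a - X * c)"
    using X(1,2) k l il w' by (simp add: mat_ring ilc)
  also have "sdet (k * (a - X * c)) = sdet k * sdet (a - X * c)"
    using X k by (intro sdet_mult[of _ r] homog_central)
  also have "sdet (l * d) = sdet l * sdet d"
    using l w' by (intro sdet_mult[of _ s] homog_central)
  also have "inv_elem (sdet l * sdet d) = inv_elem (sdet l) * inv_elem (sdet d)"
    using dl dd by (simp add: inv_elem_mult centralD[OF central_inv_elem[OF dl(2,1)]])
  also have "sdet k * sdet (a - X * c) * (inv_elem (sdet l) * inv_elem (sdet d)) =
    sdet k * (sdet (a - X * c) * inv_elem (sdet l)) * inv_elem (sdet d)"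
    by (simp only: mult.assoc)
  also have "sdet (a - X * c) * inv_elem (sdet l) = inv_elem (sdet l) * sdet (a - X * c)"
    by (rule centralD[OF central_inv_elem[OF dl(2,1)], symmetric])
  finally show ?thesis
    unfolding X(4) by (simp only: mult.assoc)
qed

text \<open>Uses the factorisation g = (1 Z; 0 1) (S 0; 0 gd) (1 0; Y 1) with Z = gb gd^-1, Y =
  gd^-1 gc and S = ga - Z gc. The three factors are applied from right to left by the preceding
  lemmas.\<close>

lemma Ber_blocks_mult:
  assumes g: "GL_blocks r s ga gb gc gd" and w: "GL_blocks r s a b c d"
  shows "Ber_blocks (ga * a + gb * c) (ga * b + gb * d) (gc * a + gd * c) (gc * b + gd * d) =
    Ber_blocks ga gb gc gd * Ber_blocks a b c d"
proof -
  note g' = GL_blocks_D[OF g]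
  note w' = GL_blocks_D[OF w]
  note id = inv_matrix[OF g'(4,10)] homog_inv_matrix[OF g'(4,8,10)]
  obtain Z where Z: "Z \<in> carrier_mat r s" "homog True Z" "Z * gd = gb"
    "Ber_blocks ga gb gc gd = sdet (ga - Z * gc) * inv_elem (sdet gd)"
    "ga - Z * gc \<in> carrier_mat r r" "homog False (ga - Z * gc)" "invertible_mat (ga - Z * gc)"
    by (rule Schur_complement[OF g])
  define S where "S = ga - Z * gc"
  define Y where "Y = inv_matrix gd * gc"
  have Y: "Y \<in> carrier_mat s r" "homog True Y" and dY: "gd * Y = gc"
    unfolding Y_def using id g' by (auto intro: homog_mult_False_True simp: mat_assoc[symmetric] mat_one_mult)
  define c' where "c' = c + Y * a"
  define d' where "d' = d + Y * b"
  note low = Ber_blocks_lower[OF w Y, folded c'_def d'_def]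
  have cd': "c' \<in> carrier_mat s r" "d' \<in> carrier_mat s s" "homog False d'" "invertible_mat d'"
    using low(1) by (auto simp: GL_blocks_def)
  have e: "gd * c' = gc * a + gd * c" "gd * d' = gc * b + gd * d"
    unfolding c'_def d'_def using g' w' Y
    by (auto simp: mat_ring mat_assoc[of gd Y, symmetric] dY intro!: comm_add_mat)
  have "S * x + Z * (gc * x + gd * y) = ga * x + gb * y"
    if "x \<in> carrier_mat r k" "y \<in> carrier_mat s k" for x y k
    unfolding S_def using that g' Z(1,2)
    by (intro eq_matI) (auto simp: mat_ring mat_assoc[of Z gd, symmetric] Z(3) simp del: index_mult_mat(1))
  note e' = this[OF w'(1,3)] this[OF w'(2,4)]
  have "Ber_blocks (ga * a + gb * c) (ga * b + gb * d) (gc * a + gd * c) (gc * b + gd * d) =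
    Ber_blocks (S * a + Z * (gd * c')) (S * b + Z * (gd * d')) (gd * c') (gd * d')"
    by (simp only: e e')
  also have "\<dots> = Ber_blocks (S * a) (S * b) (gd * c') (gd * d')"
    using Z g' w' cd' by (intro Ber_blocks_upper invertible_mat_mult[of _ s]) (auto simp: S_def)
  also have "\<dots> = sdet S * inv_elem (sdet gd) * Ber_blocks a b c' d'"
    using Z g' by (intro Ber_blocks_diag[OF low(1)]) (auto simp: S_def)
  finally show ?thesis
    by (simp add: low(2) Z(4) S_def)
qed

text \<open>Right multiplication by (E0 0; E1 1). The terms with E1 cancel in the Schur complement
  because X d = b, which leaves (a - X c) E0; its left factor is central, as
  \<open>sdet_mult\<close> requires.\<close>

lemma Ber_blocks_frame:
  assumes w: "GL_blocks r s a b c d" and E: "E0 \<in> carrier_mat r r" "E1 \<in> carrier_mat s r"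
  shows "Ber_blocks (a * E0 + b * E1) b (c * E0 + d * E1) d = Ber_blocks a b c d * sdet E0"
proof -
  note w' = GL_blocks_D[OF w]
  obtain X where X: "X \<in> carrier_mat r s" "X * d = b"
    "Ber_blocks a b c d = sdet (a - X * c) * inv_elem (sdet d)"
    "a - X * c \<in> carrier_mat r r" "homog False (a - X * c)"
    by (rule Schur_complement[OF w])
  have dd: "invertible_elem (sdet d)" "central (sdet d)"
    using w' by (auto simp: invertible_elem_sdet_iff[of _ s] homog_central intro: central_sdet)
  have "a * E0 + b * E1 - X * (c * E0 + d * E1) = (a - X * c) * E0"
    using w' X(1) E by (intro eq_matI) (auto simp: mat_ring mat_assoc[of X d, symmetric] X(2) simp del: index_mult_mat(1))
  then have "Ber_blocks (a * E0 + b * E1) b (c * E0 + d * E1) d = sdet ((a - X * c) * E0) * inv_elem (sdet d)"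
    using Ber_blocks_eqI[OF w'(4,10) X(1,2)] by simp
  also have "sdet ((a - X * c) * E0) = sdet (a - X * c) * sdet E0"
    using X E by (intro sdet_mult[of _ r] homog_central)
  also have "\<dots> * inv_elem (sdet d) = sdet (a - X * c) * (sdet E0 * inv_elem (sdet d))"
    by (simp only: mult.assoc)
  also have "sdet E0 * inv_elem (sdet d) = inv_elem (sdet d) * sdet E0"
    by (rule centralD[OF central_inv_elem[OF dd(2,1)], symmetric])
  finally show ?thesis
    unfolding X(3) by (simp only: mult.assoc)
qed

text \<open>Block elimination: the Schur complement determines E0, and then d determines E1. The
  unknowns are obtained by left multiplication alone, so x and y may have arbitrary entries.\<close>

lemma GL_blocks_solve:
  assumes w: "GL_blocks r s a b c d" and xy: "x \<in> carrier_mat r k" "y \<in> carrier_mat s k"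
  obtains E0 E1 where "E0 \<in> carrier_mat r k" "E1 \<in> carrier_mat s k" "a * E0 + b * E1 = x" "c * E0 + d * E1 = y"
proof -
  note w' = GL_blocks_D[OF w]
  obtain X where X: "X \<in> carrier_mat r s" "homog True X" "X * d = b"
    "Ber_blocks a b c d = sdet (a - X * c) * inv_elem (sdet d)"
    "a - X * c \<in> carrier_mat r r" "homog False (a - X * c)" "invertible_mat (a - X * c)"
    by (rule Schur_complement[OF w])
  define S where "S = a - X * c"
  define T where "T = inv_matrix S"
  define e where "e = inv_matrix d"
  note S = X(5,7)[folded S_def]
  note T = inv_matrix[OF S, folded T_def] and e = inv_matrix[OF w'(4,10), folded e_def]
  define E0 where "E0 = T * (x - X * y)"
  define E1 where "E1 = e * (y - c * E0)"
  have E: "E0 \<in> carrier_mat r k" "E1 \<in> carrier_mat s k"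
    unfolding E0_def E1_def using T(1) e(1) X(1) w'(3) xy by (auto intro!: carrier_matI)
  have SE: "S * E0 = x - X * y"
    unfolding E0_def using S(1) T(1) xy X(1)
    by (simp add: mat_assoc[of S T, symmetric] T(2) mat_one_mult)
  have dE: "d * E1 = y - c * E0"
    unfolding E1_def using e(1) w'(3,4) xy E(1)
    by (simp add: mat_assoc[of d e, symmetric] e(2) mat_one_mult)
  have "c * E0 + d * E1 = y"
    unfolding dE using w' xy E by (intro eq_matI) (auto simp del: index_mult_mat(1))
  moreover have "a * E0 + b * E1 = S * E0 + X * (c * E0 + d * E1)"
    unfolding S_def using w' X(1) E by (intro eq_matI) (auto simp: mat_ring mat_assoc[of X d, symmetric] X(3) simp del: index_mult_mat(1))
  then have "a * E0 + b * E1 = x"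
    unfolding SE \<open>c * E0 + d * E1 = y\<close> using X xy by (intro eq_matI) (auto simp del: index_mult_mat(1))
  ultimately show ?thesis
    using E that by blast
qed

text \<open>
  The columns of \<open>x\<close> and \<open>y\<close> need not be homogeneous or independent, which covers wrong-parity and repeated columns.
\<close>

lemma Ber_blocks_mult_left:
  assumes g: "GL_blocks r s ga gb gc gd" and w: "GL_blocks r s a b c d"
    and xy: "x \<in> carrier_mat r r" "y \<in> carrier_mat s r"
  shows "Ber_blocks (ga * x + gb * y) (ga * b + gb * d) (gc * x + gd * y) (gc * b + gd * d) =
    Ber_blocks ga gb gc gd * Ber_blocks x b y d"
proof -
  obtain E0 E1 where E: "E0 \<in> carrier_mat r r" "E1 \<in> carrier_mat s r" "a * E0 + b * E1 = x" "c * E0 + d * E1 = y"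
    by (rule GL_blocks_solve[OF w xy])
  note g' = GL_blocks_D[OF g]
  note w' = GL_blocks_D[OF w]
  have e1: "ga * x + gb * y = (ga * a + gb * c) * E0 + (ga * b + gb * d) * E1"
    and e2: "gc * x + gd * y = (gc * a + gd * c) * E0 + (gc * b + gd * d) * E1"
    unfolding E(3,4)[symmetric] using g' w' E(1,2)
    by (intro eq_matI; auto simp: mat_ring simp del: index_mult_mat(1))+
  have "Ber_blocks (ga * x + gb * y) (ga * b + gb * d) (gc * x + gd * y) (gc * b + gd * d) =
    Ber_blocks ga gb gc gd * Ber_blocks a b c d * sdet E0"
    unfolding e1 e2 Ber_blocks_frame[OF GL_blocks_mult[OF g w] E(1,2)] Ber_blocks_mult[OF g w] ..
  also have "\<dots> = Ber_blocks ga gb gc gd * Ber_blocks x b y d"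
    using Ber_blocks_frame[OF w E(1,2)] unfolding E(3,4) by (simp add: mult.assoc)
  finally show ?thesis .
qed

text \<open>From ga ha = 1 - gb hc with gb and hc odd, the determinant of ga ha is a unit, hence so
  is its central factor det ga. The block gd is treated alike after exchanging parities.\<close>

lemma GL_blocks_of_right_inverse:
  assumes g: "ga \<in> carrier_mat r r" "gb \<in> carrier_mat r s" "gc \<in> carrier_mat s r" "gd \<in> carrier_mat s s"
      "homog False ga" "homog True gb" "homog True gc" "homog False gd"
    and h: "ha \<in> carrier_mat r r" "hb \<in> carrier_mat r s" "hc \<in> carrier_mat s r" "he \<in> carrier_mat s s"
      "homog False ha" "homog True hb" "homog True hc" "homog False he"
    and gh: "ga * ha + gb * hc = 1\<^sub>m r" "gc * hb + gd * he = 1\<^sub>m s"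
  shows "GL_blocks r s ga gb gc gd"
proof -
  have *: "invertible_mat ga"
    if g: "ga \<in> carrier_mat r r" "gb \<in> carrier_mat r s" "homog False ga" "homog True gb"
      and h: "ha \<in> carrier_mat r r" "hc \<in> carrier_mat s r" "homog False ha" "homog True hc"
      and gh: "ga * ha + gb * hc = 1\<^sub>m r" for r s ga gb ha hc
  proof -
    have "ga * ha = 1\<^sub>m r - gb * hc"
      unfolding gh[symmetric] using g h by (intro eq_matI) (auto simp del: index_mult_mat(1))
    then have "invertible_elem (sdet (ga * ha))"
      using invertible_elem_sdet_one_minus_odd[of gb r s hc] g h by simp
    then have "invertible_elem (sdet ga * sdet ha)"
      using g h by (simp add: sdet_mult[of _ r] homog_central)
    then have "invertible_elem (sdet ga)"
      using central_sdet[OF g(1) homog_central[OF g(3)]] by (rule invertible_elem_factor[rotated])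
    then show ?thesis
      using g by (simp add: invertible_elem_sdet_iff[of _ r] homog_central)
  qed
  have "gd * he + gc * hb = 1\<^sub>m s"
    unfolding gh(2)[symmetric] using g h by (intro comm_add_mat[of _ s s]) auto
  then show ?thesis
    unfolding GL_blocks_def using g h *[of ga r gb s ha hc] *[of gd s gc r he hb] gh by auto
qed

lemma GL_blocks_inverse:
  assumes w: "GL_blocks r s a b c d"
  obtains a' b' c' d' where "GL_blocks r s a' b' c' d'"
    "a * a' + b * c' = 1\<^sub>m r" "a * b' + b * d' = 0\<^sub>m r s" "c * a' + d * c' = 0\<^sub>m s r" "c * b' + d * d' = 1\<^sub>m s"
    "a' * a + b' * c = 1\<^sub>m r" "a' * b + b' * d = 0\<^sub>m r s" "c' * a + d' * c = 0\<^sub>m s r" "c' * b + d' * d = 1\<^sub>m s"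
proof -
  note w' = GL_blocks_D[OF w]
  obtain X where X: "X \<in> carrier_mat r s" "homog True X" "X * d = b"
    "Ber_blocks a b c d = sdet (a - X * c) * inv_elem (sdet d)"
    "a - X * c \<in> carrier_mat r r" "homog False (a - X * c)" "invertible_mat (a - X * c)"
    by (rule Schur_complement[OF w])
  define S where "S = a - X * c"
  note S = X(5-7)[folded S_def]
  define T where "T = inv_matrix S"
  define e where "e = inv_matrix d"
  note T = inv_matrix[OF S(1,3), folded T_def] homog_inv_matrix[OF S, folded T_def]
  note e = inv_matrix[OF w'(4,10), folded e_def] homog_inv_matrix[OF w'(4,8,10), folded e_def]
  have aS: "a = S + X * c"
    unfolding S_def using w' X by (intro eq_matI) (auto simp del: index_mult_mat(1))
  \<comment> \<open>The classical block inverse, with T the inverse of the Schur complement, e =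
    d^-1 and X = b e.\<close>
  define a' b' c' d' where "a' = T" and "b' = - (T * X)" and "c' = - (e * (c * T))" and "d' = e + e * (c * (T * X))"
  note h_def = a'_def b'_def c'_def d'_def
  have h: "a' \<in> carrier_mat r r" "b' \<in> carrier_mat r s" "c' \<in> carrier_mat s r" "d' \<in> carrier_mat s s"
    unfolding h_def using T(1) e(1) X(1) w'(3) by (auto intro!: carrier_matI)
  have h': "homog False a'" "homog True b'" "homog True c'" "homog False d'"
  proof -
    have TX: "homog True (T * X)"
      using T(1) X(1) by (auto intro: homog_mult_False_True[OF T(4) X(2)])
    have cTX: "homog False (c * (T * X))"
      using w'(3) T(1) by (auto intro: homog_mult_True_True[OF w'(7) TX])
    have ecTX: "homog False (e * (c * (T * X)))"
      using e(1) w'(3) by (auto intro: homog_mult_False_False[OF e(4) cTX])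
    show "homog False d'"
      unfolding d'_def using e(1) w'(3) X(1) by (auto intro: homog_add[OF e(4) ecTX])
    have cT: "homog True (c * T)"
      using w'(3) T(1) by (auto intro: homog_mult_True_False[OF w'(7) T(4)])
    have "homog True (e * (c * T))"
      using e(1) w'(3) by (auto intro: homog_mult_False_True[OF e(4) cT])
    then show "homog True c'"
      unfolding c'_def by (rule homog_uminus)
    show "homog False a'" "homog True b'"
      unfolding a'_def b'_def by (rule T(4) homog_uminus[OF TX])+
  qed
  have de: "d * (e * x) = x" if "x \<in> carrier_mat s k" for x k
    using that e(1) w'(4) by (simp add: mat_assoc[of d e, symmetric] e(2) mat_one_mult)
  have ST: "S * (T * x) = x" if "x \<in> carrier_mat r k" for x k
    using that S(1) T(1) by (simp add: mat_assoc[of S T, symmetric] T(2) mat_one_mult)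
  have be: "b * (e * x) = X * x" if "x \<in> carrier_mat s k" for x k
    unfolding X(3)[symmetric] using that de[OF that] e(1) w'(4) X(1) by (simp add: mat_assoc)
  have be': "b * e = X"
    using be[of "1\<^sub>m s" s] e(1) X(1) by (simp add: mat_mult_one)
  have cT: "c * T \<in> carrier_mat s r" "c * (T * X) \<in> carrier_mat s s"
    using w'(3) T(1) X(1) by (auto intro!: carrier_matI)
  note dims = carrier_matD[OF T(1)] carrier_matD[OF e(1)] carrier_matD[OF X(1)] carrier_matD[OF S(1)] 
    carrier_matD[OF w'(2)] carrier_matD[OF w'(3)] carrier_matD[OF w'(4)]
  have 1: "a * a' + b * c' = 1\<^sub>m r"
    unfolding aS h_def
    by (intro eq_matI) (auto simp: dims mat_ring be[OF cT(1)] T(2) simp del: index_mult_mat(1))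
  have 2: "a * b' + b * d' = 0\<^sub>m r s"
    unfolding aS h_def
    by (intro eq_matI) (auto simp: dims mat_ring be[OF cT(2)] be' ST[OF X(1)] simp del: index_mult_mat(1))
  have 3: "c * a' + d * c' = 0\<^sub>m s r"
    unfolding h_def
    by (intro eq_matI) (auto simp: dims mat_ring de[OF cT(1)] simp del: index_mult_mat(1))
  have 4: "c * b' + d * d' = 1\<^sub>m s"
    unfolding h_def
    by (intro eq_matI) (auto simp: dims mat_ring de[OF cT(2)] e(2) simp del: index_mult_mat(1))
  have 5: "a' * a + b' * c = 1\<^sub>m r"
    unfolding aS h_def
    by (intro eq_matI) (auto simp: dims mat_ring T(3) simp del: index_mult_mat(1))
  have 6: "a' * b + b' * d = 0\<^sub>m r s"
    unfolding h_def
    by (intro eq_matI) (auto simp: dims mat_ring X(3) simp del: index_mult_mat(1))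
  have 7: "c' * a + d' * c = 0\<^sub>m s r"
    unfolding aS h_def
    by (intro eq_matI) (auto simp: dims mat_ring T(3) simp del: index_mult_mat(1))
  have 8: "c' * b + d' * d = 1\<^sub>m s"
    unfolding h_def
    by (intro eq_matI) (auto simp: dims mat_ring X(3) e(3) simp del: index_mult_mat(1))
  \<comment> \<open>The given matrix is a right inverse of the new one, so the diagonal blocks of
    the latter are invertible.\<close>
  have "GL_blocks r s a' b' c' d'"
    using GL_blocks_of_right_inverse[OF h h' w'(1-8) 5 8] .
  then show ?thesis
    using 1 2 3 4 5 6 7 8 by (rule that)
qed

end

section \<open>Antisymmetry of Berezinians\<close>

text \<open>Entries are given by a function of row and column label, so that columns reduced by a
  Schur complement (\<open>N\<close> in the proof of \<open>Ber_blocks_colm_antisym\<close>) have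
  the same format as columns of a given matrix.\<close>

definition colm :: "nat \<Rightarrow> (nat \<Rightarrow> nat \<Rightarrow> 'a) \<Rightarrow> nat list \<Rightarrow> 'a mat" where
  "colm k T ds = mat k (length ds) (\<lambda>(i, j). T i (ds ! j))"

lemma colm_carrier [simp]: "length ds = l \<Longrightarrow> colm k T ds \<in> carrier_mat k l"
  by (simp add: colm_def)

lemma dim_colm [simp]: "dim_row (colm k T ds) = k" "dim_col (colm k T ds) = length ds"
  by (simp_all add: colm_def)

lemma index_colm [simp]: "i < k \<Longrightarrow> j < length ds \<Longrightarrow> colm k T ds $$ (i, j) = T i (ds ! j)"
  by (simp add: colm_def)

lemma central_inversion_sign: "central (inversion_sign ds)"
  unfolding inversion_sign_altdef by (cases "even (card (inversions ds))") (simp_all add: central_minus)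

lemma inversion_sign_square [simp]: "inversion_sign ds * inversion_sign ds = (1 :: 'a::ring_1)"
  unfolding inversion_sign_altdef by (cases "even (card (inversions ds))") simp_all

text \<open>\<open>\<pi>\<close> marks labels whose columns need not be central. As at most one
  position is marked, of two neighbouring columns at least one is central, and the exchange lemmas
  apply.\<close>

lemma sdet_colm:
  fixes N :: "nat \<Rightarrow> nat \<Rightarrow> 'a::ring_1"
  assumes len: "length ds = r"
    and cen: "\<And>i d. i < r \<Longrightarrow> d \<in> set ds \<Longrightarrow> \<not> \<pi> d \<Longrightarrow> central (N i d)"
    and one: "length (filter \<pi> ds) \<le> 1"
  shows "sdet (colm r N ds) = (if distinct ds then inversion_sign ds * sdet (colm r N (sort ds)) else 0)"
proof -
  have aux: "length (xs @ x # y # ys) = r" "length (filter \<pi> (xs @ x # y # ys)) \<le> 1"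
    "set (xs @ x # y # ys) = set ds"
    if "mset (xs @ x # y # ys) = mset ds" for xs x y ys
  proof -
    show "length (xs @ x # y # ys) = r"
      using that len by (metis size_mset)
    show "set (xs @ x # y # ys) = set ds"
      using that by (metis set_mset_mset)
    have "mset (filter \<pi> (xs @ x # y # ys)) = mset (filter \<pi> ds)"
      using that by (simp only: mset_filter)
    then show "length (filter \<pi> (xs @ x # y # ys)) \<le> 1"
      using one by (metis size_mset)
  qed
  have comm: "N i x * N i' y = N i' y * N i x"
    if "mset (xs @ x # y # ys) = mset ds" "i < r" "i' < r" for xs x y ys i i'
  proof -
    have "x \<in> set ds" "y \<in> set ds"
      using aux(3)[OF that(1)] by auto
    moreover have "\<not> \<pi> x \<or> \<not> \<pi> y"
      using aux(2)[OF that(1)] by auto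
    ultimately show ?thesis
      using cen that by (metis centralD)
  qed
  show ?thesis
  proof (rule alternating_sort[where F = "\<lambda>ds. sdet (colm r N ds)"])
    fix xs x y ys assume ms: "mset (xs @ x # y # ys) = mset ds" and "y < x"
    let ?M = "colm r N (xs @ x # y # ys)"
    have "swap_adjacent (length xs) ?M = colm r N (xs @ y # x # ys)"
      by (rule eq_matI) (auto simp: swap_adjacent_def Transposition.transpose_def nth_append nth_Cons split: nat.splits)
    moreover have "sdet (swap_adjacent (length xs) ?M) = - sdet ?M"
      using aux(1)[OF ms] comm[OF ms] by (intro sdet_swap_adjacent[of _ r]) (auto simp: nth_append)
    ultimately show "sdet (colm r N (xs @ y # x # ys)) = - sdet ?M"
      by simp
  next
    fix xs x ys assume ms: "mset (xs @ x # x # ys) = mset ds"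
    show "sdet (colm r N (xs @ x # x # ys)) = 0"
      using aux(1)[OF ms] comm[OF ms] by (intro sdet_equal_adjacent[of _ r "length xs"]) (auto simp: nth_append)
  qed
qed

lemma sdet_zero_column:
  assumes "M \<in> carrier_mat n n" "k < n" "\<And>i. i < n \<Longrightarrow> M $$ (i, k) = 0"
  shows "sdet M = 0"
proof -
  have "prod_list (map (\<lambda>j. M $$ (p j, j)) [0..<n]) = 0" if "p permutes {..<n}" for p
  proof (rule prod_list_zero)
    have "M $$ (p k, k) = 0"
      using permutes_in_image[OF that, of k] assms by simp
    then show "0 \<in> set (map (\<lambda>j. M $$ (p j, j)) [0..<n])"
      using assms(2) by (auto simp: image_iff intro!: bexI[of _ k])
  qed
  then show ?thesis
    using assms(1) by (simp add: sdet_def)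
qed

context superalgebra
begin

text \<open>\<open>\<pi>\<close> marks the labels that belong to the second group of positions: the
  odd labels for \<open>Ber\<close>, the even ones for \<open>Ber_star\<close>. Every column d
  reduces to a Schur column N d depending on d alone, so dependence on \<open>ds\<close> is that of
  a determinant, while the order of \<open>es\<close> matters only through the sign of the
  denominator.\<close>

lemma
  fixes T B :: "nat \<Rightarrow> nat \<Rightarrow> 'a"
  assumes T: "\<And>i d. i < r \<Longrightarrow> d \<in> set ds \<union> set es \<Longrightarrow> T i d \<in> A (\<pi> d)"
    and B: "\<And>i d. i < s \<Longrightarrow> d \<in> set ds \<union> set es \<Longrightarrow> B i d \<in> A (\<not> \<pi> d)"
    and es: "length es = s" "distinct es" "\<And>e. e \<in> set es \<Longrightarrow> \<pi> e"
    and inv: "invertible_mat (colm s B es)"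
    and ds: "length ds = r" "length (filter \<pi> ds) \<le> 1"
  shows Ber_blocks_colm_antisym:
    "Ber_blocks (colm r T ds) (colm r T es) (colm s B ds) (colm s B es) =
      antisym (\<lambda>ds es. Ber_blocks (colm r T ds) (colm r T es) (colm s B ds) (colm s B es)) ds es"
    and Ber_blocks_colm_parity:
    "Ber_blocks (colm r T ds) (colm r T es) (colm s B ds) (colm s B es) \<in> A (\<exists>d\<in>set ds. \<pi> d)"
proof -
  have Be: "B i e \<in> A False" if "i < s" "e \<in> set es" for i e
    using B[of i e] es(3)[of e] that by simp
  have Te: "T i e \<in> A True" if "i < r" "e \<in> set es" for i e
    using T[of i e] es(3)[of e] that by simp
  let ?D = "colm s B es"
  have D: "?D \<in> carrier_mat s s" "homog False ?D"
    using Be es(1) by (auto simp: homog_def)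
  note iD = inv_matrix[OF D(1) inv] homog_inv_matrix[OF D inv]
  define X where "X = colm r T es * inv_matrix ?D"
  have X: "X \<in> carrier_mat r s" "X * ?D = colm r T es"
    unfolding X_def using iD es(1) by (auto simp: mat_ring intro!: carrier_matI)
  have Xo: "homog True X"
    unfolding X_def using Te es(1) iD(1) by (intro homog_mult_True_False iD) (auto simp: homog_def)
  have Xi: "(\<Sum>k<s. X $$ (i, k) * B k (es ! j)) = T i (es ! j)" if "i < r" "j < s" for i j
  proof -
    have "T i (es ! j) = (X * ?D) $$ (i, j)"
      using that es X by simp
    also have "\<dots> = (\<Sum>k<s. X $$ (i, k) * B k (es ! j))"
      using that es X(1) by (simp add: scalar_prod_def lessThan_atLeast0)
    finally show ?thesis ..
  qed
  \<comment> \<open>Column d of the Schur complement. It vanishes for d in \<open>es\<close>, which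
    accounts for the value 0 when a label occurs on both sides of the bar.\<close>
  define N where "N i d = T i d - (\<Sum>k<s. X $$ (i, k) * B k d)" for i d
  have N_colm: "colm r T ds' - X * colm s B ds' = colm r N ds'" for ds'
    using X(1) by (intro eq_matI) (auto simp: N_def scalar_prod_def lessThan_atLeast0)
  have N_par: "N i d \<in> A (\<pi> d)" if "i < r" "d \<in> set ds" for i d
  proof -
    have "X $$ (i, k) * B k d \<in> A (True \<noteq> (\<not> \<pi> d))" if "k < s" for k
      using Xo X B that \<open>i < r\<close> \<open>d \<in> set ds\<close> by (intro A_mult) (auto simp: homog_def)
    then show ?thesis
      unfolding N_def using T that by (intro A_minus A_sum) auto
  qed
  have N_zero: "N i d = 0" if "i < r" "d \<in> set es" for i d
    using that Xi es by (auto simp: N_def in_set_conv_nth)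
  \<comment> \<open>X * D = T holds column by column, so the same X serves for every rearrangement
    of \<open>es\<close>.\<close>
  have F: "Ber_blocks (colm r T ds') (colm r T es') (colm s B ds') (colm s B es') =
    sdet (colm r N ds') * inv_elem (sdet (colm s B es'))"
    if "mset es' = mset es" "invertible_mat (colm s B es')" for ds' es'
  proof -
    have se: "set es' = set es" "length es' = s"
      using that es by (metis set_mset_mset, metis size_mset)
    have "X * colm s B es' = colm r T es'"
    proof (rule eq_matI)
      fix i j assume "i < dim_row (colm r T es')" "j < dim_col (colm r T es')"
      then have ij: "i < r" "j < s"
        using se by auto
      then have "es' ! j \<in> set es"
        using se by (metis nth_mem)
      then obtain l where "l < s" "es ! l = es' ! j"
        using es by (auto simp: in_set_conv_nth)
      with Xi[OF ij(1) this(1)] show "(X * colm s B es') $$ (i, j) = colm r T es' $$ (i, j)"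
        using ij se X(1) by (simp add: scalar_prod_def lessThan_atLeast0)
    qed (use X se in auto)
    then show ?thesis
      using Ber_blocks_eqI[OF colm_carrier[OF se(2)] that(2) X(1)] by (simp add: N_colm)
  qed
  have Bc: "central (B i e)" if "i < s" "e \<in> set es" for i e
    using Be[OF that] by (rule even_central)
  let ?D' = "colm s B (sort es)"
  have "sdet ?D = inversion_sign es * sdet ?D'"
    using sdet_colm[of es s "\<lambda>_. False" B] Bc es by simp
  moreover have D': "?D' \<in> carrier_mat s s" "homog False ?D'"
  proof -
    show "?D' \<in> carrier_mat s s"
      using es by simp
    have "sort es ! j \<in> set es" if "j < s" for j
      using that es by (metis length_sort nth_mem set_sort)
    then show "homog False ?D'"
      using Be es(1) by (auto simp: homog_def)
  qed
  ultimately have sD': "sdet ?D' = inversion_sign es * sdet ?D"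
    by (simp add: mult.assoc[symmetric])
  have uD: "invertible_elem (sdet ?D)"
    using inv D by (simp add: invertible_elem_sdet_iff[of _ s] homog_central)
  have us: "is_inverse (inversion_sign es) (inversion_sign es :: 'a)"
    by (simp add: is_inverse_def)
  then have us': "invertible_elem (inversion_sign es :: 'a)"
    unfolding invertible_elem_def by blast
  have uD': "invertible_elem (sdet ?D')"
    unfolding sD' by (rule invertible_elem_mult[OF us' uD])
  then have iD': "invertible_mat ?D'"
    using D' by (simp add: invertible_elem_sdet_iff[of _ s] homog_central)
  have iv: "inv_elem (sdet ?D') = inv_elem (sdet ?D) * inversion_sign es"
    unfolding sD' inv_elem_mult[OF us' uD] inv_elem_eq[OF us] ..
  have FD: "Ber_blocks (colm r T ds) (colm r T es) (colm s B ds) ?D = sdet (colm r N ds) * inv_elem (sdet ?D)"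
    by (rule F[OF refl inv])
  show "Ber_blocks (colm r T ds) (colm r T es) (colm s B ds) ?D \<in> A (\<exists>d\<in>set ds. \<pi> d)"
  proof -
    \<comment> \<open>k is the position of the wrong-parity column, or r if there is none.\<close>
    obtain k where k: "\<And>j. j < r \<Longrightarrow> \<pi> (ds ! j) = (j = k)" "k < r \<longleftrightarrow> (\<exists>d\<in>set ds. \<pi> d)"
    proof (cases "\<exists>d\<in>set ds. \<pi> d")
      case False
      then have "\<pi> (ds ! j) = (j = r)" if "j < r" for j
        using that ds(1) by auto
      with False that[of r] show ?thesis
        by auto
    next
      case True
      then obtain k where k: "k < r" "\<pi> (ds ! k)"
        using ds(1) by (auto simp: in_set_conv_nth)
      have uniq: "j = k" if "j < r" "\<pi> (ds ! j)" for j
      proof (rule ccontr)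
        assume "j \<noteq> k"
        have "card {j, k} \<le> card {i. i < length ds \<and> \<pi> (ds ! i)}"
          using that k ds(1) by (intro card_mono) auto
        then show False
          using \<open>j \<noteq> k\<close> ds(2) by (simp add: length_filter_conv_card)
      qed
      show ?thesis
      proof (rule that)
        show "\<pi> (ds ! j) = (j = k)" if "j < r" for j
          using uniq[OF that] k(2) by blast
        show "k < r \<longleftrightarrow> (\<exists>d\<in>set ds. \<pi> d)"
          using k(1) True by (simp only:)
      qed
    qed
    have "sdet (colm r N ds) \<in> A (k < r)"
      using N_par ds(1) k(1) by (intro sdet_parity[of _ r]) (auto simp: k(1)[symmetric])
    then show ?thesis
      unfolding FD k(2) by (intro A_mult_even even_inv_elem even_sdet[OF D] uD)
  qed
  have Nd: "sdet (colm r N ds) = (if distinct ds then inversion_sign ds * sdet (colm r N (sort ds)) else 0)"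
  proof (rule sdet_colm[of ds r \<pi> N])
    fix i d assume "i < r" "d \<in> set ds" "\<not> \<pi> d"
    then show "central (N i d)"
      using N_par[of i d] even_central by simp
  qed (use ds in auto)
  show "Ber_blocks (colm r T ds) (colm r T es) (colm s B ds) ?D =
      antisym (\<lambda>ds es. Ber_blocks (colm r T ds) (colm r T es) (colm s B ds) (colm s B es)) ds es"
  proof (cases "distinct (ds @ es)")
    case True
    have "sdet (colm r N ds) * inv_elem (sdet ?D) =
      inversion_sign ds * (sdet (colm r N (sort ds)) * inv_elem (sdet ?D)) * (inversion_sign es * inversion_sign es)"
      using True by (simp add: Nd mult.assoc)
    also have "\<dots> = inversion_sign ds * ((sdet (colm r N (sort ds)) * inv_elem (sdet ?D) * inversion_sign es) * inversion_sign es)"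
      by (simp only: mult.assoc)
    also have "(sdet (colm r N (sort ds)) * inv_elem (sdet ?D) * inversion_sign es) * inversion_sign es =
      inversion_sign es * (sdet (colm r N (sort ds)) * inv_elem (sdet ?D) * inversion_sign es)"
      by (rule centralD[OF central_inversion_sign, symmetric])
    finally show ?thesis
      using True by (simp add: FD antisym_def F[OF _ iD'] iv mult.assoc)
  next
    case False
    have "sdet (colm r N ds) = 0"
    proof (cases "distinct ds")
      case True
      then obtain d where "d \<in> set ds" "d \<in> set es"
        using False es(2) by auto
      then obtain k where k: "k < r" "ds ! k \<in> set es"
        using ds(1) by (metis in_set_conv_nth)
      then show ?thesis
        using ds(1) N_zero by (intro sdet_zero_column[of _ r k]) auto
    qed (simp add: Nd)
    then show ?thesis
      unfolding FD antisym_def if_not_P[OF False] by simp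
  qed
qed

end

section \<open>Column submatrices\<close>

lemma submatrix_cols_carrier:
  "U \<in> carrier_mat k l \<Longrightarrow> length ds + length es = t \<Longrightarrow> submatrix_cols U ds es \<in> carrier_mat k t"
  by (auto simp: submatrix_cols_def)

context superalgebra
begin

context
  fixes r s :: nat
begin

abbreviation top_cols :: "'a mat \<Rightarrow> nat list \<Rightarrow> 'a mat" where
  "top_cols U \<equiv> colm r (\<lambda>i j. U $$ (i, j))"

abbreviation bot_cols :: "'a mat \<Rightarrow> nat list \<Rightarrow> 'a mat" where
  "bot_cols U \<equiv> colm s (\<lambda>i j. U $$ (r + i, j))"

abbreviation frame :: "'a mat \<Rightarrow> nat list \<Rightarrow> nat list \<Rightarrow> bool" where
  "frame U ds es \<equiv> GL_blocks r s (top_cols U ds) (top_cols U es) (bot_cols U ds) (bot_cols U es)"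

abbreviation ev :: "nat list" where "ev \<equiv> [0..<r]"
abbreviation od :: "nat list" where "od \<equiv> [r..<r + s]"

lemma split_submatrix_cols:
  assumes "dim_row U = r + s" "length ds = r" "length es = s"
  shows "split_block (submatrix_cols U ds es) r r =
    (top_cols U ds, top_cols U es, bot_cols U ds, bot_cols U es)"
  using assms by (auto simp: split_block_def Let_def submatrix_cols_def nth_append add.commute intro!: eq_matI)

lemma Ber_submatrix_cols:
  assumes "dim_row U = r + s" "length ds = r" "length es = s"
  shows "Ber r (submatrix_cols U ds es) =
      Ber_blocks (top_cols U ds) (top_cols U es) (bot_cols U ds) (bot_cols U es)"
    and "Ber_star r (submatrix_cols U ds es) =
      Ber_blocks (bot_cols U es) (bot_cols U ds) (top_cols U es) (top_cols U ds)"
    and "Ber_defined r (submatrix_cols U ds es) \<longleftrightarrow> invertible_mat (bot_cols U es)"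
    and "Ber_star_defined r (submatrix_cols U ds es) \<longleftrightarrow> invertible_mat (top_cols U ds)"
  by (simp_all add: Ber_def Ber_star_def Ber_defined_def Ber_star_defined_def split_submatrix_cols[OF assms])

lemma submatrix_cols_all: "g \<in> carrier_mat (r + s) (r + s) \<Longrightarrow> submatrix_cols g ev od = g"
  by (intro eq_matI) (auto simp: submatrix_cols_def nth_append)

lemma index_mult_split:
  fixes g U :: "'a mat"
  assumes "g \<in> carrier_mat (r + s) (r + s)" "U \<in> carrier_mat (r + s) N" "i < r + s" "j < N"
  shows "(g * U) $$ (i, j) = (\<Sum>k<r. g $$ (i, k) * U $$ (k, j)) + (\<Sum>k<s. g $$ (i, r + k) * U $$ (r + k, j))"
proof -
  have "(g * U) $$ (i, j) = (\<Sum>k<r + s. g $$ (i, k) * U $$ (k, j))"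
    using assms by (simp add: scalar_prod_def lessThan_atLeast0)
  also have "\<dots> = (\<Sum>k<r. g $$ (i, k) * U $$ (k, j)) + (\<Sum>k<s. g $$ (i, r + k) * U $$ (r + k, j))"
    by (induction s) (simp_all add: add.assoc)
  finally show ?thesis .
qed

lemma cols_mult:
  fixes g U :: "'a mat"
  assumes g: "g \<in> carrier_mat (r + s) (r + s)" and U: "U \<in> carrier_mat (r + s) N" and ds: "set ds \<subseteq> {..<N}"
  shows "top_cols (g * U) ds = top_cols g ev * top_cols U ds + top_cols g od * bot_cols U ds"
    and "bot_cols (g * U) ds = bot_cols g ev * top_cols U ds + bot_cols g od * bot_cols U ds"
proof -
  have d: "ds ! j < N" if "j < length ds" for j
    using that ds nth_mem by fastforce
  show "top_cols (g * U) ds = top_cols g ev * top_cols U ds + top_cols g od * bot_cols U ds"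
    by (intro eq_matI)
      (auto simp: index_mult_split[OF g U _ d] scalar_prod_def lessThan_atLeast0 simp del: index_mult_mat(1),
       auto simp: scalar_prod_def)
  show "bot_cols (g * U) ds = bot_cols g ev * top_cols U ds + bot_cols g od * bot_cols U ds"
    by (intro eq_matI)
      (auto simp: index_mult_split[OF g U _ d] scalar_prod_def lessThan_atLeast0 simp del: index_mult_mat(1),
       auto simp: scalar_prod_def)
qed

lemma eq_mat_blocks:
  fixes M N :: "'a mat"
  assumes M: "M \<in> carrier_mat (r + s) k" and N: "N \<in> carrier_mat (r + s) k"
    and "top_cols M [0..<k] = top_cols N [0..<k]" "bot_cols M [0..<k] = bot_cols N [0..<k]"
  shows "M = N"
proof (rule eq_matI)
  fix i j assume "i < dim_row N" "j < dim_col N"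
  then have ij: "i < r + s" "j < k"
    using N by auto
  show "M $$ (i, j) = N $$ (i, j)"
  proof (cases "i < r")
    case True
    then have "top_cols M [0..<k] $$ (i, j) = M $$ (i, j)" "top_cols N [0..<k] $$ (i, j) = N $$ (i, j)"
      using ij by simp_all
    then show ?thesis
      using assms(3) by simp
  next
    case False
    then have "i - r < s" "r + (i - r) = i"
      using ij by auto
    then have "bot_cols M [0..<k] $$ (i - r, j) = M $$ (i, j)" "bot_cols N [0..<k] $$ (i - r, j) = N $$ (i, j)"
      using ij by simp_all
    then show ?thesis
      using assms(4) by simp
  qed
qed (use M N in auto)

lemma homog_colm:
  "(\<And>i j. i < k \<Longrightarrow> j < length ds \<Longrightarrow> T i (ds ! j) \<in> A p) \<Longrightarrow> homog p (colm k T ds)"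
  by (simp add: homog_def)

lemma even_supermats_cols:
  assumes U: "U \<in> even_supermats A r s n m"
  shows "set ds \<subseteq> {..<n} \<Longrightarrow> homog False (top_cols U ds)"
    "set ds \<subseteq> {..<n} \<Longrightarrow> homog True (bot_cols U ds)"
    "set es \<subseteq> {n..<n + m} \<Longrightarrow> homog True (top_cols U es)"
    "set es \<subseteq> {n..<n + m} \<Longrightarrow> homog False (bot_cols U es)"
proof -
  have e: "U $$ (i, j) \<in> A ((i < r) \<noteq> (j < n))" if "i < r + s" "j < n + m" for i j
    using U that by (auto simp: even_supermats_def)
  have ds: "ds ! j < n" if "set ds \<subseteq> {..<n}" "j < length ds" for j
    using that nth_mem by fastforce
  have es: "\<not> es ! j < n" "es ! j < n + m" if "set es \<subseteq> {n..<n + m}" "j < length es" for j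
    using subsetD[OF that(1) nth_mem[OF that(2)]] by auto
  show "homog False (top_cols U ds)" if "set ds \<subseteq> {..<n}"
  proof (rule homog_colm)
    fix i j assume "i < r" "j < length ds"
    then show "U $$ (i, ds ! j) \<in> A False"
      using e[of "i" "ds ! j"] ds[OF that, of j] by simp
  qed
  show "homog True (bot_cols U ds)" if "set ds \<subseteq> {..<n}"
  proof (rule homog_colm)
    fix i j assume "i < s" "j < length ds"
    then show "U $$ (r + i, ds ! j) \<in> A True"
      using e[of "r + i" "ds ! j"] ds[OF that, of j] by simp
  qed
  show "homog True (top_cols U es)" if "set es \<subseteq> {n..<n + m}"
  proof (rule homog_colm)
    fix i j assume "i < r" "j < length es"
    then show "U $$ (i, es ! j) \<in> A True"
      using e[of "i" "es ! j"] es[OF that, of j] by simp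
  qed
  show "homog False (bot_cols U es)" if "set es \<subseteq> {n..<n + m}"
  proof (rule homog_colm)
    fix i j assume "i < s" "j < length es"
    then show "U $$ (r + i, es ! j) \<in> A False"
      using e[of "r + i" "es ! j"] es[OF that, of j] by simp
  qed
qed

lemma even_supermats_mult:
  assumes g: "g \<in> even_supermats A r s r s" and U: "U \<in> even_supermats A r s n m"
  shows "g * U \<in> even_supermats A r s n m"
proof -
  have gc: "g \<in> carrier_mat (r + s) (r + s)" and Uc: "U \<in> carrier_mat (r + s) (n + m)"
    using g U by (auto simp: even_supermats_def)
  have "(g * U) $$ (i, j) \<in> A ((i < r) \<noteq> (j < n))" if "i < r + s" "j < n + m" for i j
  proof -
    have "g $$ (i, k) * U $$ (k, j) \<in> A ((i < r) \<noteq> (j < n))" if "k < r + s" for k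
    proof -
      have "g $$ (i, k) * U $$ (k, j) \<in> A (((i < r) \<noteq> (k < r)) \<noteq> ((k < r) \<noteq> (j < n)))"
        using g U that \<open>i < r + s\<close> \<open>j < n + m\<close> by (intro A_mult) (auto simp: even_supermats_def)
      also have "(((i < r) \<noteq> (k < r)) \<noteq> ((k < r) \<noteq> (j < n))) = ((i < r) \<noteq> (j < n))"
        by blast
      finally show ?thesis .
    qed
    then show ?thesis
      using that gc Uc by (auto simp: scalar_prod_def intro!: A_sum)
  qed
  then show ?thesis
    using gc Uc by (simp add: even_supermats_def)
qed

lemma top_cols_one: "top_cols (1\<^sub>m (r + s)) ev = 1\<^sub>m r" "top_cols (1\<^sub>m (r + s)) od = 0\<^sub>m r s"
  "bot_cols (1\<^sub>m (r + s)) ev = 0\<^sub>m s r" "bot_cols (1\<^sub>m (r + s)) od = 1\<^sub>m s"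
  by (intro eq_matI; auto)+

section \<open>Agreement of GL(r|s) with the block description\<close>

lemma super_GL_frame:
  assumes "g \<in> super_GL A r s"
  shows "frame g ev od"
proof -
  obtain h where g: "g \<in> even_supermats A r s r s" and h: "h \<in> even_supermats A r s r s"
    and gh: "inverts_mat g h"
    using assms by (auto simp: super_GL_def)
  have c: "g \<in> carrier_mat (r + s) (r + s)" "h \<in> carrier_mat (r + s) (r + s)"
    using g h by (auto simp: even_supermats_def)
  have gh': "g * h = 1\<^sub>m (r + s)"
    using gh c by (simp add: inverts_mat_def)
  have s: "set ev \<subseteq> {..<r}" "set od \<subseteq> {r..<r + s}" "set ev \<subseteq> {..<r + s}" "set od \<subseteq> {..<r + s}"
    by auto
  show ?thesis
  proof (rule GL_blocks_of_right_inverse)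
    show "top_cols g ev * top_cols h ev + top_cols g od * bot_cols h ev = 1\<^sub>m r"
      by (simp only: cols_mult[OF c s(3), symmetric] gh' top_cols_one)
    show "bot_cols g ev * top_cols h od + bot_cols g od * bot_cols h od = 1\<^sub>m s"
      by (simp only: cols_mult[OF c s(4), symmetric] gh' top_cols_one)
  qed (simp_all add: even_supermats_cols(1,2)[OF g s(1)] even_supermats_cols(3,4)[OF g s(2)]
      even_supermats_cols(1,2)[OF h s(1)] even_supermats_cols(3,4)[OF h s(2)])
qed

lemma upt_append_od: "[0..<r + s] = ev @ od"
  by (rule upt_add_eq_append) simp

lemma colm_append_eq:
  assumes "colm k T ds = colm k T' ds" "colm k T es = colm k T' es"
  shows "colm k T (ds @ es) = colm k T' (ds @ es)"
proof (rule eq_matI)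
  fix i j assume "i < dim_row (colm k T' (ds @ es))" "j < dim_col (colm k T' (ds @ es))"
  then have ij: "i < k" "j < length ds + length es"
    by auto
  have "colm k T ds $$ (i, j) = colm k T' ds $$ (i, j)" "colm k T es $$ (i, j - length ds) = colm k T' es $$ (i, j - length ds)"
    using assms by auto
  then show "colm k T (ds @ es) $$ (i, j) = colm k T' (ds @ es) $$ (i, j)"
    using ij by (cases "j < length ds") (auto simp: nth_append)
qed auto

lemma frame_super_GL:
  assumes g: "g \<in> even_supermats A r s r s" and fr: "frame g ev od"
  shows "g \<in> super_GL A r s"
proof -
  have gc: "g \<in> carrier_mat (r + s) (r + s)"
    using g by (auto simp: even_supermats_def)
  obtain a b c d where h: "GL_blocks r s a b c d"
    and e: "top_cols g ev * a + top_cols g od * c = 1\<^sub>m r" "top_cols g ev * b + top_cols g od * d = 0\<^sub>m r s"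
      "bot_cols g ev * a + bot_cols g od * c = 0\<^sub>m s r" "bot_cols g ev * b + bot_cols g od * d = 1\<^sub>m s"
    and e': "a * top_cols g ev + b * bot_cols g ev = 1\<^sub>m r" "a * top_cols g od + b * bot_cols g od = 0\<^sub>m r s"
      "c * top_cols g ev + d * bot_cols g ev = 0\<^sub>m s r" "c * top_cols g od + d * bot_cols g od = 1\<^sub>m s"
    by (rule GL_blocks_inverse[OF fr])
  define h where "h = four_block_mat a b c d"
  have bl: "a \<in> carrier_mat r r" "b \<in> carrier_mat r s" "c \<in> carrier_mat s r" "d \<in> carrier_mat s s"
    "homog False a" "homog True b" "homog True c" "homog False d"
    using h by (auto simp: GL_blocks_def)
  have hc: "h \<in> carrier_mat (r + s) (r + s)"
    unfolding h_def using bl by (intro four_block_carrier_mat)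
  have hb: "top_cols h ev = a" "top_cols h od = b" "bot_cols h ev = c" "bot_cols h od = d"
    unfolding h_def using bl by (intro eq_matI; auto)+
  have he: "h \<in> even_supermats A r s r s"
    using hc bl unfolding even_supermats_def h_def
    by (auto simp: homog_def index_mat_four_block)
  have s: "set ev \<subseteq> {..<r + s}" "set od \<subseteq> {..<r + s}"
    by auto
  have "g * h = 1\<^sub>m (r + s)"
  proof (rule eq_mat_blocks)
    show "top_cols (g * h) [0..<r + s] = top_cols (1\<^sub>m (r + s)) [0..<r + s]"
      "bot_cols (g * h) [0..<r + s] = bot_cols (1\<^sub>m (r + s)) [0..<r + s]"
      unfolding upt_append_od
      by (intro colm_append_eq; simp only: cols_mult[OF gc hc] s hb e top_cols_one)+
  qed (use gc hc in auto)
  moreover have "h * g = 1\<^sub>m (r + s)"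
  proof (rule eq_mat_blocks)
    show "top_cols (h * g) [0..<r + s] = top_cols (1\<^sub>m (r + s)) [0..<r + s]"
      "bot_cols (h * g) [0..<r + s] = bot_cols (1\<^sub>m (r + s)) [0..<r + s]"
      unfolding upt_append_od
      by (intro colm_append_eq; simp only: cols_mult[OF hc gc] s hb e' top_cols_one)+
  qed (use gc hc in auto)
  ultimately show ?thesis
    using g he gc hc by (auto simp: super_GL_def inverts_mat_def)
qed

end

end

section \<open>Coordinates of the super Grassmannian\<close>

lemma length_filter_list_update:
  assumes "\<And>x. x \<in> set xs \<Longrightarrow> \<not> \<pi> x"
  shows "length (filter \<pi> (xs[i := d])) \<le> 1"
proof -
  have "{j. j < length (xs[i := d]) \<and> \<pi> (xs[i := d] ! j)} \<subseteq> {i}"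
    using assms by auto (metis nth_list_update_neq nth_mem)
  from card_mono[OF _ this] show ?thesis
    by (simp add: length_filter_conv_card)
qed

lemma sort_in_increasing_tuples:
  "ds \<in> distinct_tuples I k \<Longrightarrow> sort ds \<in> increasing_tuples I k"
  by (auto simp: distinct_tuples_def increasing_tuples_def tuples_def strict_sorted_iff)

lemma increasing_imp_distinct_tuples:
  "ds \<in> increasing_tuples I k \<Longrightarrow> ds \<in> distinct_tuples I k"
  by (auto simp: distinct_tuples_def increasing_tuples_def tuples_def strict_sorted_iff)

text \<open>Odd labels exceed all even ones, so a single odd label ends up last, the place
  prescribed by \<open>wrong_symbols\<close>.\<close>

lemma sorted_last_only:
  assumes "sorted_wrt (<) ds" "length (filter (\<lambda>d. n \<le> d) ds) \<le> 1" "d \<in> set ds" "n \<le> (d::nat)"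
  obtains xs where "ds = xs @ [d]" "set xs \<subseteq> {..<n}" "sorted_wrt (<) xs"
proof -
  obtain xs ys where ds: "ds = xs @ d # ys"
    using assms(3) by (metis split_list)
  have "ys = []"
  proof (cases ys)
    case (Cons y ys')
    then have "d < y"
      using assms(1) ds by (simp add: sorted_wrt_append)
    then show ?thesis
      using assms(2,4) Cons ds by auto
  qed simp
  moreover have "filter (\<lambda>d. n \<le> d) xs = []"
    using assms(2,4) ds by auto
  then have "set xs \<subseteq> {..<n}"
    by (auto simp: filter_empty_conv not_le)
  ultimately show ?thesis
    using that ds assms(1) by (auto simp: sorted_wrt_append)
qed

text \<open>The mirror case for \<open>wrong_symbols_star\<close>: a single even label comes
  first.\<close>

lemma sorted_first_only:
  assumes "sorted_wrt (<) ds" "length (filter (\<lambda>d. d < n) ds) \<le> 1" "d \<in> set ds" "(d::nat) < n"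
  obtains xs where "ds = d # xs" "set xs \<subseteq> {n..}" "sorted_wrt (<) xs"
proof -
  obtain ys xs where ds: "ds = ys @ d # xs"
    using assms(3) by (metis split_list)
  have "ys = []"
  proof (cases ys rule: rev_cases)
    case (snoc ys' y)
    then have "y < d"
      using assms(1) ds by (simp add: sorted_wrt_append)
    then show ?thesis
      using assms(2,4) snoc ds by auto
  qed simp
  moreover have "filter (\<lambda>d. d < n) xs = []"
    using assms(2,4) ds by auto
  then have "set xs \<subseteq> {n..}"
    by (auto simp: filter_empty_conv not_less)
  ultimately show ?thesis
    using that ds assms(1) by (auto simp: sorted_wrt_append)
qed

text \<open>Ensures that \<open>antisym\<close> evaluates its argument at a symbol that labels a
  coordinate, never at one where the default 0 is stored; the two cases separate the
  parities.\<close>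

lemma sort_symbol:
  assumes ds: "length ds = r" "set ds \<subseteq> {..<n + m}" "length (filter (\<lambda>d. n \<le> d) ds) \<le> 1"
    and es: "es \<in> distinct_tuples (odd_inds n m) s" and dist: "distinct (ds @ es)"
  shows "if \<exists>d\<in>set ds. n \<le> d then (sort ds, sort es) \<in> wrong_symbols n m r s
    else (sort ds, sort es) \<in> right_symbols n m r s"
proof -
  have es': "sort es \<in> increasing_tuples (odd_inds n m) s"
    using es by (rule sort_in_increasing_tuples)
  show ?thesis
  proof (cases "\<exists>d\<in>set ds. n \<le> d")
    case False
    then have "ds \<in> distinct_tuples (even_inds n) r"
      using ds dist by (auto simp: distinct_tuples_def tuples_def even_inds_def not_le)
    then show ?thesis
      using False es' by (auto simp: right_symbols_def sort_in_increasing_tuples)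
  next
    case True
    then obtain d where d: "d \<in> set ds" "n \<le> d"
      by blast
    have "mset (filter (\<lambda>d. n \<le> d) (sort ds)) = mset (filter (\<lambda>d. n \<le> d) ds)"
      by simp
    then have "length (filter (\<lambda>d. n \<le> d) (sort ds)) \<le> 1"
      using ds(3) by (metis size_mset)
    moreover have "sorted_wrt (<) (sort ds)"
      using dist by (simp add: strict_sorted_iff)
    ultimately obtain xs where xs: "sort ds = xs @ [d]" "set xs \<subseteq> {..<n}" "sorted_wrt (<) xs"
      using d by (auto elim: sorted_last_only)
    have "length xs + 1 = r"
      using arg_cong[OF xs(1), of length] ds(1) by simp
    then have "r \<ge> 1" "xs \<in> increasing_tuples (even_inds n) (r - 1)"
      using xs by (auto simp: increasing_tuples_def tuples_def even_inds_def)
    moreover have "d \<in> odd_inds n m" "d \<notin> set (sort es)"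
      using d ds(2) dist by (auto simp: odd_inds_def)
    ultimately show ?thesis
      using True es' xs(1) by (auto simp: wrong_symbols_def)
  qed
qed

lemma sort_symbol_star:
  assumes es: "length es = s" "set es \<subseteq> {..<n + m}" "length (filter (\<lambda>d. d < n) es) \<le> 1"
    and ds: "ds \<in> distinct_tuples (even_inds n) r" and dist: "distinct (ds @ es)"
  shows "if \<exists>d\<in>set es. d < n then (sort ds, sort es) \<in> wrong_symbols_star n m r s
    else (sort ds, sort es) \<in> right_symbols n m r s"
proof -
  have ds': "sort ds \<in> increasing_tuples (even_inds n) r"
    using ds by (rule sort_in_increasing_tuples)
  show ?thesis
  proof (cases "\<exists>d\<in>set es. d < n")
    case False
    then have "es \<in> distinct_tuples (odd_inds n m) s"
      using es dist by (auto simp: distinct_tuples_def tuples_def odd_inds_def not_less)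
    then show ?thesis
      using False ds' by (auto simp: right_symbols_def sort_in_increasing_tuples)
  next
    case True
    then obtain d where d: "d \<in> set es" "d < n"
      by blast
    have "mset (filter (\<lambda>d. d < n) (sort es)) = mset (filter (\<lambda>d. d < n) es)"
      by simp
    then have "length (filter (\<lambda>d. d < n) (sort es)) \<le> 1"
      using es(3) by (metis size_mset)
    moreover have "sorted_wrt (<) (sort es)"
      using dist by (simp add: strict_sorted_iff)
    ultimately obtain xs where xs: "sort es = d # xs" "set xs \<subseteq> {n..}" "sorted_wrt (<) xs"
      using d by (auto elim: sorted_first_only)
    have "length xs + 1 = s"
      using arg_cong[OF xs(1), of length] es(1) by simp
    moreover have "set xs \<subseteq> {..<n + m}"
      using arg_cong[OF xs(1), of set] es(2) by auto
    ultimately have "s \<ge> 1" "xs \<in> increasing_tuples (odd_inds n m) (s - 1)"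
      using xs by (auto simp: increasing_tuples_def tuples_def odd_inds_def)
    moreover have "d \<in> even_inds n" "d \<notin> set (sort ds)"
      using d dist by (auto simp: even_inds_def)
    ultimately show ?thesis
      using True ds' xs(1) by (auto simp: wrong_symbols_star_def)
  qed
qed

section \<open>Generic matrices and their Berezinians\<close>

locale super_Pluecker = superalgebra A for A :: "bool \<Rightarrow> 'a::ring_1 set" +
  fixes n m r s :: nat
  assumes rn: "r \<le> n" and sm: "s \<le> m"
begin

abbreviation coords :: "'a mat \<Rightarrow> 'a coords" where "coords \<equiv> Pluecker_coords n m r s"
abbreviation hcoords :: "'a coords set" where "hcoords \<equiv> homogeneous_coords A n m r s"
abbreviation wrel :: "('a coords \<times> 'a coords) set" where "wrel \<equiv> weighted_rel A n m r s"
abbreviation GL :: "'a mat set" where "GL \<equiv> super_GL A r s"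
abbreviation glrel :: "('a mat \<times> 'a mat) set" where "glrel \<equiv> GL_rel A n m r s"
abbreviation mats :: "'a mat set" where "mats \<equiv> even_supermats A r s n m"
abbreviation sub :: "'a mat \<Rightarrow> nat list \<Rightarrow> nat list \<Rightarrow> 'a mat" where "sub \<equiv> submatrix_cols"
abbreviation inds :: "nat set" where "inds \<equiv> {..<n + m}"
abbreviation RS :: "(nat list \<times> nat list) set" where "RS \<equiv> right_symbols n m r s"
abbreviation WS :: "(nat list \<times> nat list) set" where "WS \<equiv> wrong_symbols n m r s"
abbreviation WS_star :: "(nat list \<times> nat list) set" where "WS_star \<equiv> wrong_symbols_star n m r s"
abbreviation pmap :: "'a mat set \<Rightarrow> 'a coords set" where "pmap \<equiv> super_Pluecker_map A n m r s"
abbreviation pdom :: "'a mat set set" where "pdom \<equiv> Pluecker_domain A n m r s"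
abbreviation few_odd :: "nat list \<Rightarrow> bool" where "few_odd ds \<equiv> length (filter (\<lambda>d. n \<le> d) ds) \<le> 1"
abbreviation few_even :: "nat list \<Rightarrow> bool" where "few_even ds \<equiv> length (filter (\<lambda>d. d < n) ds) \<le> 1"
abbreviation even_tuples :: "nat \<Rightarrow> nat list set" where "even_tuples \<equiv> tuples (even_inds n)"
abbreviation odd_tuples :: "nat \<Rightarrow> nat list set" where "odd_tuples \<equiv> tuples (odd_inds n m)"
abbreviation EV :: "nat list set" where "EV \<equiv> distinct_tuples (even_inds n) r"
abbreviation OD :: "nat list set" where "OD \<equiv> distinct_tuples (odd_inds n m) s"

lemma EV_D: "ds \<in> EV \<Longrightarrow> length ds = r" "ds \<in> EV \<Longrightarrow> set ds \<subseteq> {..<n}" "ds \<in> EV \<Longrightarrow> distinct ds"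
    "ds \<in> EV \<Longrightarrow> set ds \<subseteq> inds"
  and OD_D: "es \<in> OD \<Longrightarrow> length es = s" "es \<in> OD \<Longrightarrow> set es \<subseteq> {n..<n + m}" "es \<in> OD \<Longrightarrow> distinct es"
    "es \<in> OD \<Longrightarrow> set es \<subseteq> inds"
  by (auto simp: distinct_tuples_def tuples_def even_inds_def odd_inds_def)

text \<open>The bounds on r and s enter here. These tuples complete a tuple of one parity to a
  frame, and together they form the symbol fixed in the converse.\<close>

lemma first_EV: "[0..<r] \<in> EV" and first_OD: "[n..<n + s] \<in> OD"
  using rn sm by (auto simp: distinct_tuples_def tuples_def even_inds_def odd_inds_def)

text \<open>For U in \<open>mats\<close> equivalent to \<open>Pluecker_defined\<close>: definedness
  of \<open>Ber\<close> concerns the odd columns, that of \<open>Ber_star\<close> the even ones, and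
  together they are the invertibility of all diagonal blocks. Arbitrary orderings are included, and
  the form is visibly suited to \<open>GL_blocks_mult\<close>.\<close>

definition generic :: "'a mat \<Rightarrow> bool" where
  "generic U \<longleftrightarrow> U \<in> mats \<and> (\<forall>ds\<in>EV. \<forall>es\<in>OD. frame r s U ds es)"

lemma generic_carrier: "generic U \<Longrightarrow> U \<in> carrier_mat (r + s) (n + m)"
  and generic_even: "generic U \<Longrightarrow> U \<in> mats"
  by (auto simp: generic_def even_supermats_def)

lemma generic_frame: "generic U \<Longrightarrow> ds \<in> EV \<Longrightarrow> es \<in> OD \<Longrightarrow> frame r s U ds es"
  by (simp add: generic_def)

lemma generic_invertible_bot: "generic U \<Longrightarrow> es \<in> OD \<Longrightarrow> invertible_mat (bot_cols r s U es)"
  using generic_frame[OF _ first_EV, of U es] by (simp add: GL_blocks_def)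

lemma generic_invertible_top: "generic U \<Longrightarrow> ds \<in> EV \<Longrightarrow> invertible_mat (top_cols r U ds)"
  using generic_frame[OF _ _ first_OD, of U ds] by (simp add: GL_blocks_def)

lemma super_GL_carrier: "g \<in> GL \<Longrightarrow> g \<in> carrier_mat (r + s) (r + s)"
  by (auto simp: super_GL_def even_supermats_def)

lemma generic_mult:
  assumes U: "generic U" and g: "g \<in> GL"
  shows "generic (g * U)"
  unfolding generic_def
proof (intro conjI ballI)
  show "g * U \<in> mats"
    using g by (intro even_supermats_mult generic_even U) (simp add: super_GL_def)
  fix ds es assume ds: "ds \<in> EV" and es: "es \<in> OD"
  show "frame r s (g * U) ds es"
    unfolding cols_mult[OF super_GL_carrier[OF g] generic_carrier[OF U] EV_D(4)[OF ds]]
      cols_mult[OF super_GL_carrier[OF g] generic_carrier[OF U] OD_D(4)[OF es]]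
    by (intro GL_blocks_mult super_GL_frame[OF g] generic_frame[OF U ds es])
qed

lemma Ber_all:
  assumes "g \<in> carrier_mat (r + s) (r + s)"
  shows "Ber r g = Ber_blocks (top_cols r g (ev r)) (top_cols r g (od r s)) (bot_cols r s g (ev r)) (bot_cols r s g (od r s))"
    and "Ber_star r g = Ber_blocks (bot_cols r s g (od r s)) (bot_cols r s g (ev r)) (top_cols r g (od r s)) (top_cols r g (ev r))"
  using Ber_submatrix_cols(1,2)[of g r s "ev r" "od r s"] assms by (simp_all add: submatrix_cols_all)

lemma generic_dim: "generic U \<Longrightarrow> dim_row U = r + s"
  by (auto dest: generic_carrier)

text \<open>The even tuple \<open>first_EV\<close> completes \<open>es\<close> to the invertible
  frame required by \<open>Ber_blocks_mult_left\<close>; the columns \<open>ds\<close> may be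
  repeated or of wrong parity.\<close>

lemma Ber_mult:
  assumes U: "generic U" and g: "g \<in> GL" and ds: "length ds = r" "set ds \<subseteq> inds" and es: "es \<in> OD"
  shows "Ber r (sub (g * U) ds es) = Ber r g * Ber r (sub U ds es)"
proof -
  note gc = super_GL_carrier[OF g]
  have d: "dim_row (g * U) = r + s"
    using gc by simp
  show ?thesis
    unfolding Ber_all[OF gc] Ber_submatrix_cols(1)[OF generic_dim[OF U] ds(1) OD_D(1)[OF es]]
      Ber_submatrix_cols(1)[OF d ds(1) OD_D(1)[OF es]]
      cols_mult[OF gc generic_carrier[OF U] ds(2)] cols_mult[OF gc generic_carrier[OF U] OD_D(4)[OF es]]
    using ds(1) by (intro Ber_blocks_mult_left[OF super_GL_frame[OF g] generic_frame[OF U first_EV es]]) auto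
qed

lemma Ber_star_mult:
  assumes U: "generic U" and g: "g \<in> GL" and ds: "ds \<in> EV" and es: "length es = s" "set es \<subseteq> inds"
  shows "Ber_star r (sub (g * U) ds es) = Ber_star r g * Ber_star r (sub U ds es)"
proof -
  note gc = super_GL_carrier[OF g]
  have d: "dim_row (g * U) = r + s"
    using gc by simp
  \<comment> \<open>The summands are exchanged to match the block product formula after the exchange
    of parities.\<close>
  have t: "top_cols r (g * U) xs = top_cols r g (od r s) * bot_cols r s U xs + top_cols r g (ev r) * top_cols r U xs"
    and b: "bot_cols r s (g * U) xs = bot_cols r s g (od r s) * bot_cols r s U xs + bot_cols r s g (ev r) * top_cols r U xs"
    if "set xs \<subseteq> inds" for xs
    unfolding cols_mult[OF gc generic_carrier[OF U] that]
    by (rule comm_add_mat[of _ _ "length xs"]; auto intro!: carrier_matI)+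
  show ?thesis
    unfolding Ber_all[OF gc] Ber_submatrix_cols(2)[OF generic_dim[OF U] EV_D(1)[OF ds] es(1)]
      Ber_submatrix_cols(2)[OF d EV_D(1)[OF ds] es(1)]
      t[OF es(2)] b[OF es(2)] t[OF EV_D(4)[OF ds]] b[OF EV_D(4)[OF ds]]
    using es(1) by (intro Ber_blocks_mult_left[OF GL_blocks_swap[OF super_GL_frame[OF g]]
      GL_blocks_swap[OF generic_frame[OF U ds first_OD]]]) auto
qed

lemma super_GL_Ber:
  assumes g: "g \<in> GL"
  shows "Ber r g \<in> A False" "invertible_elem (Ber r g)" "inv_elem (Ber r g) = Ber_star r g"
    "is_inverse (Ber r g) (Ber_star r g)"
proof -
  note fr = super_GL_frame[OF g] and gc = super_GL_carrier[OF g]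
  show 1: "Ber r g \<in> A False" "invertible_elem (Ber r g)"
    unfolding Ber_all[OF gc] by (fact Ber_blocks_even[OF fr] invertible_Ber_blocks[OF fr])+
  have "Ber r g * Ber_star r g = 1"
    unfolding Ber_all[OF gc] by (rule Ber_blocks_inverse[OF fr])
  then show "is_inverse (Ber r g) (Ber_star r g)"
    using centralD[OF even_central[OF 1(1)]] by (simp add: is_inverse_def)
  then show "inv_elem (Ber r g) = Ber_star r g"
    by (rule inv_elem_eq)
qed

lemma submatrix_super_GL:
  assumes U: "generic U" and ds: "ds \<in> EV" and es: "es \<in> OD"
  shows "sub U ds es \<in> GL"
proof (rule frame_super_GL)
  let ?W = "sub U ds es"
  note d = EV_D[OF ds] and e = OD_D[OF es]
  have W: "?W \<in> carrier_mat (r + s) (r + s)"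
    by (rule submatrix_cols_carrier[OF generic_carrier[OF U]]) (simp add: d e)
  have c: "top_cols r ?W (ev r) = top_cols r U ds" "top_cols r ?W (od r s) = top_cols r U es"
    "bot_cols r s ?W (ev r) = bot_cols r s U ds" "bot_cols r s ?W (od r s) = bot_cols r s U es"
    using d(1) e(1) generic_dim[OF U] by (auto intro!: eq_matI simp: submatrix_cols_def nth_append)
  show "frame r s ?W (ev r) (od r s)"
    unfolding c by (rule generic_frame[OF U ds es])
  have "U $$ (i, (ds @ es) ! j) \<in> A ((i < r) \<noteq> (j < r))" if "i < r + s" "j < r + s" for i j
  proof -
    have k: "(ds @ es) ! j < n + m" "(ds @ es) ! j < n \<longleftrightarrow> j < r"
    proof -
      show "(ds @ es) ! j < n + m"
        using subsetD[of "set (ds @ es)" "inds", OF _ nth_mem[of j "ds @ es"]] that(2) d(1,4) e(1,4) by simp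
      show "(ds @ es) ! j < n \<longleftrightarrow> j < r"
      proof (cases "j < r")
        case True
        then show ?thesis
          using subsetD[OF d(2) nth_mem[of j ds]] d(1) by (simp add: nth_append)
      next
        case False
        then have "es ! (j - r) \<in> {n..<n + m}"
          using that(2) e(1) by (intro subsetD[OF e(2) nth_mem]) auto
        then show ?thesis
          using False d(1) by (simp add: nth_append)
      qed
    qed
    have "U $$ (i, (ds @ es) ! j) \<in> A ((i < r) \<noteq> ((ds @ es) ! j < n))"
      using generic_even[OF U] that(1) k(1) by (auto simp: even_supermats_def)
    then show ?thesis
      unfolding k(2) .
  qed
  then show "?W \<in> even_supermats A r s r s"
    using W generic_dim[OF U] d(1) e(1) unfolding even_supermats_def by (auto simp: submatrix_cols_def)
qed

lemma Ber_antisym: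
  assumes U: "U \<in> mats" and es: "es \<in> OD" "invertible_mat (bot_cols r s U es)"
    and ds: "length ds = r" "set ds \<subseteq> inds" "few_odd ds"
  shows "Ber r (sub U ds es) = antisym (\<lambda>ds es. Ber r (sub U ds es)) ds es"
    and "Ber r (sub U ds es) \<in> A (\<exists>d\<in>set ds. n \<le> d)"
proof -
  have e: "U $$ (i, j) \<in> A ((i < r) \<noteq> (j < n))" if "i < r + s" "j < n + m" for i j
    using U that by (auto simp: even_supermats_def)
  have d: "dim_row U = r + s"
    using U by (auto simp: even_supermats_def)
  have l: "d < n + m" if "d \<in> set ds \<union> set es" for d
    using that ds(2) OD_D(4)[OF es(1)] by auto
  have T: "U $$ (i, d) \<in> A (n \<le> d)" if "i < r" "d \<in> set ds \<union> set es" for i d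
    using e[of i d] l[OF that(2)] that(1) by (simp add: not_less)
  have B: "U $$ (r + i, d) \<in> A (\<not> n \<le> d)" if "i < s" "d \<in> set ds \<union> set es" for i d
    using e[of "r + i" d] l[OF that(2)] that(1) by (simp add: not_less not_le)
  have "n \<le> e" if "e \<in> set es" for e
    using OD_D(2)[OF es(1)] that by auto
  note * = Ber_blocks_colm_antisym[OF T B OD_D(1,3)[OF es(1)] this es(2) ds(1,3)]
    Ber_blocks_colm_parity[OF T B OD_D(1,3)[OF es(1)] this es(2) ds(1,3)]
  have len: "length (sort ds) = r" "length (sort es) = s"
    using ds(1) OD_D(1)[OF es(1)] by auto
  show "Ber r (sub U ds es) = antisym (\<lambda>ds es. Ber r (sub U ds es)) ds es"
    using *(1) unfolding antisym_def Ber_submatrix_cols(1)[OF d ds(1) OD_D(1)[OF es(1)]]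
      Ber_submatrix_cols(1)[OF d len] by simp
  show "Ber r (sub U ds es) \<in> A (\<exists>d\<in>set ds. n \<le> d)"
    using *(2) unfolding Ber_submatrix_cols(1)[OF d ds(1) OD_D(1)[OF es(1)]] by simp
qed

lemma Ber_star_antisym:
  assumes U: "U \<in> mats" and ds: "ds \<in> EV" "invertible_mat (top_cols r U ds)"
    and es: "length es = s" "set es \<subseteq> inds" "few_even es"
  shows "Ber_star r (sub U ds es) = antisym (\<lambda>ds es. Ber_star r (sub U ds es)) ds es"
    and "Ber_star r (sub U ds es) \<in> A (\<exists>d\<in>set es. d < n)"
proof -
  have e: "U $$ (i, j) \<in> A ((i < r) \<noteq> (j < n))" if "i < r + s" "j < n + m" for i j
    using U that by (auto simp: even_supermats_def)
  have d: "dim_row U = r + s"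
    using U by (auto simp: even_supermats_def)
  have l: "d < n + m" if "d \<in> set es \<union> set ds" for d
    using that es(2) EV_D(4)[OF ds(1)] by auto
  have T: "U $$ (r + i, d) \<in> A (d < n)" if "i < s" "d \<in> set es \<union> set ds" for i d
    using e[of "r + i" d] l[OF that(2)] that(1) by simp
  have B: "U $$ (i, d) \<in> A (\<not> d < n)" if "i < r" "d \<in> set es \<union> set ds" for i d
    using e[of i d] l[OF that(2)] that(1) by simp
  have "e < n" if "e \<in> set ds" for e
    using EV_D(2)[OF ds(1)] that by auto
  note * = Ber_blocks_colm_antisym[OF T B EV_D(1,3)[OF ds(1)] this ds(2) es(1,3)]
    Ber_blocks_colm_parity[OF T B EV_D(1,3)[OF ds(1)] this ds(2) es(1,3)]
  have len: "length (sort ds) = r" "length (sort es) = s"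
    using es(1) EV_D(1)[OF ds(1)] by auto
  have sw: "inversion_sign es * inversion_sign ds = (inversion_sign ds * inversion_sign es :: 'a)"
    by (rule centralD[OF central_inversion_sign])
  have dist: "distinct (es @ ds) = distinct (ds @ es)"
    by auto
  show "Ber_star r (sub U ds es) = antisym (\<lambda>ds es. Ber_star r (sub U ds es)) ds es"
    using *(1) unfolding antisym_def sw dist Ber_submatrix_cols(2)[OF d EV_D(1)[OF ds(1)] es(1)]
      Ber_submatrix_cols(2)[OF d len] by simp
  show "Ber_star r (sub U ds es) \<in> A (\<exists>d\<in>set es. d < n)"
    using *(2) unfolding Ber_submatrix_cols(2)[OF d EV_D(1)[OF ds(1)] es(1)] by simp
qed

text \<open>Extending by antisymmetry from increasing symbols gives back the Berezinian of the
  columns in the given order, including value 0 for repeated labels. So entries of relation matrices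
  can be computed as Berezinians.\<close>

lemma antisym_Pluecker:
  assumes U: "generic U" and es: "es \<in> OD"
    and ds: "length ds = r" "set ds \<subseteq> inds" "few_odd ds"
  shows "antisym (fst (coords U)) ds es = Ber r (sub U ds es)"
proof -
  have "antisym (fst (coords U)) ds es = antisym (\<lambda>ds es. Ber r (sub U ds es)) ds es"
    using sort_symbol[OF ds es] unfolding antisym_def Pluecker_coords_def by (auto split: if_splits)
  then show ?thesis
    using Ber_antisym(1)[OF generic_even[OF U] es generic_invertible_bot[OF U es] ds] by simp
qed

lemma antisym_Pluecker_star:
  assumes U: "generic U" and ds: "ds \<in> EV"
    and es: "length es = s" "set es \<subseteq> inds" "few_even es"
  shows "antisym (snd (coords U)) ds es = Ber_star r (sub U ds es)"
proof -
  have "antisym (snd (coords U)) ds es = antisym (\<lambda>ds es. Ber_star r (sub U ds es)) ds es"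
    using sort_symbol_star[OF es ds] unfolding antisym_def Pluecker_coords_def by (auto split: if_splits)
  then show ?thesis
    using Ber_star_antisym(1)[OF generic_even[OF U] ds generic_invertible_top[OF U ds] es] by simp
qed

end

section \<open>Integer powers and the shape of the relation matrices\<close>

lemma is_inverse_power: 
  assumes "is_inverse x y"
  shows "is_inverse (x ^ k) (y ^ k)"
proof (induction k)
  case (Suc k)
  have "is_inverse (x * x ^ k) (y ^ k * y)"
    using is_inverse_mult[OF assms Suc] .
  then show ?case
    by (simp only: power_Suc power_Suc2[symmetric])
qed (simp add: is_inverse_def)

lemma is_inverse_zpow:
  assumes "invertible_elem x"
  shows "is_inverse (zpow x k) (zpow x (- k))"
proof -
  have *: "is_inverse (x ^ l) (inv_elem x ^ l)" for l
    by (intro is_inverse_power is_inverse_inv_elem assms)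
  show ?thesis
    using *[of "nat k"] *[of "nat (- k)"] by (auto simp: zpow_def is_inverse_def)
qed

text \<open>Includes k = 0, that is r = s = 0, where the exponent is -1 and \<open>zpow\<close> uses
  the inverse.\<close>

lemma zpow_pred_mult:
  assumes "invertible_elem x"
  shows "zpow x (int k - 1) * x = x ^ k"
  using assms by (cases k) (simp_all add: zpow_def power_commutes)

lemma zpow_neg_mult:
  assumes "k \<ge> 1"
  shows "zpow x (1 - int k) * inv_elem x = inv_elem x ^ k"
proof -
  obtain l where k: "k = Suc l"
    using assms by (cases k) auto
  show ?thesis
    by (cases l) (simp_all add: k zpow_def power_commutes nat_add_distrib mult.assoc)
qed

lemma antisym_scale:
  assumes "central c"
  shows "antisym (\<lambda>ds es. c * u ds es) ds es = c * antisym u ds es"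
proof -
  have "inversion_sign ds * inversion_sign es * (c * x) = c * (inversion_sign ds * inversion_sign es * x)" for x
    using centralD[OF assms, of "inversion_sign ds * inversion_sign es"] by (metis mult.assoc)
  then show ?thesis
    by (simp add: antisym_def)
qed

lemma antisym_sorted:
  assumes "sorted ds" "sorted es" "distinct (ds @ es)"
  shows "antisym u ds es = u ds es"
  using assms by (simp add: antisym_def inversion_sign_sorted sorted_sort_id)

text \<open>For a fixed symbol all relation matrices are column submatrices of one matrix with n + m
  columns. This matrix is compared with a representative U, and in the converse it becomes the
  representative.\<close>

lemma relation_matrix_append:
  assumes "set ds \<subseteq> {..<N}" "set es \<subseteq> {..<N}"
  shows "relation_matrix p as \<mu>s (ds @ es) = submatrix_cols (relation_matrix p as \<mu>s [0..<N]) ds es"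
proof -
  have "(ds @ es) ! j < N" if "j < length ds + length es" for j
    using subsetD[of "set (ds @ es)" "{..<N}", OF _ nth_mem[of j "ds @ es"]] that assms by simp
  then show ?thesis
    by (auto simp: relation_matrix_def submatrix_cols_def split: prod.splits intro!: eq_matI)
qed

context superalgebra
begin

lemma even_inversion_sign: "inversion_sign ds \<in> A False"
  unfolding inversion_sign_altdef by (cases "even (card (inversions ds))") (auto intro: A_1 A_uminus)

lemma even_power: "x \<in> A False \<Longrightarrow> x ^ k \<in> A False"
  by (induction k) (auto intro: A_1 A_even_mult)

lemma even_zpow: "x \<in> A False \<Longrightarrow> invertible_elem x \<Longrightarrow> zpow x k \<in> A False"
  by (auto simp: zpow_def intro: even_power even_inv_elem)

end

section \<open>Symbols, parities and homogeneity of the coordinates\<close>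

context super_Pluecker
begin

lemma right_symbols_D:
  assumes "(ds, es) \<in> RS"
  shows "ds \<in> EV" "es \<in> OD" "sorted ds" "sorted es" "distinct (ds @ es)"
proof -
  show *: "ds \<in> EV" "es \<in> OD" "sorted ds" "sorted es"
    using assms by (auto simp: right_symbols_def increasing_imp_distinct_tuples)
      (auto simp: increasing_tuples_def strict_sorted_iff)
  show "distinct (ds @ es)"
    using EV_D[OF *(1)] OD_D[OF *(2)] by fastforce
qed

lemma first_right_symbol: "([0..<r], [n..<n + s]) \<in> RS"
  using first_EV first_OD
  by (auto simp: right_symbols_def increasing_tuples_def distinct_tuples_def)

lemma wrong_symbols_D:
  assumes "(ds, es) \<in> WS"
  obtains bs \<kappa> where "r \<ge> 1" "ds = bs @ [\<kappa>]" "bs \<in> even_tuples (r - 1)" "\<kappa> \<in> odd_inds n m" 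
    "es \<in> OD" "sorted ds" "sorted es" "distinct (ds @ es)" 
    "length ds = r" "set ds \<subseteq> inds" "few_odd ds" "\<exists>d\<in>set ds. n \<le> d"
proof -
  obtain bs \<kappa> where *: "r \<ge> 1" "ds = bs @ [\<kappa>]" "bs \<in> increasing_tuples (even_inds n) (r - 1)" "\<kappa> \<in> odd_inds n m"
    "es \<in> increasing_tuples (odd_inds n m) s" "\<kappa> \<notin> set es"
    using assms by (auto simp: wrong_symbols_def)
  have es: "es \<in> OD" "sorted es"
    using *(5) by (auto simp: increasing_imp_distinct_tuples) (auto simp: increasing_tuples_def strict_sorted_iff)
  have bs: "set bs \<subseteq> {..<n}" "length bs = r - 1" "sorted bs" "distinct bs"
    using *(3) by (auto simp: increasing_tuples_def tuples_def even_inds_def strict_sorted_iff)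
  have \<kappa>: "n \<le> \<kappa>" "\<kappa> < n + m"
    using *(4) by (auto simp: odd_inds_def)
  have f: "filter (\<lambda>d. n \<le> d) bs = []"
    using bs(1) by (auto simp: filter_empty_conv not_le)
  show ?thesis
  proof (rule that[OF *(1,2) _ *(4) es(1) _ es(2)])
    show "bs \<in> even_tuples (r - 1)"
      using *(3) by (simp add: increasing_tuples_def)
    show "sorted ds"
      using bs \<kappa> by (auto simp: *(2) sorted_append)
    show "distinct (ds @ es)"
      using bs \<kappa> *(6) OD_D[OF es(1)] by (fastforce simp: *(2))
    show "few_odd ds"
      by (simp add: *(2) f)
  qed (use *(1) bs \<kappa> in \<open>auto simp: *(2)\<close>)
qed

lemma wrong_symbols_star_D:
  assumes "(ds, es) \<in> WS_star"
  obtains b \<nu>s where "s \<ge> 1" "es = b # \<nu>s" "\<nu>s \<in> odd_tuples (s - 1)" "b \<in> even_inds n"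
    "ds \<in> EV" "sorted ds" "sorted es" "distinct (ds @ es)" 
    "length es = s" "set es \<subseteq> inds" "few_even es" "\<exists>d\<in>set es. d < n"
proof -
  obtain b \<nu>s where *: "s \<ge> 1" "es = b # \<nu>s" "\<nu>s \<in> increasing_tuples (odd_inds n m) (s - 1)" "b \<in> even_inds n"
    "ds \<in> increasing_tuples (even_inds n) r" "b \<notin> set ds"
    using assms by (auto simp: wrong_symbols_star_def)
  have ds: "ds \<in> EV" "sorted ds"
    using *(5) by (auto simp: increasing_imp_distinct_tuples) (auto simp: increasing_tuples_def strict_sorted_iff)
  have \<nu>s: "set \<nu>s \<subseteq> {n..<n + m}" "length \<nu>s = s - 1" "sorted \<nu>s" "distinct \<nu>s"
    using *(3) by (auto simp: increasing_tuples_def tuples_def odd_inds_def strict_sorted_iff)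
  have b: "b < n"
    using *(4) by (auto simp: even_inds_def)
  have f: "filter (\<lambda>d. d < n) \<nu>s = []"
    using \<nu>s(1) by (auto simp: filter_empty_conv not_less)
  show ?thesis
  proof (rule that[OF *(1,2) _ *(4) ds(1,2)])
    show "\<nu>s \<in> odd_tuples (s - 1)"
      using *(3) by (simp add: increasing_tuples_def)
    show "sorted es"
      using \<nu>s b by (fastforce simp: *(2))
    show "distinct (ds @ es)"
      using \<nu>s b *(6) EV_D[OF ds(1)] by (fastforce simp: *(2))
    show "few_even es"
      by (simp add: *(2) f)
  qed (use *(1) \<nu>s b in \<open>auto simp: *(2)\<close>)
qed

lemma EV_few:
  assumes "ds \<in> EV"
  shows "few_odd ds" "\<not> (\<exists>d\<in>set ds. n \<le> d)"
proof -
  show *: "\<not> (\<exists>d\<in>set ds. n \<le> d)"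
    using EV_D(2)[OF assms] by (auto simp: not_le)
  then show "few_odd ds"
    by (simp add: filter_False)
qed

lemma OD_few:
  assumes "es \<in> OD"
  shows "few_even es" "\<not> (\<exists>d\<in>set es. d < n)"
proof -
  show *: "\<not> (\<exists>d\<in>set es. d < n)"
    using OD_D(2)[OF assms] by (auto simp: not_less)
  then show "few_even es"
    by (simp add: filter_False)
qed

text \<open>The replaced entry is the only possible odd label, so the entries of the upper rows of a
  relation matrix are admissible extended coordinates, of the parity of d.\<close>

lemma EV_update:
  assumes "as \<in> EV" "d < n + m" "i < r"
  shows "length (as[i := d]) = r" "set (as[i := d]) \<subseteq> inds"
    "few_odd (as[i := d])" "(\<exists>x\<in>set (as[i := d]). n \<le> x) \<longleftrightarrow> n \<le> d"
proof -
  have lt: "x < n" if "x \<in> set as" for x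
    using EV_D(2)[OF assms(1)] that by auto
  show "length (as[i := d]) = r"
    using EV_D(1)[OF assms(1)] by simp
  show "set (as[i := d]) \<subseteq> inds"
    using EV_D(4)[OF assms(1)] assms(2) set_update_subset_insert[of as i d] by auto
  show "few_odd (as[i := d])"
    by (rule length_filter_list_update) (auto dest: lt)
  have "d \<in> set (as[i := d])"
    using assms(3) EV_D(1)[OF assms(1)] by (simp add: set_update_memI)
  then show "(\<exists>x\<in>set (as[i := d]). n \<le> x) \<longleftrightarrow> n \<le> d"
    using set_update_subset_insert[of as i d] lt by (auto simp: not_le[symmetric])
qed

lemma OD_update:
  assumes "\<mu>s \<in> OD" "d < n + m" "i < s"
  shows "length (\<mu>s[i := d]) = s" "set (\<mu>s[i := d]) \<subseteq> inds"
    "few_even (\<mu>s[i := d])" "(\<exists>x\<in>set (\<mu>s[i := d]). x < n) \<longleftrightarrow> d < n"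
proof -
  have ge: "n \<le> x" if "x \<in> set \<mu>s" for x
    using OD_D(2)[OF assms(1)] that by auto
  show "length (\<mu>s[i := d]) = s"
    using OD_D(1)[OF assms(1)] by simp
  show "set (\<mu>s[i := d]) \<subseteq> inds"
    using OD_D(4)[OF assms(1)] assms(2) set_update_subset_insert[of \<mu>s i d] by auto
  show "few_even (\<mu>s[i := d])"
    by (rule length_filter_list_update) (auto dest: ge)
  have "d \<in> set (\<mu>s[i := d])"
    using assms(3) OD_D(1)[OF assms(1)] by (simp add: set_update_memI)
  then show "(\<exists>x\<in>set (\<mu>s[i := d]). x < n) \<longleftrightarrow> d < n"
    using set_update_subset_insert[of \<mu>s i d] ge by (auto simp: not_less[symmetric])
qed

lemma antisym_parity:
  assumes p: "(u, v) \<in> hcoords" and es: "es \<in> OD"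
    and ds: "length ds = r" "set ds \<subseteq> inds" "few_odd ds"
  shows "antisym u ds es \<in> A (\<exists>d\<in>set ds. n \<le> d)"
proof (cases "distinct (ds @ es)")
  case True
  have "u (sort ds) (sort es) \<in> A (\<exists>d\<in>set ds. n \<le> d)"
    using sort_symbol[OF ds es True] p by (auto simp: homogeneous_coords_def split: if_splits)
  then show ?thesis
    using True by (simp only: antisym_def if_True) (intro A_even_mult even_inversion_sign)
qed (simp only: antisym_def if_False A_0)

lemma antisym_parity_star:
  assumes p: "(u, v) \<in> hcoords" and ds: "ds \<in> EV"
    and es: "length es = s" "set es \<subseteq> inds" "few_even es"
  shows "antisym v ds es \<in> A (\<exists>d\<in>set es. d < n)"
proof (cases "distinct (ds @ es)")
  case True
  have "v (sort ds) (sort es) \<in> A (\<exists>d\<in>set es. d < n)"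
    using sort_symbol_star[OF es ds True] p by (auto simp: homogeneous_coords_def split: if_splits)
  then show ?thesis
    using True by (simp only: antisym_def if_True) (intro A_even_mult even_inversion_sign)
qed (simp only: antisym_def if_False A_0)

lemma Ber_right:
  assumes U: "generic U" and ds: "ds \<in> EV" and es: "es \<in> OD"
  shows "is_inverse (Ber r (sub U ds es)) (Ber_star r (sub U ds es))"
    "Ber r (sub U ds es) \<in> A False" "Ber_star r (sub U ds es) \<in> A False"
proof -
  note W = submatrix_super_GL[OF U ds es]
  show "is_inverse (Ber r (sub U ds es)) (Ber_star r (sub U ds es))"
    "Ber r (sub U ds es) \<in> A False"
    by (fact super_GL_Ber[OF W])+
  show "Ber_star r (sub U ds es) \<in> A False"
    unfolding super_GL_Ber(3)[OF W, symmetric] by (intro even_inv_elem super_GL_Ber[OF W])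
qed

lemma Pluecker_coords_homogeneous:
  assumes U: "generic U"
  shows "coords U \<in> hcoords"
proof -
  let ?u = "fst (coords U)" and ?v = "snd (coords U)"
  have right: "?u ds es \<in> A False \<and> ?v ds es \<in> A False" if "(ds, es) \<in> RS" for ds es
    using that Ber_right[OF U right_symbols_D(1,2)[OF that]] by (simp add: Pluecker_coords_def)
  have wrong: "?u ds es \<in> A True" if w: "(ds, es) \<in> WS" for ds es
  proof -
    obtain bs \<kappa> where "es \<in> OD" "length ds = r" "set ds \<subseteq> inds"
      "few_odd ds" "\<exists>d\<in>set ds. n \<le> d"
      using w by (rule wrong_symbols_D)
    then show ?thesis
      using Ber_antisym(2)[OF generic_even[OF U] \<open>es \<in> OD\<close> generic_invertible_bot[OF U \<open>es \<in> OD\<close>], of ds] w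
      by (simp add: Pluecker_coords_def)
  qed
  have wrong': "?v ds es \<in> A True" if w: "(ds, es) \<in> WS_star" for ds es
  proof -
    obtain b \<nu>s where "ds \<in> EV" "length es = s" "set es \<subseteq> inds"
      "few_even es" "\<exists>d\<in>set es. d < n"
      using w by (rule wrong_symbols_star_D)
    then show ?thesis
      using Ber_star_antisym(2)[OF generic_even[OF U] \<open>ds \<in> EV\<close> generic_invertible_top[OF U \<open>ds \<in> EV\<close>], of es] w
      by (simp add: Pluecker_coords_def)
  qed
  have "invertible_elem (?u [0..<r] [n..<n + s])"
    using first_right_symbol super_GL_Ber(2)[OF submatrix_super_GL[OF U first_EV first_OD]]
    by (simp add: Pluecker_coords_def)
  then have inv: "\<exists>(ds, es) \<in> RS. invertible_elem (?u ds es) \<or> invertible_elem (?v ds es)"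
    using first_right_symbol by blast
  have zero: "?u ds es = 0" if "(ds, es) \<notin> RS \<union> WS" for ds es
    using that by (simp add: Pluecker_coords_def)
  have zero': "?v ds es = 0" if "(ds, es) \<notin> RS \<union> WS_star" for ds es
    using that by (simp add: Pluecker_coords_def)
  have "(?u, ?v) \<in> hcoords"
    unfolding homogeneous_coords_def using right wrong wrong' inv zero zero' by blast
  then show ?thesis
    by simp
qed

section \<open>The domain of the super Pluecker map\<close>

lemma Pluecker_defined_gen:
  assumes U: "U \<in> mats" and def: "Pluecker_defined n m r s U"
  shows "generic U"
  unfolding generic_def
proof (intro conjI ballI)
  fix ds es assume ds: "ds \<in> EV" and es: "es \<in> OD"
  have dim: "dim_row U = r + s"
    using U by (auto simp: even_supermats_def)
  note h = even_supermats_cols[OF U]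
  have sub: "set ds \<subseteq> {..<n}" "set es \<subseteq> {n..<n + m}"
    using EV_D(2)[OF ds] OD_D(2)[OF es] .
  have sym: "(sort ds, sort es) \<in> RS"
    using ds es by (simp add: right_symbols_def sort_in_increasing_tuples)
  have len: "length (sort ds) = r" "length (sort es) = s"
    using EV_D(1)[OF ds] OD_D(1)[OF es] by auto
  have inv: "invertible_mat (bot_cols r s U (sort es))" "invertible_mat (top_cols r U (sort ds))"
    using def sym Ber_submatrix_cols(3,4)[OF dim len] unfolding Pluecker_defined_def by auto
  \<comment> \<open>Definedness is stated for increasing symbols only; reordering columns changes
    the determinant of an even block by a sign, so invertibility passes to all orderings.\<close>
  have *: "invertible_mat (colm k T xs)"
    if "invertible_mat (colm k T (sort xs))" "homog False (colm k T xs)" "homog False (colm k T (sort xs))"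
      "length xs = k" "distinct xs" for k T xs
  proof -
    have cen: "central (T i d)" if id: "i < k" "d \<in> set xs" for i d
    proof -
      obtain j where "j < k" "d = xs ! j"
        using id(2) \<open>length xs = k\<close> by (metis in_set_conv_nth)
      then have "T i d \<in> A False"
        using \<open>homog False (colm k T xs)\<close> \<open>length xs = k\<close> id(1) by (auto simp: homog_def)
      then show ?thesis
        by (rule even_central)
    qed
    have us: "invertible_elem (inversion_sign xs :: 'a)"
      unfolding invertible_elem_def is_inverse_def by (rule exI[of _ "inversion_sign xs"]) simp
    have "sdet (colm k T xs) = inversion_sign xs * sdet (colm k T (sort xs))"
      using sdet_colm[of xs k "\<lambda>_. False" T] cen that by simp
    also have "invertible_elem \<dots>"
      using that by (intro invertible_elem_mult us) (simp add: invertible_elem_sdet_iff[of _ k] homog_central)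
    finally show ?thesis
      using that by (simp add: invertible_elem_sdet_iff[of _ k] homog_central)
  qed
  show "frame r s U ds es"
    unfolding GL_blocks_def
    using h(1,2)[OF sub(1)] h(3,4)[OF sub(2)] h(1)[of "sort ds"] h(4)[of "sort es"] sub
      *[OF inv(1)] *[OF inv(2)] EV_D(1,3)[OF ds] OD_D(1,3)[OF es] by simp
qed (rule U)

lemma generic_Pluecker_defined:
  assumes U: "generic U"
  shows "Pluecker_defined n m r s U"
  unfolding Pluecker_defined_def
proof (intro conjI ballI; clarify)
  fix ds es assume "(ds, es) \<in> RS \<union> WS"
  then have "es \<in> OD" "length ds = r"
    by (auto dest: right_symbols_D EV_D elim: wrong_symbols_D)
  then show "Ber_defined r (sub U ds es)"
    using generic_invertible_bot[OF U] by (simp add: Ber_submatrix_cols(3)[OF generic_dim[OF U]] OD_D)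
next
  fix ds es assume "(ds, es) \<in> RS \<union> WS_star"
  then have "ds \<in> EV" "length es = s"
    by (auto dest: right_symbols_D OD_D elim: wrong_symbols_star_D)
  then show "Ber_star_defined r (sub U ds es)"
    using generic_invertible_top[OF U] by (simp add: Ber_submatrix_cols(4)[OF generic_dim[OF U]] EV_D)
qed

lemma generic_full_rank: "generic U \<Longrightarrow> U \<in> full_rank_supermats A n m r s"
  unfolding full_rank_supermats_def
  using generic_even submatrix_super_GL[OF _ first_EV first_OD] first_right_symbol by blast

text \<open>The origin of the weights +1 and -1: a change of representative multiplies unstarred
  coordinates by Ber g and starred ones by \<open>Ber_star\<close> g, which is its inverse.\<close>

lemma Pluecker_coords_mult:
  assumes U: "generic U" and g: "g \<in> GL"
  shows "coords (g * U) =
    ((\<lambda>ds es. Ber r g * fst (coords U) ds es),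
     (\<lambda>ds es. inv_elem (Ber r g) * snd (coords U) ds es))"
proof -
  have "Ber r (sub (g * U) ds es) = Ber r g * Ber r (sub U ds es)"
    if "(ds, es) \<in> RS \<union> WS" for ds es
  proof -
    have "es \<in> OD" "length ds = r" "set ds \<subseteq> inds"
      using that by (auto dest: right_symbols_D EV_D elim: wrong_symbols_D)
    then show ?thesis
      by (intro Ber_mult U g)
  qed
  moreover have "Ber_star r (sub (g * U) ds es) = Ber_star r g * Ber_star r (sub U ds es)"
    if "(ds, es) \<in> RS \<union> WS_star" for ds es
  proof -
    have "ds \<in> EV" "length es = s" "set es \<subseteq> inds"
      using that by (auto dest: right_symbols_D OD_D elim: wrong_symbols_star_D)
    then show ?thesis
      by (intro Ber_star_mult U g)
  qed
  ultimately show ?thesis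
    unfolding Pluecker_coords_def super_GL_Ber(3)[OF g] by (auto intro!: ext)
qed

section \<open>Weighted classes and the map induced on them\<close>

lemma weighted_rel_iff:
  "((u, v), (u', v')) \<in> wrel \<longleftrightarrow>
    (u, v) \<in> hcoords \<and> (u', v') \<in> hcoords \<and>
    (\<exists>c\<in>A False. invertible_elem c \<and> u' = (\<lambda>ds es. c * u ds es) \<and> v' = (\<lambda>ds es. inv_elem c * v ds es))"
  by (simp add: weighted_rel_def)

lemma weighted_rel_refl:
  assumes "p \<in> hcoords"
  shows "(p, p) \<in> wrel"
proof (cases p)
  case (Pair u v)
  then show ?thesis
    using assms by (auto simp: weighted_rel_iff intro!: bexI[of _ 1] A_1)
qed

lemma weighted_rel_sym:
  assumes "(p, q) \<in> wrel"
  shows "(q, p) \<in> wrel"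
proof -
  obtain u v u' v' where pq: "p = (u, v)" "q = (u', v')"
    by fastforce
  then obtain c where c: "c \<in> A False" "invertible_elem c"
    and u': "u' = (\<lambda>ds es. c * u ds es)" and v': "v' = (\<lambda>ds es. inv_elem c * v ds es)"
    and h: "p \<in> hcoords" "q \<in> hcoords"
    using assms by (auto simp: weighted_rel_iff)
  have "u = (\<lambda>ds es. inv_elem c * u' ds es)" "v = (\<lambda>ds es. inv_elem (inv_elem c) * v' ds es)"
    using c(2) by (auto simp: u' v' mult.assoc[symmetric] inv_elem_inv_elem)
  then show ?thesis
    using h c unfolding pq weighted_rel_iff
    by (intro conjI bexI[of _ "inv_elem c"] even_inv_elem invertible_elem_inv_elem)
qed

lemma weighted_rel_trans:
  assumes "(p, q) \<in> wrel" "(q, w) \<in> wrel"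
  shows "(p, w) \<in> wrel"
proof -
  obtain u v u' v' u'' v'' where pq: "p = (u, v)" "q = (u', v')" "w = (u'', v'')"
    by (metis prod.exhaust)
  then obtain c where c: "c \<in> A False" "invertible_elem c"
    and u': "u' = (\<lambda>ds es. c * u ds es)" and v': "v' = (\<lambda>ds es. inv_elem c * v ds es)"
    and h: "p \<in> hcoords"
    using assms(1) by (auto simp: weighted_rel_iff)
  obtain d where d: "d \<in> A False" "invertible_elem d"
    and u'': "u'' = (\<lambda>ds es. d * u' ds es)" and v'': "v'' = (\<lambda>ds es. inv_elem d * v' ds es)"
    and h': "w \<in> hcoords"
    using assms(2) pq by (auto simp: weighted_rel_iff)
  have "inv_elem (d * c) = inv_elem d * inv_elem c"
    using centralD[OF even_central[OF even_inv_elem[OF d]], of "inv_elem c"] c(2) d(2) by (simp add: inv_elem_mult)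
  then have "u'' = (\<lambda>ds es. (d * c) * u ds es)" "v'' = (\<lambda>ds es. inv_elem (d * c) * v ds es)"
    by (auto simp: u' v' u'' v'' mult.assoc)
  then show ?thesis
    using h h' c d unfolding pq weighted_rel_iff
    by (intro conjI bexI[of _ "d * c"] A_even_mult invertible_elem_mult)
qed

lemma weighted_rel_class_eq:
  assumes "(p, q) \<in> wrel"
  shows "wrel `` {p} = wrel `` {q}"
  using assms weighted_rel_sym[OF assms] weighted_rel_trans by blast

lemma one_super_GL: "1\<^sub>m (r + s) \<in> GL"
proof -
  have "1\<^sub>m (r + s) \<in> even_supermats A r s r s"
    by (auto simp: even_supermats_def A_0 A_1)
  then show ?thesis
    unfolding super_GL_def by (auto simp: inverts_mat_def intro!: bexI[of _ "1\<^sub>m (r + s)"])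
qed

text \<open>All representatives g * U give the same weighted class, so the union defining the map
  collapses to one class; and genericity is preserved by g, so the whole orbit lies in the
  domain.\<close>

lemma super_Pluecker_map_class:
  assumes U: "generic U"
  shows "pmap (glrel `` {U}) = wrel `` {coords U}"
    and "glrel `` {U} \<in> pdom"
proof -
  have cl: "glrel `` {U} = {g * U | g. g \<in> GL}"
    using generic_full_rank[OF U] by (auto simp: GL_rel_def)
  have U1: "U \<in> {g * U | g. g \<in> GL}"
    using one_super_GL generic_carrier[OF U] by force
  have eq: "wrel `` {coords (g * U)} = wrel `` {coords U}"
    if g: "g \<in> GL" for g
  proof (rule weighted_rel_class_eq[symmetric])
    obtain u v where uv: "coords U = (u, v)"
      by fastforce
    show "(coords U, coords (g * U)) \<in> wrel"
      using Pluecker_coords_homogeneous[OF U] Pluecker_coords_homogeneous[OF generic_mult[OF U g]] super_GL_Ber(1,2)[OF g]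
      unfolding Pluecker_coords_mult[OF U g] uv by (auto simp: weighted_rel_iff)
  qed
  show "pmap (glrel `` {U}) = wrel `` {coords U}"
    unfolding super_Pluecker_map_def cl using eq U1 by blast
  show "glrel `` {U} \<in> pdom"
    unfolding Pluecker_domain_def super_Grassmannian_def quotient_def
    using generic_full_rank[OF U] generic_Pluecker_defined[OF generic_mult[OF U]] by (auto simp: GL_rel_def)
qed

lemma Pluecker_domain_gen:
  assumes "\<Gamma> \<in> pdom"
  obtains U where "generic U" "\<Gamma> = glrel `` {U}"
proof -
  obtain U where U: "U \<in> full_rank_supermats A n m r s" "\<Gamma> = glrel `` {U}"
    using assms by (auto simp: Pluecker_domain_def super_Grassmannian_def quotient_def)
  then have Ue: "U \<in> mats"
    by (auto simp: full_rank_supermats_def)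
  have "1\<^sub>m (r + s) * U = U"
    using Ue by (auto simp: even_supermats_def)
  then have "U \<in> \<Gamma>"
    using U one_super_GL unfolding GL_rel_def by force
  then have "Pluecker_defined n m r s U"
    using assms by (auto simp: Pluecker_domain_def)
  then show ?thesis
    using that U(2) Pluecker_defined_gen[OF Ue] by blast
qed

end

section \<open>The relations\<close>

context super_Pluecker
begin

section \<open>Group structure and diagonal elements of GL(r|s)\<close>

lemma super_GL_even: "g \<in> GL \<Longrightarrow> g \<in> even_supermats A r s r s"
  by (simp add: super_GL_def)

lemma super_GL_inverse:
  assumes "g \<in> GL"
  obtains h where "h \<in> GL" "g * h = 1\<^sub>m (r + s)" "h * g = 1\<^sub>m (r + s)"
proof -
  obtain h where h: "h \<in> even_supermats A r s r s" "inverts_mat g h" "inverts_mat h g"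
    using assms by (auto simp: super_GL_def)
  moreover from this have "h \<in> GL"
    using super_GL_even[OF assms] by (auto simp: super_GL_def)
  ultimately show ?thesis
    using that super_GL_carrier[OF assms] by (auto simp: inverts_mat_def even_supermats_def)
qed

lemma super_GL_mult:
  assumes g: "g \<in> GL" and h: "h \<in> GL"
  shows "g * h \<in> GL"
proof -
  obtain g' where g': "g' \<in> GL" "g * g' = 1\<^sub>m (r + s)" "g' * g = 1\<^sub>m (r + s)"
    by (rule super_GL_inverse[OF g])
  obtain h' where h': "h' \<in> GL" "h * h' = 1\<^sub>m (r + s)" "h' * h = 1\<^sub>m (r + s)"
    by (rule super_GL_inverse[OF h])
  note c = super_GL_carrier[OF g] super_GL_carrier[OF h] super_GL_carrier[OF g'(1)] super_GL_carrier[OF h'(1)]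
  have "(g * h) * (h' * g') = g * (h * h') * g'"
    using c by (simp add: mat_assoc)
  moreover have "(h' * g') * (g * h) = h' * (g' * g) * h"
    using c by (simp add: mat_assoc)
  ultimately have "inverts_mat (g * h) (h' * g')" "inverts_mat (h' * g') (g * h)"
    using c g'(2,3) h'(2,3) by (auto simp: inverts_mat_def)
  then show ?thesis
    using even_supermats_mult super_GL_even g h g'(1) h'(1) unfolding super_GL_def by blast
qed

definition diag :: "'a \<Rightarrow> 'a \<Rightarrow> 'a mat" where
  "diag t t' = mat (r + s) (r + s) (\<lambda>(i, j). if i = j then if i < r then t else t' else 0)"

lemma diag_carrier: "diag t t' \<in> carrier_mat (r + s) (r + s)"
  by (simp add: diag_def)

lemma index_diag_mult:
  assumes "M \<in> carrier_mat (r + s) k" "i < r + s" "j < k"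
  shows "(diag t t' * M) $$ (i, j) = (if i < r then t else t') * M $$ (i, j)"
proof -
  have "(diag t t' * M) $$ (i, j) = (\<Sum>l = 0..<r + s. (if i = l then if i < r then t else t' else 0) * M $$ (l, j))"
    using assms by (simp add: diag_def scalar_prod_def)
  also have "\<dots> = (\<Sum>l = 0..<r + s. if i = l then (if i < r then t else t') * M $$ (l, j) else 0)"
    by (intro sum.cong) auto
  finally show ?thesis
    using assms(2) by simp
qed

lemma diag_super_GL:
  assumes t: "t \<in> A False" "t' \<in> A False" "is_inverse t t'"
  shows "diag t t' \<in> GL"
proof -
  have e: "diag x y \<in> even_supermats A r s r s" if "x \<in> A False" "y \<in> A False" for x y
    using that by (auto simp: even_supermats_def diag_def A_0)
  have "diag x y * diag y x = 1\<^sub>m (r + s)" if "is_inverse x y" for x y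
  proof (rule eq_matI)
    fix i j assume "i < dim_row (1\<^sub>m (r + s) :: 'a mat)" "j < dim_col (1\<^sub>m (r + s) :: 'a mat)"
    then have ij: "i < r + s" "j < r + s"
      by auto
    show "(diag x y * diag y x) $$ (i, j) = 1\<^sub>m (r + s) $$ (i, j)"
      unfolding index_diag_mult[OF diag_carrier ij]
      using ij that by (simp add: diag_def is_inverse_def)
  qed (simp_all add: diag_def)
  moreover have "is_inverse t' t"
    using t by (simp add: is_inverse_def)
  ultimately show ?thesis
    using e t carrier_matD(1)[OF diag_carrier]
    by (auto simp: super_GL_def inverts_mat_def intro!: bexI[of _ "diag t' t"])
qed

text \<open>The even block contributes t^r; the odd block contributes the inverse of t'^s, which is
  t^s. This is the source of the exponent r + s.\<close>

lemma Ber_diag: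
  assumes t: "t \<in> A False" "t' \<in> A False" "is_inverse t t'"
  shows "Ber r (diag t t') = t ^ (r + s)" "Ber_star r (diag t t') = t' ^ (r + s)"
proof -
  have c: "top_cols r (diag t t') (ev r) = t \<cdot>\<^sub>m 1\<^sub>m r" "top_cols r (diag t t') (od r s) = 0\<^sub>m r s"
    "bot_cols r s (diag t t') (ev r) = 0\<^sub>m s r" "bot_cols r s (diag t t') (od r s) = t' \<cdot>\<^sub>m 1\<^sub>m s"
    by (intro eq_matI; auto simp: diag_def)+
  have i: "inv_elem (t' ^ k) = t ^ k" "inv_elem (t ^ k) = t' ^ k" for k
    using t(3) by (auto intro!: inv_elem_eq is_inverse_power simp: is_inverse_def[of t'] is_inverse_def[of t])
  have inv: "invertible_mat (x \<cdot>\<^sub>m 1\<^sub>m k)" if "is_inverse x y" "x \<in> A False" for x y k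
  proof -
    have "homog False (x \<cdot>\<^sub>m 1\<^sub>m k)"
      using that by (auto simp: homog_def A_0)
    then show ?thesis
      using that is_inverse_power[OF that(1)]
      by (subst invertible_elem_sdet_iff[symmetric, of _ k])
        (auto simp: homog_central sdet_smult_one even_central invertible_elem_def)
  qed
  have t'': "is_inverse t' t"
    using t(3) by (simp add: is_inverse_def)
  have "Ber_blocks (x \<cdot>\<^sub>m 1\<^sub>m k) (0\<^sub>m k l) (0\<^sub>m l k) (y \<cdot>\<^sub>m 1\<^sub>m l) = x ^ k * inv_elem (y ^ l)"
    if "is_inverse y z" "x \<in> A False" "y \<in> A False" for x y z k l
  proof -
    have "Ber_blocks (x \<cdot>\<^sub>m 1\<^sub>m k) (0\<^sub>m k l) (0\<^sub>m l k) (y \<cdot>\<^sub>m 1\<^sub>m l) =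
      sdet (x \<cdot>\<^sub>m 1\<^sub>m k - 0\<^sub>m k l * 0\<^sub>m l k) * inv_elem (sdet (y \<cdot>\<^sub>m 1\<^sub>m l))"
      by (rule Ber_blocks_eqI[OF _ inv[OF that(1,3)]]) auto
    also have "x \<cdot>\<^sub>m 1\<^sub>m k - 0\<^sub>m k l * 0\<^sub>m l k = x \<cdot>\<^sub>m 1\<^sub>m k"
      by (intro eq_matI) auto
    finally show ?thesis
      using that by (simp add: sdet_smult_one even_central)
  qed
  from this[OF t'' t(1,2)] this[OF t(3) t(2,1)]
  show "Ber r (diag t t') = t ^ (r + s)" "Ber_star r (diag t t') = t' ^ (r + s)"
    unfolding Ber_all[OF diag_carrier] c i by (simp_all add: power_add) (metis add.commute power_add)
qed

text \<open>The columns as | mus form the identity, so after replacing one of them the off-diagonal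
  block over the untouched parity is 0 and its diagonal block is 1. The Berezinian reduces to the
  determinant of an identity matrix with one column replaced.\<close>

lemma Cramer:
  assumes W: "generic W" "sub W as \<mu>s = 1\<^sub>m (r + s)" and as: "as \<in> EV" and \<mu>s: "\<mu>s \<in> OD"
  shows "i < r \<Longrightarrow> Ber r (sub W (as[i := d]) \<mu>s) = W $$ (i, d)"
    and "j < s \<Longrightarrow> Ber_star r (sub W as (\<mu>s[j := d])) = W $$ (r + j, d)"
proof -
  note len = EV_D(1)[OF as] OD_D(1)[OF \<mu>s]
  have e: "W $$ (i, (as @ \<mu>s) ! j) = (if i = j then 1 else 0)" if "i < r + s" "j < r + s" for i j
    using arg_cong[OF W(2), of "\<lambda>M. M $$ (i, j)"] that len generic_dim[OF W(1)] by (simp add: submatrix_cols_def)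
  have ea: "W $$ (i, as ! j) = (if i = j then 1 else 0)" if "i < r + s" "j < r" for i j
    using e[of i j] that len by (simp add: nth_append)
  have em: "W $$ (i, \<mu>s ! j) = (if i = r + j then 1 else 0)" if "i < r + s" "j < s" for i j
    using e[of i "r + j"] that len by (simp add: nth_append)
  have blocks: "bot_cols r s W \<mu>s = 1\<^sub>m s" "top_cols r W \<mu>s = 0\<^sub>m r s"
    "bot_cols r s W as = 0\<^sub>m s r" "top_cols r W as = 1\<^sub>m r"
    using len by (auto intro!: eq_matI simp: ea em)
  have inv1: "invertible_mat (1\<^sub>m k :: 'a mat)" for k
    by (rule invertible_matI[of _ k "1\<^sub>m k"]) auto
  have B: "Ber_blocks M (0\<^sub>m k l) N (1\<^sub>m l) = sdet M" if "M \<in> carrier_mat k k" "N \<in> carrier_mat l k" for M N :: "'a mat" and k l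
  proof -
    have "Ber_blocks M (0\<^sub>m k l) N (1\<^sub>m l) = sdet (M - 0\<^sub>m k l * N) * inv_elem (sdet (1\<^sub>m l))"
      by (rule Ber_blocks_eqI[OF _ inv1]) auto
    also have "M - 0\<^sub>m k l * N = M"
      using that by (intro eq_matI) auto
    finally show ?thesis
      by simp
  qed
  show "Ber r (sub W (as[i := d]) \<mu>s) = W $$ (i, d)" if i: "i < r"
  proof -
    have "top_cols r W (as[i := d]) =
        mat r r (\<lambda>(k, j). if j = i then W $$ (k, d) else if k = j then 1 else 0)"
      using len by (intro eq_matI) (auto simp: nth_list_update ea)
    then have "sdet (top_cols r W (as[i := d])) = W $$ (i, d)"
      using sdet_id_col[OF i, of "\<lambda>k. W $$ (k, d)"] by simp
    then show ?thesis
      using len by (simp add: Ber_submatrix_cols(1)[OF generic_dim[OF W(1)]] blocks B)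
  qed
  show "Ber_star r (sub W as (\<mu>s[j := d])) = W $$ (r + j, d)" if j: "j < s"
  proof -
    have "bot_cols r s W (\<mu>s[j := d]) =
        mat s s (\<lambda>(k, l). if l = j then W $$ (r + k, d) else if k = l then 1 else 0)"
      using len by (intro eq_matI) (auto simp: nth_list_update em)
    then have "sdet (bot_cols r s W (\<mu>s[j := d])) = W $$ (r + j, d)"
      using sdet_id_col[OF j, of "\<lambda>k. W $$ (r + k, d)"] by simp
    then show ?thesis
      using len by (simp add: Ber_submatrix_cols(2)[OF generic_dim[OF W(1)]] blocks B)
  qed
qed

lemma submatrix_cols_mult:
  fixes g U :: "'a mat"
  assumes "g \<in> carrier_mat k k" "U \<in> carrier_mat k N" "set ds \<subseteq> {..<N}" "set es \<subseteq> {..<N}"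
  shows "sub (g * U) ds es = g * sub U ds es"
proof -
  have "(ds @ es) ! j < N" if "j < length ds + length es" for j
    using subsetD[of "set (ds @ es)" "{..<N}", OF _ nth_mem[of j "ds @ es"]] that assms by simp
  then show ?thesis
    using assms(1,2) by (intro eq_matI) (auto simp: submatrix_cols_def scalar_prod_def)
qed

text \<open>The representative and the factor c are both free, so arbitrary homogeneous coordinates
  of the point are covered. The two Berezinian identities result from taking the columns as | mus of
  g * U = diag t t' * W in two ways: the left side gives g times the submatrix of U, the right side
  diag t t' times the identity.\<close>

lemma relation_matrix_Pluecker:
  assumes U: "generic U" and c: "c \<in> A False" "invertible_elem c"
    and uv: "u = (\<lambda>ds es. c * fst (coords U) ds es)"
      "v = (\<lambda>ds es. inv_elem c * snd (coords U) ds es)"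
    and as: "as \<in> EV" and \<mu>s: "\<mu>s \<in> OD"
  obtains g where "g \<in> GL" "relation_matrix (u, v) as \<mu>s [0..<n + m] = g * U"
    "Ber r g * Ber r (sub U as \<mu>s) = antisym u as \<mu>s ^ (r + s)"
    "Ber_star r g * Ber_star r (sub U as \<mu>s) = antisym v as \<mu>s ^ (r + s)"
    "is_inverse (antisym u as \<mu>s) (antisym v as \<mu>s)"
proof -
  define W0 where "W0 = sub U as \<mu>s"
  have W0: "W0 \<in> GL"
    unfolding W0_def by (rule submatrix_super_GL[OF U as \<mu>s])
  obtain h where h: "h \<in> GL" "W0 * h = 1\<^sub>m (r + s)" "h * W0 = 1\<^sub>m (r + s)"
    by (rule super_GL_inverse[OF W0])
  define W where "W = h * U"
  have W: "generic W"
    unfolding W_def by (rule generic_mult[OF U h(1)])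
  have W1: "sub W as \<mu>s = 1\<^sub>m (r + s)"
    unfolding W_def using h(3) EV_D(4)[OF as] OD_D(4)[OF \<mu>s]
    by (simp add: submatrix_cols_mult[OF super_GL_carrier[OF h(1)] generic_carrier[OF U]] W0_def)
  have UW: "U = W0 * W"
    unfolding W_def using super_GL_carrier[OF h(1)] super_GL_carrier[OF W0] generic_carrier[OF U] h(2)
    by (simp add: mat_assoc[symmetric])
  have uc: "antisym u ds es = c * antisym (fst (coords U)) ds es" for ds es
    unfolding uv(1) by (rule antisym_scale[OF even_central[OF c(1)]])
  have vc: "antisym v ds es = inv_elem c * antisym (snd (coords U)) ds es" for ds es
    unfolding uv(2) by (rule antisym_scale[OF even_central[OF even_inv_elem[OF c]]])
  let ?b = "Ber r W0" and ?b' = "Ber_star r W0"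
  define t where "t = c * ?b"
  define t' where "t' = inv_elem c * ?b'"
  have ta: "antisym u as \<mu>s = t"
    unfolding uc t_def W0_def using antisym_Pluecker[OF U \<mu>s EV_D(1,4)[OF as] EV_few(1)[OF as]] by simp
  have ta': "antisym v as \<mu>s = t'"
    unfolding vc t'_def W0_def using antisym_Pluecker_star[OF U as OD_D(1,4)[OF \<mu>s] OD_few(1)[OF \<mu>s]] by simp
  have "is_inverse t (?b' * inv_elem c)"
    unfolding t_def by (intro is_inverse_mult is_inverse_inv_elem c super_GL_Ber(4)[OF W0])
  also have "?b' * inv_elem c = t'"
    unfolding t'_def by (rule centralD[OF even_central[OF even_inv_elem[OF c]], symmetric])
  finally have tt: "is_inverse t t'" .
  have te: "t \<in> A False" "t' \<in> A False"
    unfolding t_def t'_def W0_def using Ber_right[OF U as \<mu>s] c by (auto intro!: A_even_mult even_inv_elem)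
  let ?R = "relation_matrix (u, v) as \<mu>s [0..<n + m]"
  \<comment> \<open>An entry is c times a Berezinian of U with one column exchanged. Writing U = W0
    * W, multiplicativity splits off Ber W0, which with c makes t, and \<open>Cramer\<close>
    identifies the rest as an entry of W. The starred rows give t' in the same way.\<close>
  have R: "?R = diag t t' * W"
  proof (rule eq_matI)
    fix i j assume "i < dim_row (diag t t' * W)" "j < dim_col (diag t t' * W)"
    then have ij: "i < r + s" "j < n + m"
      using generic_carrier[OF W] diag_carrier[of t t'] by auto
    show "?R $$ (i, j) = (diag t t' * W) $$ (i, j)"
    proof (cases "i < r")
      case True
      note upd = EV_update[OF as ij(2) True]
      have "?R $$ (i, j) = antisym u (as[i := j]) \<mu>s"
        using ij True EV_D(1)[OF as] OD_D(1)[OF \<mu>s] by (simp add: relation_matrix_def)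
      also have "\<dots> = c * Ber r (sub U (as[i := j]) \<mu>s)"
        unfolding uc antisym_Pluecker[OF U \<mu>s upd(1-3)] ..
      also have "\<dots> = c * (?b * Ber r (sub W (as[i := j]) \<mu>s))"
        unfolding Ber_mult[OF W W0 upd(1,2) \<mu>s, symmetric] UW[symmetric] ..
      also have "\<dots> = t * W $$ (i, j)"
        unfolding Cramer(1)[OF W W1 as \<mu>s True] t_def by (simp add: mult.assoc)
      finally show ?thesis
        using True index_diag_mult[OF generic_carrier[OF W] ij] by simp
    next
      case False
      then have k: "i - r < s" "r + (i - r) = i"
        using ij by auto
      note upd = OD_update[OF \<mu>s ij(2) k(1)]
      have "?R $$ (i, j) = antisym v as (\<mu>s[i - r := j])"
        using ij False EV_D(1)[OF as] OD_D(1)[OF \<mu>s] by (simp add: relation_matrix_def)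
      also have "\<dots> = inv_elem c * Ber_star r (sub U as (\<mu>s[i - r := j]))"
        unfolding vc antisym_Pluecker_star[OF U as upd(1-3)] ..
      also have "\<dots> = inv_elem c * (?b' * Ber_star r (sub W as (\<mu>s[i - r := j])))"
        unfolding Ber_star_mult[OF W W0 as upd(1,2), symmetric] UW[symmetric] ..
      also have "\<dots> = t' * W $$ (i, j)"
        unfolding Cramer(2)[OF W W1 as \<mu>s k(1)] t'_def k(2) by (simp add: mult.assoc)
      finally show ?thesis
        using False index_diag_mult[OF generic_carrier[OF W] ij] by simp
    qed
  qed (use EV_D(1)[OF as] OD_D(1)[OF \<mu>s] generic_carrier[OF W] diag_carrier[of t t'] in \<open>auto simp: relation_matrix_def\<close>)
  note D = diag_super_GL[OF te tt]
  define g where "g = diag t t' * h"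
  have g: "g \<in> GL"
    unfolding g_def by (rule super_GL_mult[OF D h(1)])
  have Rg: "?R = g * U"
    unfolding R W_def g_def using diag_carrier[of t t'] super_GL_carrier[OF h(1)] generic_carrier[OF U]
    by (intro assoc_mult_mat[symmetric])
  have gW: "g * U = diag t t' * W"
    using Rg R by simp
  have one: "Ber r (1\<^sub>m (r + s) :: 'a mat) = 1" "Ber_star r (1\<^sub>m (r + s) :: 'a mat) = 1"
  proof -
    have "diag 1 1 = 1\<^sub>m (r + s)"
      by (rule eq_matI) (auto simp: diag_def)
    then show "Ber r (1\<^sub>m (r + s) :: 'a mat) = 1" "Ber_star r (1\<^sub>m (r + s) :: 'a mat) = 1"
      using Ber_diag[of 1 1] by (auto simp: A_1 is_inverse_def)
  qed
  have "Ber r g * ?b = t ^ (r + s)"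
    using Ber_mult[OF U g EV_D(1,4)[OF as] \<mu>s] Ber_mult[OF W D EV_D(1,4)[OF as] \<mu>s]
    unfolding gW W1 one Ber_diag[OF te tt] W0_def by simp
  moreover have "Ber_star r g * ?b' = t' ^ (r + s)"
    using Ber_star_mult[OF U g as OD_D(1,4)[OF \<mu>s]] Ber_star_mult[OF W D as OD_D(1,4)[OF \<mu>s]]
    unfolding gW W1 one Ber_diag[OF te tt] W0_def by simp
  ultimately show ?thesis
    using that[OF g Rg] tt unfolding ta ta' W0_def by simp
qed

section \<open>From points of the Grassmannian to the relations\<close>

lemma tuples_EV_D:
  "bs \<in> even_tuples k \<Longrightarrow> length bs = k" "bs \<in> even_tuples k \<Longrightarrow> set bs \<subseteq> inds"
  "bs \<in> even_tuples k \<Longrightarrow> filter (\<lambda>d. n \<le> d) bs = []"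
  by (auto simp: tuples_def even_inds_def filter_empty_conv not_le)

lemma tuples_OD_D:
  "\<nu>s \<in> odd_tuples k \<Longrightarrow> length \<nu>s = k" "\<nu>s \<in> odd_tuples k \<Longrightarrow> set \<nu>s \<subseteq> inds"
  "\<nu>s \<in> odd_tuples k \<Longrightarrow> filter (\<lambda>d. d < n) \<nu>s = []"
  by (auto simp: tuples_def odd_inds_def filter_empty_conv not_less)

lemma Pluecker_imp_relations:
  assumes U: "generic U" and c: "c \<in> A False" "invertible_elem c"
    and uv: "u = (\<lambda>ds es. c * fst (coords U) ds es)"
      "v = (\<lambda>ds es. inv_elem c * snd (coords U) ds es)"
  shows "super_Pluecker_relations n m r s (u, v)"
proof -
  have uc: "antisym u ds es = c * antisym (fst (coords U)) ds es" for ds es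
    unfolding uv(1) by (rule antisym_scale[OF even_central[OF c(1)]])
  have vc: "antisym v ds es = inv_elem c * antisym (snd (coords U)) ds es" for ds es
    unfolding uv(2) by (rule antisym_scale[OF even_central[OF even_inv_elem[OF c]]])
  \<comment> \<open>The second and third relations are instances of one statement, for r columns of
    which at most one is odd; the fourth is proved for s columns of which at most one is
    even.\<close>
  have "antisym u as \<mu>s * antisym v as \<mu>s = 1 \<and>
     (\<forall>bs \<nu>s. length bs = r \<longrightarrow> set bs \<subseteq> inds \<longrightarrow> few_odd bs \<longrightarrow> \<nu>s \<in> OD \<longrightarrow>
        Ber_defined r (relation_matrix (u, v) as \<mu>s (bs @ \<nu>s)) \<and>
        Ber r (relation_matrix (u, v) as \<mu>s (bs @ \<nu>s)) =
          zpow (antisym u as \<mu>s) (int r + int s - 1) * antisym u bs \<nu>s) \<and>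
     (s \<ge> 1 \<longrightarrow> (\<forall>bs \<nu>s. bs \<in> EV \<longrightarrow> length \<nu>s = s \<longrightarrow> set \<nu>s \<subseteq> inds \<longrightarrow> few_even \<nu>s \<longrightarrow>
        Ber_star_defined r (relation_matrix (u, v) as \<mu>s (bs @ \<nu>s)) \<and>
        Ber_star r (relation_matrix (u, v) as \<mu>s (bs @ \<nu>s)) =
          zpow (antisym u as \<mu>s) (- int r - int s + 1) * antisym v bs \<nu>s))"
    if as: "as \<in> EV" and \<mu>s: "\<mu>s \<in> OD" for as \<mu>s
  proof -
    let ?t = "antisym u as \<mu>s" and ?t' = "antisym v as \<mu>s"
    let ?b = "Ber r (sub U as \<mu>s)" and ?b' = "Ber_star r (sub U as \<mu>s)"
    obtain g where g: "g \<in> GL" "relation_matrix (u, v) as \<mu>s [0..<n + m] = g * U"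
      "Ber r g * ?b = ?t ^ (r + s)" "Ber_star r g * ?b' = ?t' ^ (r + s)" "is_inverse ?t ?t'"
      by (rule relation_matrix_Pluecker[OF U c uv as \<mu>s])
    note gU = generic_mult[OF U g(1)]
    have M: "relation_matrix (u, v) as \<mu>s (ds @ es) = sub (g * U) ds es"
      if "set ds \<subseteq> inds" "set es \<subseteq> inds" for ds es
      unfolding relation_matrix_append[OF that] g(2) ..
    have ti: "invertible_elem ?t" "inv_elem ?t = ?t'"
      using g(5) inv_elem_eq by (auto simp: invertible_elem_def)
    have tb: "?t = c * ?b" "?t' = inv_elem c * ?b'"
      unfolding uc vc using antisym_Pluecker[OF U \<mu>s EV_D(1,4)[OF as] EV_few(1)[OF as]]
        antisym_Pluecker_star[OF U as OD_D(1,4)[OF \<mu>s] OD_few(1)[OF \<mu>s]] by simp_all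
    have bi: "invertible_elem ?b" "invertible_elem ?b'"
      using Ber_right(1)[OF U as \<mu>s] by (auto simp: invertible_elem_def is_inverse_def)
    \<comment> \<open>Since t = c * b, one factor t of t^(r+s) is spent on c * b, and the unit b can
      be cancelled.\<close>
    have "Ber r g * ?b = zpow ?t (int r + int s - 1) * c * ?b"
      using zpow_pred_mult[OF ti(1), of "r + s"] unfolding g(3) by (simp add: tb(1)[symmetric] mult.assoc)
    then have Bg: "Ber r g = zpow ?t (int r + int s - 1) * c"
      by (rule invertible_elem_right_cancel[OF bi(1)])
    \<comment> \<open>The starred counterpart: one factor t^-1 is split into the inverse of c and
      b'. The fourth relation exists only for s at least 1, which makes r + s positive as
      \<open>zpow_neg_mult\<close> demands.\<close>
    have Bg': "Ber_star r g = zpow ?t (- int r - int s + 1) * inv_elem c" if "s \<ge> 1"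
    proof -
      have e: "1 - int (r + s) = - int r - int s + 1"
        by simp
      have "zpow ?t (- int r - int s + 1) * ?t' = ?t' ^ (r + s)"
        using zpow_neg_mult[of "r + s" ?t] that unfolding ti(2) e by simp
      then have "Ber_star r g * ?b' = zpow ?t (- int r - int s + 1) * inv_elem c * ?b'"
        unfolding g(4) by (simp add: tb(2)[symmetric] mult.assoc)
      then show ?thesis
        by (rule invertible_elem_right_cancel[OF bi(2)])
    qed
    show ?thesis
    proof (intro conjI allI impI)
      show "?t * ?t' = 1"
        using g(5) by (simp add: is_inverse_def)
    next
      fix bs \<nu>s assume bs: "length bs = r" "set bs \<subseteq> inds" "few_odd bs" and \<nu>s: "\<nu>s \<in> OD"
      show "Ber_defined r (relation_matrix (u, v) as \<mu>s (bs @ \<nu>s))"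
        unfolding M[OF bs(2) OD_D(4)[OF \<nu>s]] Ber_submatrix_cols(3)[OF generic_dim[OF gU] bs(1) OD_D(1)[OF \<nu>s]]
        by (rule generic_invertible_bot[OF gU \<nu>s])
      show "Ber r (relation_matrix (u, v) as \<mu>s (bs @ \<nu>s)) = zpow ?t (int r + int s - 1) * antisym u bs \<nu>s"
        unfolding M[OF bs(2) OD_D(4)[OF \<nu>s]] Ber_mult[OF U g(1) bs(1,2) \<nu>s] Bg
          uc[of bs \<nu>s] antisym_Pluecker[OF U \<nu>s bs] by (simp only: mult.assoc)
    next
      fix bs \<nu>s assume s: "s \<ge> 1" and bs: "bs \<in> EV" and \<nu>s: "length \<nu>s = s" "set \<nu>s \<subseteq> inds" "few_even \<nu>s"
      show "Ber_star_defined r (relation_matrix (u, v) as \<mu>s (bs @ \<nu>s))"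
        unfolding M[OF EV_D(4)[OF bs] \<nu>s(2)] Ber_submatrix_cols(4)[OF generic_dim[OF gU] EV_D(1)[OF bs] \<nu>s(1)]
        by (rule generic_invertible_top[OF gU bs])
      show "Ber_star r (relation_matrix (u, v) as \<mu>s (bs @ \<nu>s)) = zpow ?t (- int r - int s + 1) * antisym v bs \<nu>s"
        unfolding M[OF EV_D(4)[OF bs] \<nu>s(2)] Ber_star_mult[OF U g(1) bs \<nu>s(1,2)] Bg'[OF s]
          vc[of bs \<nu>s] antisym_Pluecker_star[OF U bs \<nu>s] by (simp only: mult.assoc)
    qed
  qed
  note * = this
  show ?thesis
    unfolding super_Pluecker_relations_def prod.case Let_def
  proof (intro ballI conjI impI)
    fix as \<mu>s assume as: "as \<in> EV" and \<mu>s: "\<mu>s \<in> OD"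
    note ** = *[OF as \<mu>s]
    show "antisym u as \<mu>s * antisym v as \<mu>s = 1"
      using ** by blast
    {
      fix bs \<nu>s assume "bs \<in> even_tuples r" "\<nu>s \<in> OD"
      with ** show "Ber_defined r (relation_matrix (u, v) as \<mu>s (bs @ \<nu>s))"
        "Ber r (relation_matrix (u, v) as \<mu>s (bs @ \<nu>s)) = zpow (antisym u as \<mu>s) (int r + int s - 1) * antisym u bs \<nu>s"
        by (simp_all add: tuples_EV_D)
    next
      fix bs \<kappa> \<nu>s assume "r \<ge> 1" "bs \<in> even_tuples (r - 1)" "\<kappa> \<in> odd_inds n m" "\<nu>s \<in> OD"
      then have "length (bs @ [\<kappa>]) = r" "set (bs @ [\<kappa>]) \<subseteq> inds" "few_odd (bs @ [\<kappa>])"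
        by (auto simp: tuples_EV_D odd_inds_def dest: tuples_EV_D(2))
      with ** \<open>\<nu>s \<in> OD\<close> have "Ber_defined r (relation_matrix (u, v) as \<mu>s ((bs @ [\<kappa>]) @ \<nu>s)) \<and>
        Ber r (relation_matrix (u, v) as \<mu>s ((bs @ [\<kappa>]) @ \<nu>s)) = zpow (antisym u as \<mu>s) (int r + int s - 1) * antisym u (bs @ [\<kappa>]) \<nu>s"
        by blast
      then show "Ber_defined r (relation_matrix (u, v) as \<mu>s (bs @ [\<kappa>] @ \<nu>s))"
        "Ber r (relation_matrix (u, v) as \<mu>s (bs @ [\<kappa>] @ \<nu>s)) = zpow (antisym u as \<mu>s) (int r + int s - 1) * antisym u (bs @ [\<kappa>]) \<nu>s"
        by simp_all
    next
      fix bs c \<nu>s assume "s \<ge> 1" "bs \<in> EV" "c \<in> even_inds n" "\<nu>s \<in> odd_tuples (s - 1)"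
      then have "length (c # \<nu>s) = s" "set (c # \<nu>s) \<subseteq> inds" "few_even (c # \<nu>s)"
        by (auto simp: tuples_OD_D even_inds_def dest: tuples_OD_D(2))
      with ** \<open>s \<ge> 1\<close> \<open>bs \<in> EV\<close> have "Ber_star_defined r (relation_matrix (u, v) as \<mu>s (bs @ (c # \<nu>s))) \<and>
        Ber_star r (relation_matrix (u, v) as \<mu>s (bs @ (c # \<nu>s))) = zpow (antisym u as \<mu>s) (- int r - int s + 1) * antisym v bs (c # \<nu>s)"
        by blast
      then show "Ber_star_defined r (relation_matrix (u, v) as \<mu>s (bs @ [c] @ \<nu>s))"
        "Ber_star r (relation_matrix (u, v) as \<mu>s (bs @ [c] @ \<nu>s)) = zpow (antisym u as \<mu>s) (- int r - int s + 1) * antisym v bs (c # \<nu>s)"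
        by simp_all
    }
  qed
qed

end

section \<open>From the relations to points of the Grassmannian\<close>

context super_Pluecker
begin

text \<open>A unit Berezinian makes the Schur complement a - X c invertible, and a differs from it
  by X c, a product of odd matrices. In the converse the second relation supplies the invertible
  bottom block, while definedness of \<open>Ber_star\<close> is asserted only in the fourth
  relation, which is absent for s = 0.\<close>

lemma invertible_top_of_Ber:
  assumes U: "U \<in> mats" and ds: "ds \<in> EV" and es: "es \<in> OD"
    and bot: "invertible_mat (bot_cols r s U es)" and Ber: "invertible_elem (Ber r (sub U ds es))"
  shows "invertible_mat (top_cols r U ds)"
proof -
  have dim: "dim_row U = r + s"
    using U by (auto simp: even_supermats_def)
  define a b c d where "a = top_cols r U ds" and "b = top_cols r U es" and "c = bot_cols r s U ds" and "d = bot_cols r s U es"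
  have w: "a \<in> carrier_mat r r" "b \<in> carrier_mat r s" "c \<in> carrier_mat s r" "d \<in> carrier_mat s s"
    "homog False a" "homog True b" "homog True c" "homog False d" "invertible_mat d"
    unfolding a_def b_def c_def d_def
    using EV_D[OF ds] OD_D[OF es] even_supermats_cols[OF U] bot by auto
  note id = inv_matrix[OF w(4,9)] homog_inv_matrix[OF w(4,8,9)]
  define X where "X = b * inv_matrix d"
  have X: "X \<in> carrier_mat r s" "X * d = b"
    unfolding X_def using w(2,4) id(1,3) by (auto simp: mat_ring intro!: carrier_matI)
  have Xo: "homog True X"
    unfolding X_def using w(2) id(1) by (auto intro: homog_mult_True_False[OF w(6) id(4)])
  have S: "a - X * c \<in> carrier_mat r r" "homog False (a - X * c)"
    using w(1,3) X(1) by (auto intro!: carrier_matI homog_minus[OF w(5)] homog_mult_True_True[OF Xo w(7)])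
  have "Ber r (sub U ds es) = sdet (a - X * c) * inv_elem (sdet d)"
    unfolding Ber_submatrix_cols(1)[OF dim EV_D(1)[OF ds] OD_D(1)[OF es]] a_def[symmetric] b_def[symmetric] c_def[symmetric] d_def[symmetric]
    by (rule Ber_blocks_eqI[OF w(4,9) X])
  then have "invertible_elem (sdet (a - X * c))"
    using invertible_elem_factor[OF central_sdet[OF S(1) homog_central[OF S(2)]]] Ber by simp
  then have "invertible_mat (a - X * c)"
    by (simp add: invertible_elem_sdet_iff[OF S(1) homog_central[OF S(2)]])
  from invertible_mat_plus_odd[OF S this X(1) Xo w(3,7)]
  have "invertible_mat (a - X * c + X * c)" .
  also have "a - X * c + X * c = a"
    using w(1,3) X(1) by (intro eq_matI) (auto simp del: index_mult_mat(1))
  finally show ?thesis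
    by (simp add: a_def)
qed

text \<open>An upper entry has a wrong-parity label exactly when its column is odd, a lower entry
  exactly when its column is even; this is the parity pattern of an even supermatrix.\<close>

lemma relation_matrix_even:
  assumes p: "(u, v) \<in> hcoords" and as: "as \<in> EV" and \<mu>s: "\<mu>s \<in> OD"
  shows "relation_matrix (u, v) as \<mu>s [0..<n + m] \<in> mats"
proof -
  let ?R = "relation_matrix (u, v) as \<mu>s [0..<n + m]"
  note len = EV_D(1)[OF as] OD_D(1)[OF \<mu>s]
  have "?R $$ (i, j) \<in> A ((i < r) \<noteq> (j < n))" if ij: "i < r + s" "j < n + m" for i j
  proof (cases "i < r")
    case True
    note upd = EV_update[OF as ij(2) True]
    have "antisym u (as[i := j]) \<mu>s \<in> A (n \<le> j)"
      using antisym_parity[OF p \<mu>s upd(1-3)] unfolding upd(4) .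
    then show ?thesis
      using ij True len by (simp add: relation_matrix_def not_less)
  next
    case False
    then have k: "i - r < s"
      using ij by auto
    note upd = OD_update[OF \<mu>s ij(2) k]
    have "antisym v as (\<mu>s[i - r := j]) \<in> A (j < n)"
      using antisym_parity_star[OF p as upd(1-3)] unfolding upd(4) .
    then show ?thesis
      using ij False len by (simp add: relation_matrix_def)
  qed
  then show ?thesis
    using len by (auto simp: even_supermats_def relation_matrix_def)
qed

lemma relations_imp_Pluecker:
  assumes p: "(u, v) \<in> hcoords" and rel: "super_Pluecker_relations n m r s (u, v)"
  obtains U c where "generic U" "c \<in> A False" "invertible_elem c"
    "u = (\<lambda>ds es. c * fst (coords U) ds es)"
    "v = (\<lambda>ds es. inv_elem c * snd (coords U) ds es)"
proof -
  \<comment> \<open>Relations two to four are used for this one symbol; the first relation is used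
    for all symbols.\<close>
  define as \<mu>s where "as = [0..<r]" and "\<mu>s = [n..<n + s]"
  have as: "as \<in> EV" and \<mu>s: "\<mu>s \<in> OD"
    unfolding as_def \<mu>s_def by (fact first_EV first_OD)+
  define U where "U = relation_matrix (u, v) as \<mu>s [0..<n + m]"
  define t where "t = antisym u as \<mu>s"
  define z where "z = zpow t (int r + int s - 1)"
  have Ue: "U \<in> mats"
    unfolding U_def by (rule relation_matrix_even[OF p as \<mu>s])
  then have dim: "dim_row U = r + s"
    by (auto simp: even_supermats_def)
  have M: "relation_matrix (u, v) as \<mu>s (ds @ es) = sub U ds es"
    if "set ds \<subseteq> inds" "set es \<subseteq> inds" for ds es
    unfolding U_def relation_matrix_append[OF that] ..
  have one: "antisym u ds es * antisym v ds es = 1" if "ds \<in> EV" "es \<in> OD" for ds es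
    using rel that by (auto simp: super_Pluecker_relations_def Let_def)
  have two: "Ber_defined r (sub U bs \<nu>s)"
      "Ber r (sub U bs \<nu>s) = z * antisym u bs \<nu>s"
    if "bs \<in> even_tuples r" "\<nu>s \<in> OD" for bs \<nu>s
    using rel as \<mu>s that unfolding M[OF tuples_EV_D(2)[OF that(1)] OD_D(4)[OF that(2)], symmetric]
    by (auto simp: super_Pluecker_relations_def Let_def z_def t_def)
  have three: "Ber r (sub U (bs @ [\<kappa>]) \<nu>s) = z * antisym u (bs @ [\<kappa>]) \<nu>s"
    if "r \<ge> 1" "bs \<in> even_tuples (r - 1)" "\<kappa> \<in> odd_inds n m" "\<nu>s \<in> OD" for bs \<kappa> \<nu>s
  proof -
    have "set (bs @ [\<kappa>]) \<subseteq> inds"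
      using tuples_EV_D(2)[OF that(2)] that(3) by (auto simp: odd_inds_def)
    from M[OF this OD_D(4)[OF that(4)], symmetric] show ?thesis
      using rel as \<mu>s that by (auto simp: super_Pluecker_relations_def Let_def z_def t_def)
  qed
  have four: "Ber_star r (sub U bs (c # \<nu>s)) = zpow t (- int r - int s + 1) * antisym v bs (c # \<nu>s)"
    if "s \<ge> 1" "bs \<in> EV" "c \<in> even_inds n" "\<nu>s \<in> odd_tuples (s - 1)" for bs c \<nu>s
  proof -
    have "set (c # \<nu>s) \<subseteq> inds"
      using tuples_OD_D(2)[OF that(4)] that(3) by (auto simp: even_inds_def)
    from M[OF EV_D(4)[OF that(2)] this, symmetric] show ?thesis
      using rel as \<mu>s that by (auto simp: super_Pluecker_relations_def Let_def t_def)
  qed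
  have ue: "antisym u ds es \<in> A False" and ve: "antisym v ds es \<in> A False" if "ds \<in> EV" "es \<in> OD" for ds es
    using antisym_parity[OF p that(2) EV_D(1,4)[OF that(1)] EV_few(1)[OF that(1)]] EV_few(2)[OF that(1)]
      antisym_parity_star[OF p that(1) OD_D(1,4)[OF that(2)] OD_few(1)[OF that(2)]] OD_few(2)[OF that(2)]
    by simp_all
  have ui: "is_inverse (antisym u ds es) (antisym v ds es)" if "ds \<in> EV" "es \<in> OD" for ds es
    using one[OF that] centralD[OF even_central[OF ue[OF that]]] by (simp add: is_inverse_def)
  have te: "t \<in> A False" and ti: "invertible_elem t"
    unfolding t_def using ue[OF as \<mu>s] ui[OF as \<mu>s] by (auto simp: invertible_elem_def)
  have ze: "z \<in> A False" and zi: "invertible_elem z" and z': "zpow t (- int r - int s + 1) = inv_elem z"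
  proof -
    show "z \<in> A False"
      unfolding z_def by (rule even_zpow[OF te ti])
    have e: "- (int r + int s - 1) = - int r - int s + 1"
      by simp
    have i: "is_inverse z (zpow t (- int r - int s + 1))"
      using is_inverse_zpow[OF ti, of "int r + int s - 1"] unfolding z_def e .
    then show "invertible_elem z"
      unfolding invertible_elem_def by blast
    show "zpow t (- int r - int s + 1) = inv_elem z"
      by (rule inv_elem_eq[OF i, symmetric])
  qed
  have EVt: "ds \<in> even_tuples r" if "ds \<in> EV" for ds
    using that by (simp add: distinct_tuples_def)
  have bot: "invertible_mat (bot_cols r s U es)" if "es \<in> OD" for es
    using two(1)[OF EVt[OF as] that] Ber_submatrix_cols(3)[OF dim EV_D(1)[OF as] OD_D(1)[OF that]] by simp
  have U: "generic U"
    unfolding generic_def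
  proof (intro conjI ballI)
    fix ds es assume ds: "ds \<in> EV" and es: "es \<in> OD"
    \<comment> \<open>By the second relation this Berezinian is z times a coordinate, which is a
      unit by the first relation.\<close>
    have "invertible_elem (Ber r (sub U ds es))"
      unfolding two(2)[OF EVt[OF ds] es] using ui[OF ds es]
      by (intro invertible_elem_mult zi) (auto simp: invertible_elem_def)
    then have "invertible_mat (top_cols r U ds)"
      by (rule invertible_top_of_Ber[OF Ue ds es bot[OF es]])
    then show "frame r s U ds es"
      unfolding GL_blocks_def using bot[OF es] EV_D[OF ds] OD_D[OF es] even_supermats_cols[OF Ue] by auto
  qed (rule Ue)
  \<comment> \<open>The Berezinian coordinates of U are z and z^-1 times the given ones, so the
    rescaling undoes z.\<close>
  define c where "c = inv_elem z"
  have c: "c \<in> A False" "invertible_elem c" "inv_elem c = z"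
    unfolding c_def using ze zi by (simp_all add: even_inv_elem invertible_elem_inv_elem inv_elem_inv_elem)
  have cz: "c * (z * x) = x" for x
    unfolding c_def using zi by (simp add: mult.assoc[symmetric])
  have zc: "z * (inv_elem z * x) = x" for x
    using zi by (simp add: mult.assoc[symmetric])
  have u: "u ds es = c * fst (coords U) ds es" for ds es
  proof -
    consider "(ds, es) \<in> RS" | "(ds, es) \<in> WS"
      | "(ds, es) \<notin> RS \<union> WS"
      by blast
    then show ?thesis
    proof cases
      case 1
      note d = right_symbols_D[OF 1]
      show ?thesis
        using 1 two(2)[OF EVt[OF d(1)] d(2)] antisym_sorted[OF d(3-5), of u] by (simp add: Pluecker_coords_def cz)
    next
      case 2
      then obtain bs \<kappa> where d: "r \<ge> 1" "ds = bs @ [\<kappa>]" "bs \<in> even_tuples (r - 1)" "\<kappa> \<in> odd_inds n m" 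
        "es \<in> OD" "sorted ds" "sorted es" "distinct (ds @ es)"
        by (rule wrong_symbols_D)
      show ?thesis
        using 2 three[OF d(1,3,4,5)] antisym_sorted[OF d(6-8), of u] unfolding d(2)[symmetric]
        by (simp add: Pluecker_coords_def cz)
    next
      \<comment> \<open>Outside the coordinate symbols both sides are the default value 0.\<close>
      case 3
      then show ?thesis
        using p by (auto simp: homogeneous_coords_def Pluecker_coords_def)
    qed
  qed
  have v: "v ds es = inv_elem c * snd (coords U) ds es" for ds es
  proof -
    consider "(ds, es) \<in> RS" | "(ds, es) \<in> WS_star"
      | "(ds, es) \<notin> RS \<union> WS_star"
      by blast
    then show ?thesis
    proof cases
      case 1
      note d = right_symbols_D[OF 1]
      \<comment> \<open>No relation gives \<open>Ber_star\<close> on right-parity symbols. It is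
        recovered by uniqueness of inverses: \<open>Ber_star\<close> inverts \<open>Ber\<close>, and
        v inverts u by the first relation.\<close>
      have "is_inverse (z * antisym u ds es) (Ber_star r (sub U ds es))"
        using Ber_right(1)[OF U d(1,2)] unfolding two(2)[OF EVt[OF d(1)] d(2)] .
      moreover have "is_inverse (z * antisym u ds es) (antisym v ds es * inv_elem z)"
        by (intro is_inverse_mult is_inverse_inv_elem zi ui d)
      ultimately have "Ber_star r (sub U ds es) = antisym v ds es * inv_elem z"
        by (rule is_inverse_unique)
      also have "\<dots> = inv_elem z * antisym v ds es"
        by (rule centralD[OF even_central[OF ve[OF d(1,2)]]])
      finally show ?thesis
        using 1 antisym_sorted[OF d(3-5), of v] by (simp add: Pluecker_coords_def c(3) zc)
    next
      case 2
      then obtain b \<nu>s where d: "s \<ge> 1" "es = b # \<nu>s" "\<nu>s \<in> odd_tuples (s - 1)" "b \<in> even_inds n"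
        "ds \<in> EV" "sorted ds" "sorted es" "distinct (ds @ es)" 
        by (rule wrong_symbols_star_D)
      show ?thesis
        using 2 four[OF d(1,5,4,3)] antisym_sorted[OF d(6-8), of v] unfolding d(2)[symmetric] z'
        by (simp add: Pluecker_coords_def c(3) zc)
    next
      case 3
      then show ?thesis
        using p by (auto simp: homogeneous_coords_def Pluecker_coords_def)
    qed
  qed
  show ?thesis
    by (rule that[OF U c(1,2)]) (use u v in \<open>auto intro!: ext\<close>)
qed

section \<open>The image of the super Pluecker map\<close>

lemma super_Pluecker_map_image:
  assumes p: "p \<in> hcoords"
  shows "wrel `` {p} \<in> pmap ` pdom \<longleftrightarrow>
    super_Pluecker_relations n m r s p"
proof
  obtain u v where uv: "p = (u, v)"
    by fastforce
  assume "wrel `` {p} \<in> pmap ` pdom"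
  then obtain U where U: "generic U"
    and eq: "wrel `` {p} = wrel `` {coords U}"
    using super_Pluecker_map_class(1) by (auto elim!: Pluecker_domain_gen)
  \<comment> \<open>Equality of classes makes p a rescaling of \<open>coords U\<close>; the factor c
    in \<open>Pluecker_imp_relations\<close> is there for this purpose.\<close>
  have "(coords U, p) \<in> wrel"
    using eq weighted_rel_refl[OF p] by blast
  then obtain c where "c \<in> A False" "invertible_elem c"
    "u = (\<lambda>ds es. c * fst (coords U) ds es)"
    "v = (\<lambda>ds es. inv_elem c * snd (coords U) ds es)"
    unfolding uv using weighted_rel_iff[of "fst (coords U)" "snd (coords U)"] by auto
  then show "super_Pluecker_relations n m r s p"
    unfolding uv by (rule Pluecker_imp_relations[OF U])
next
  obtain u v where uv: "p = (u, v)"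
    by fastforce
  assume "super_Pluecker_relations n m r s p"
  then obtain U c where U: "generic U" and c: "c \<in> A False" "invertible_elem c"
    "u = (\<lambda>ds es. c * fst (coords U) ds es)"
    "v = (\<lambda>ds es. inv_elem c * snd (coords U) ds es)"
    using p relations_imp_Pluecker[of u v] unfolding uv by blast
  have "(coords U, p) \<in> wrel"
    unfolding uv using weighted_rel_iff[of "fst (coords U)" "snd (coords U)"]
      Pluecker_coords_homogeneous[OF U] p uv c by auto
  then have "wrel `` {p} = pmap (glrel `` {U})"
    using super_Pluecker_map_class(1)[OF U] weighted_rel_class_eq by simp
  then show "wrel `` {p} \<in> pmap ` pdom"
    using super_Pluecker_map_class(2)[OF U] by blast
qed

lemma super_Pluecker_map_projective:
  "pmap ` pdom \<subseteq> weighted_projective A n m r s"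
proof
  fix P assume "P \<in> pmap ` pdom"
  then obtain \<Gamma> where "\<Gamma> \<in> pdom" "P = pmap \<Gamma>"
    by blast
  then obtain U where U: "generic U" "P = wrel `` {coords U}"
    using super_Pluecker_map_class(1) by (metis Pluecker_domain_gen)
  then show "P \<in> weighted_projective A n m r s"
    using Pluecker_coords_homogeneous[OF U(1)] by (auto simp: weighted_projective_def intro: quotientI)
qed

end

theorem theorem9:
  fixes A :: "bool \<Rightarrow> 'a::ring_1 set" and n m r s :: nat
  assumes "comm_superalgebra A" and "r \<le> n" and "s \<le> m"
  shows "super_Pluecker_map A n m r s ` Pluecker_domain A n m r s \<subseteq> weighted_projective A n m r s \<and>
    (\<forall>p \<in> homogeneous_coords A n m r s.
      weighted_rel A n m r s `` {p} \<in> super_Pluecker_map A n m r s ` Pluecker_domain A n m r s \<longleftrightarrow>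
      super_Pluecker_relations n m r s p)"
proof -
  interpret super_Pluecker A n m r s
    by unfold_locales (fact assms)+
  show ?thesis
    using super_Pluecker_map_projective super_Pluecker_map_image by blast
qed

end
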